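(* Let $n\ge3$ and $\alpha\in\mathbb Q$, $\alpha\ne0$. Let $Z_{\alpha,2n}\subset\mathbb P^{2n+1}$ be the quadric defined by $$Q_{\alpha,2n}=u_1^2+\frac1{\alpha^2}(u_2^2+u_3^2+u_4^2)+u_5^2+u_6^2+\cdots+u_{2n+1}^2+u_{2n+2}^2.$$ Over the quadratic field extension $\mathbb K=\mathbb Q(\sqrt{-1})$, the complement of $Z_{\alpha,2n}$ has Grothendieck class $$[\mathbb P^{2n+1}\smallsetminus Z_{\alpha,2n}]=\mathbb L^{2n+1}-\mathbb L^n.$$ The affine complement of $\widehat{CZ}_{\alpha,2n}$ has class $$[\mathbb A^{2n+3}\smallsetminus\widehat{CZ}_{\alpha,2n}]=\mathbb L^{2n+3}-\mathbb L^{2n+2}-\mathbb L^{n+2}+\mathbb L^{n+1},$$ and the affine complement of the union $\widehat{CZ}_{\alpha,2n}\cup H_0\cup H_1$, with $H_0=\{u_0=0\}$ and $H_1=\{u_0=1\}$, has class $$[\mathbb A^{2n+3}\smallsetminus(\widehat{CZ}_{\alpha,2n}\cup H_0\cup H_1)]=\mathbb L^{2n+3}-3\mathbb L^{2n+2}+2\mathbb L^{2n+1}-\mathbb L^{n+2}+3\mathbb L^{n+1}-2\mathbb L^n.$$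
   Context: Classes are taken in the Grothendieck ring of varieties $K_0(\mathcal V_{\mathbb K})$ over $\mathbb K=\mathbb Q(\sqrt{-1})$, with $\mathbb L=[\mathbb A^1]$. The hypersurface $\widehat{CZ}_{\alpha,2n}\subset\mathbb A^{2n+3}$ is the zero set of $Q_{\alpha,2n}(u_1,\dots,u_{2n+2})$ in the affine space with coordinates $(u_0,u_1,\dots,u_{2n+2})$ (the affine cone over the projective cone in $\mathbb P^{2n+2}$ of $Z_{\alpha,2n}$). *)

theory Defs
  imports "HOL-Analysis.Analysis" "HOL-Library.Poly_Mapping" "HOL-Library.Multiset"
begin

text \<open>
  Varieties over \<open>\<rat>(\<surd>-1)\<close> in the language of spaces with functions, with \<open>\<complex>\<close> as universal
  domain. The points of a variety are its complex points; the topology is the Zariski topology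
  over the ground field (closed sets are cut out by equations with coefficients in
  \<open>\<rat>(\<surd>-1)\<close>), and regular functions are locally quotients of polynomials with coefficients in
  \<open>\<rat>(\<surd>-1)\<close>. By the Nullstellensatz these are the reduced separated schemes of finite type over
  \<open>\<rat>(\<surd>-1)\<close>; they may be empty or reducible.
\<close>

definition gauss_rat :: "complex set" where
  "gauss_rat = {of_rat a + \<i> * of_rat b | a b. True}"


section \<open>Spaces with functions\<close>

text \<open>Sections over \<open>U\<close> are functions on \<open>U\<close>, made unique by extensionality outside \<open>U\<close>.
  Only the values of \<open>sections\<close> at open sets are relevant.\<close>

datatype 'a fspace = FSpace (zar: "'a topology") (sections: "'a set \<Rightarrow> ('a \<Rightarrow> complex) set")

abbreviation points :: "'a fspace \<Rightarrow> 'a set" where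
  "points X \<equiv> topspace (zar X)"

definition is_sheaf :: "'a fspace \<Rightarrow> bool" where
  "is_sheaf X \<longleftrightarrow> (\<forall>U. openin (zar X) U \<longrightarrow>
     sections X U \<subseteq> extensional U \<and>
     (\<forall>f\<in>sections X U. \<forall>W. openin (zar X) W \<and> W \<subseteq> U \<longrightarrow> restrict f W \<in> sections X W) \<and>
     (\<forall>f\<in>extensional U.
        (\<forall>x\<in>U. \<exists>W. openin (zar X) W \<and> x \<in> W \<and> W \<subseteq> U \<and> restrict f W \<in> sections X W)
        \<longrightarrow> f \<in> sections X U))"

text \<open>For locally closed \<open>S\<close> this is the induced reduced structure.\<close>

definition subspace_of :: "'a fspace \<Rightarrow> 'a set \<Rightarrow> 'a fspace" where
  "subspace_of X S = FSpace (subtopology (zar X) S)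
     (\<lambda>U. {f \<in> extensional U. \<forall>x\<in>U. \<exists>V. \<exists>g\<in>sections X V.
        openin (zar X) V \<and> x \<in> V \<and> (\<forall>y\<in>U \<inter> V. f y = g y)})"

definition morphism :: "'a fspace \<Rightarrow> 'b fspace \<Rightarrow> ('a \<Rightarrow> 'b) \<Rightarrow> bool" where
  "morphism X Y \<phi> \<longleftrightarrow> continuous_map (zar X) (zar Y) \<phi> \<and>
     (\<forall>U. openin (zar Y) U \<longrightarrow> (\<forall>f\<in>sections Y U.
        restrict (f \<circ> \<phi>) {x \<in> points X. \<phi> x \<in> U} \<in> sections X {x \<in> points X. \<phi> x \<in> U}))"

definition isomorphic :: "'a fspace \<Rightarrow> 'b fspace \<Rightarrow> bool" (infix "\<cong>\<^sub>v" 50) where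
  "X \<cong>\<^sub>v Y \<longleftrightarrow> (\<exists>\<phi> \<psi>. morphism X Y \<phi> \<and> morphism Y X \<psi> \<and>
     (\<forall>x\<in>points X. \<psi> (\<phi> x) = x) \<and> (\<forall>y\<in>points Y. \<phi> (\<psi> y) = y))"


section \<open>Affine and projective space\<close>

text \<open>Coordinates are indexed by a finite set \<open>I\<close> of natural numbers, so that \<open>affine_space I\<close> has
  dimension \<open>card I\<close> and \<open>proj_space I\<close> has dimension \<open>card I - 1\<close>.\<close>

inductive_set poly_fun :: "nat set \<Rightarrow> ((nat \<Rightarrow> complex) \<Rightarrow> complex) set" for I :: "nat set" where
  const: "c \<in> gauss_rat \<Longrightarrow> (\<lambda>_. c) \<in> poly_fun I"
| coord: "i \<in> I \<Longrightarrow> (\<lambda>u. u i) \<in> poly_fun I"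
| add: "p \<in> poly_fun I \<Longrightarrow> q \<in> poly_fun I \<Longrightarrow> (\<lambda>u. p u + q u) \<in> poly_fun I"
| mult: "p \<in> poly_fun I \<Longrightarrow> q \<in> poly_fun I \<Longrightarrow> (\<lambda>u. p u * q u) \<in> poly_fun I"

abbreviation vectors :: "nat set \<Rightarrow> (nat \<Rightarrow> complex) set" where
  "vectors I \<equiv> I \<rightarrow>\<^sub>E UNIV"

definition affine_space :: "nat set \<Rightarrow> (nat \<Rightarrow> complex) fspace" where
  "affine_space I = FSpace
     (topology_generated_by {{u \<in> vectors I. p u \<noteq> 0} | p. p \<in> poly_fun I})
     (\<lambda>U. {f \<in> extensional U. \<forall>x\<in>U. \<exists>p\<in>poly_fun I. \<exists>q\<in>poly_fun I.
        q x \<noteq> 0 \<and> (\<forall>y\<in>U. q y \<noteq> 0 \<longrightarrow> f y = p y / q y)})"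

text \<open>Forms of degree \<open>d\<close>; over an infinite field homogeneity of a polynomial can be tested on
  the polynomial function.\<close>

definition form_fun :: "nat set \<Rightarrow> nat \<Rightarrow> ((nat \<Rightarrow> complex) \<Rightarrow> complex) set" where
  "form_fun I d = {p \<in> poly_fun I. \<forall>u\<in>vectors I. \<forall>c. p (\<lambda>i\<in>I. c * u i) = c ^ d * p u}"

text \<open>A point of projective space is the set of all its homogeneous coordinate vectors.\<close>

definition proj_point :: "nat set \<Rightarrow> (nat \<Rightarrow> complex) \<Rightarrow> (nat \<Rightarrow> complex) set" where
  "proj_point I u = {(\<lambda>i\<in>I. c * u i) | c. c \<noteq> 0}"

definition proj_points :: "nat set \<Rightarrow> (nat \<Rightarrow> complex) set set" where
  "proj_points I = proj_point I ` {u \<in> vectors I. \<exists>i\<in>I. u i \<noteq> 0}"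

definition proj_space :: "nat set \<Rightarrow> (nat \<Rightarrow> complex) set fspace" where
  "proj_space I = FSpace
     (topology_generated_by {{P \<in> proj_points I. \<forall>u\<in>P. p u \<noteq> 0} | p d. p \<in> form_fun I d})
     (\<lambda>U. {f \<in> extensional U. \<forall>P\<in>U. \<exists>d. \<exists>p\<in>form_fun I d. \<exists>q\<in>form_fun I d.
        (\<forall>u\<in>P. q u \<noteq> 0) \<and> (\<forall>R\<in>U. \<forall>u\<in>R. q u \<noteq> 0 \<longrightarrow> f R = p u / q u)})"


section \<open>Varieties\<close>

definition affine_variety :: "'a fspace \<Rightarrow> bool" where
  "affine_variety X \<longleftrightarrow> (\<exists>I V. finite I \<and> closedin (zar (affine_space I)) V \<and>
     X \<cong>\<^sub>v subspace_of (affine_space I) V)"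

definition prevariety :: "'a fspace \<Rightarrow> bool" where
  "prevariety X \<longleftrightarrow> is_sheaf X \<and>
     (\<exists>\<U>. finite \<U> \<and> \<Union>\<U> = points X \<and>
        (\<forall>U\<in>\<U>. openin (zar X) U \<and> affine_variety (subspace_of X U)))"

text \<open>The diagonal is closed, expressed through equalizers of morphisms from affine varieties.\<close>

definition separated :: "'a fspace \<Rightarrow> bool" where
  "separated X \<longleftrightarrow> (\<forall>I V \<phi> \<psi>. finite I \<longrightarrow> closedin (zar (affine_space I)) V \<longrightarrow>
     morphism (subspace_of (affine_space I) V) X \<phi> \<longrightarrow>
     morphism (subspace_of (affine_space I) V) X \<psi> \<longrightarrow>
     closedin (zar (subspace_of (affine_space I) V)) {x \<in> V. \<phi> x = \<psi> x})"

definition is_variety :: "'a fspace \<Rightarrow> bool" where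
  "is_variety X \<longleftrightarrow> prevariety X \<and> separated X"

lemma is_variety_empty: "is_variety (FSpace (discrete_topology {}) extensional)"
proof -
  let ?E = "FSpace (discrete_topology {}) extensional :: 'a fspace"
  have "prevariety ?E"
    unfolding prevariety_def is_sheaf_def by (auto intro!: exI[of _ "{}"])
  moreover have "{x \<in> V. \<phi> x = \<psi> x} = {}"
    if V: "closedin (zar (affine_space I)) V"
      and \<phi>: "morphism (subspace_of (affine_space I) V) ?E \<phi>" for I V \<phi> \<psi>
    using \<phi> closedin_subset[OF V]
    by (auto simp: morphism_def subspace_of_def continuous_map_def Int_absorb1)
  then have "separated ?E"
    unfolding separated_def by (metis closedin_empty)
  ultimately show ?thesis
    by (simp add: is_variety_def)
qed

text \<open>Every variety has at most continuum many points, so up to isomorphism all varieties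
  occur with points in the type below.\<close>

typedef variety = "{X :: (nat \<Rightarrow> complex) set fspace. is_variety X}"
  using is_variety_empty by blast

text \<open>Products are characterised by their universal property; over a field of characteristic \<open>0\<close>
  this is the fibre product of schemes over the ground field, as that is already reduced.\<close>

definition is_product :: "variety \<Rightarrow> variety \<Rightarrow> variety \<Rightarrow> bool" where
  "is_product P X Y \<longleftrightarrow> (\<exists>p q.
     morphism (Rep_variety P) (Rep_variety X) p \<and> morphism (Rep_variety P) (Rep_variety Y) q \<and>
     (\<forall>Z f g. morphism (Rep_variety Z) (Rep_variety X) f \<longrightarrow>
        morphism (Rep_variety Z) (Rep_variety Y) g \<longrightarrow>
        (\<exists>h. morphism (Rep_variety Z) (Rep_variety P) h \<and>
           (\<forall>z\<in>points (Rep_variety Z). p (h z) = f z \<and> q (h z) = g z) \<and>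
           (\<forall>h'. morphism (Rep_variety Z) (Rep_variety P) h' \<longrightarrow>
              (\<forall>z\<in>points (Rep_variety Z). p (h' z) = f z \<and> q (h' z) = g z) \<longrightarrow>
              (\<forall>z\<in>points (Rep_variety Z). h' z = h z)))))"


section \<open>The Grothendieck ring of varieties\<close>

text \<open>\<open>variety multiset \<Rightarrow>\<^sub>0 int\<close> is the polynomial ring over the integers with one indeterminate
  for each variety, a multiset being a monomial. The Grothendieck ring is its quotient by the
  ideal generated by the isomorphism, scissor, product and unit relations.\<close>

type_synonym free_ring = "variety multiset \<Rightarrow>\<^sub>0 int"

definition gen :: "variety \<Rightarrow> free_ring" where
  "gen X = Poly_Mapping.single {#X#} 1"

definition iso_relations :: "free_ring set" where
  "iso_relations = {gen X - gen Y | X Y. Rep_variety X \<cong>\<^sub>v Rep_variety Y}"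

definition scissor_relations :: "free_ring set" where
  "scissor_relations = {gen X - (gen Y + gen U) | X Y U. \<exists>C. closedin (zar (Rep_variety X)) C \<and>
     Rep_variety Y \<cong>\<^sub>v subspace_of (Rep_variety X) C \<and>
     Rep_variety U \<cong>\<^sub>v subspace_of (Rep_variety X) (points (Rep_variety X) - C)}"

definition product_relations :: "free_ring set" where
  "product_relations = {gen X * gen Y - gen P | X Y P. is_product P X Y}"

definition unit_relations :: "free_ring set" where
  "unit_relations = {gen X - 1 | X. Rep_variety X \<cong>\<^sub>v affine_space {}}"

lemma module_free_ring: "module ((*) :: free_ring \<Rightarrow> free_ring \<Rightarrow> free_ring)"
  by unfold_locales (simp_all add: algebra_simps)

definition K0_ideal :: "free_ring set" where
  "K0_ideal = module.span (*)
     (iso_relations \<union> scissor_relations \<union> product_relations \<union> unit_relations)"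

lemma K0_ideal_zero: "0 \<in> K0_ideal"
  unfolding K0_ideal_def by (rule module.span_zero[OF module_free_ring])

lemma K0_ideal_add: "a \<in> K0_ideal \<Longrightarrow> b \<in> K0_ideal \<Longrightarrow> a + b \<in> K0_ideal"
  unfolding K0_ideal_def by (rule module.span_add[OF module_free_ring])

lemma K0_ideal_uminus: "a \<in> K0_ideal \<Longrightarrow> - a \<in> K0_ideal"
  unfolding K0_ideal_def by (rule module.span_neg[OF module_free_ring])

lemma K0_ideal_mult: "a \<in> K0_ideal \<Longrightarrow> c * a \<in> K0_ideal"
  unfolding K0_ideal_def by (rule module.span_scale[OF module_free_ring])

definition K0_rel :: "free_ring \<Rightarrow> free_ring \<Rightarrow> bool" where
  "K0_rel a b \<longleftrightarrow> a - b \<in> K0_ideal"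

lemma equivp_K0_rel: "equivp K0_rel"
proof (rule equivpI)
  show "reflp K0_rel"
    by (simp add: reflp_def K0_rel_def K0_ideal_zero)
  show "symp K0_rel"
    unfolding symp_def K0_rel_def using K0_ideal_uminus by fastforce
  show "transp K0_rel"
    unfolding transp_def K0_rel_def using K0_ideal_add by fastforce
qed

quotient_type K0 = free_ring / K0_rel
  by (rule equivp_K0_rel)

instantiation K0 :: comm_ring
begin

lift_definition zero_K0 :: K0 is 0 .

lift_definition plus_K0 :: "K0 \<Rightarrow> K0 \<Rightarrow> K0" is "(+)"
  unfolding K0_rel_def using K0_ideal_add by (metis add_diff_add)

lift_definition uminus_K0 :: "K0 \<Rightarrow> K0" is uminus
  unfolding K0_rel_def using K0_ideal_uminus by (metis minus_diff_minus)

lift_definition minus_K0 :: "K0 \<Rightarrow> K0 \<Rightarrow> K0" is "(-)"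
proof -
  fix a b c d assume "K0_rel a b" "K0_rel c d"
  then have "(a - b) + - (c - d) \<in> K0_ideal"
    unfolding K0_rel_def by (intro K0_ideal_add K0_ideal_uminus)
  then show "K0_rel (a - c) (b - d)"
    unfolding K0_rel_def by (simp add: algebra_simps)
qed

lift_definition times_K0 :: "K0 \<Rightarrow> K0 \<Rightarrow> K0" is "(*)"
proof -
  fix a b c d assume "K0_rel a b" "K0_rel c d"
  then have "c * (a - b) + b * (c - d) \<in> K0_ideal"
    unfolding K0_rel_def by (intro K0_ideal_add K0_ideal_mult)
  then show "K0_rel (a * c) (b * d)"
    unfolding K0_rel_def by (simp add: algebra_simps)
qed

instance
proof
  fix a b c :: K0
  show "a * b * c = a * (b * c)" by transfer (simp add: K0_rel_def K0_ideal_zero mult.assoc)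
  show "a * b = b * a" by transfer (simp add: K0_rel_def K0_ideal_zero mult.commute)
  show "(a + b) * c = a * c + b * c" 
    by transfer (simp add: K0_rel_def K0_ideal_zero distrib_right)
  show "a + b + c = a + (b + c)" by transfer (simp add: K0_rel_def K0_ideal_zero add.assoc)
  show "a + b = b + a" by transfer (simp add: K0_rel_def K0_ideal_zero add.commute)
  show "0 + a = a" by transfer (simp add: K0_rel_def K0_ideal_zero)
  show "- a + a = 0" by transfer (simp add: K0_rel_def K0_ideal_zero)
  show "a - b = a + - b" by transfer (simp add: K0_rel_def K0_ideal_zero)
qed

end

text \<open>\<open>comm_ring_1\<close> would in addition require \<open>0 \<noteq> 1\<close>, i.e. the existence of a nontrivial
  motivic invariant; powers and numerals are available without it.\<close>

instantiation K0 :: comm_monoid_mult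
begin

lift_definition one_K0 :: K0 is 1 .

instance
  by standard (transfer, simp add: K0_rel_def K0_ideal_zero)

end

instance K0 :: semiring_numeral ..

lift_definition K0_gen :: "variety \<Rightarrow> K0" is gen .

text \<open>The class of a variety with points of any type; meaningful exactly for (spaces isomorphic
  to) varieties, and independent of the choice by the isomorphism relations.\<close>

definition K0_class :: "'a fspace \<Rightarrow> K0" where
  "K0_class X = K0_gen (SOME V. Rep_variety V \<cong>\<^sub>v X)"

definition lefschetz :: K0 ("\<bbbL>") where
  "\<bbbL> = K0_class (affine_space {0})"


section \<open>The quadrics\<close>

definition Q :: "rat \<Rightarrow> nat \<Rightarrow> (nat \<Rightarrow> complex) \<Rightarrow> complex" where
  "Q \<alpha> n u = (u 1)\<^sup>2 + 1 / (of_rat \<alpha>)\<^sup>2 * ((u 2)\<^sup>2 + (u 3)\<^sup>2 + (u 4)\<^sup>2) + (\<Sum>i=5..2*n+2. (u i)\<^sup>2)"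

definition quadric :: "rat \<Rightarrow> nat \<Rightarrow> (nat \<Rightarrow> complex) set set" where
  "quadric \<alpha> n = {P \<in> points (proj_space {1..2*n+2}). \<forall>u\<in>P. Q \<alpha> n u = 0}"

definition affine_cone :: "rat \<Rightarrow> nat \<Rightarrow> (nat \<Rightarrow> complex) set" where
  "affine_cone \<alpha> n = {u \<in> points (affine_space {0..2*n+2}). Q \<alpha> n u = 0}"

definition hyperplane :: "nat \<Rightarrow> complex \<Rightarrow> (nat \<Rightarrow> complex) set" where
  "hyperplane n c = {u \<in> points (affine_space {0..2*n+2}). u 0 = c}"

definition complement :: "'a fspace \<Rightarrow> 'a set \<Rightarrow> 'a fspace" where
  "complement X S = subspace_of X (points X - S)"

end

(* The class is computed by stratification. Over the Gaussian rationals the quadratic form becomes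
   q = x_1 y_1 + ... + x_m y_m with m = n + 1. On the locus x_1 = ... = x_(j-1) = 0, x_j \<noteq> 0 one can
   solve q = t for y_j and use t as a coordinate instead; in affine N-space the part of this locus
   with q \<noteq> 0 is therefore the complement of two coordinate hyperplanes in affine space of
   dimension N - (j - 1), and in projective space, where x_j = 1, the complement of one. The classes
   of the strata telescope.
   Projective space enters only through one isomorphism: the complement of a quadric is affine, and
   u \<mapsto> (u_a u_b / q(u)) identifies it with the symmetric matrices of rank one with q = 1. *)

theory Submission
  imports Defs
begin

section \<open>Morphisms and subspaces\<close>

text \<open>\<open>K0_class\<close> picks a representative by Hilbert choice and is informative only
  for spaces isomorphic to a variety, so each use of the scissor relation needs all three spaces
  involved to be varieties. General quasi-projective varieties are avoided: every piece that is cut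
  lies in some affine space and is given by equations and a single inequation, hence is affine by
  Rabinowitsch's trick, and for affine pieces separatedness and finite charts come cheaply. This is
  also why the projective complement is replaced by a closed set of matrices before it is cut.
  Product relations are applied to affine spaces only; because every stratum becomes a complement of
  coordinate hyperplanes, no fibration has to be analysed. Still, the universal property of a
  product ranges over all varieties, so the functions on an arbitrary variety must be known to admit
  sums, products and inverses. That is the purpose of the predicate \<open>ringed\<close>.\<close>

lemma zar_subspace_of [simp]: "zar (subspace_of X S) = subtopology (zar X) S"
  by (simp add: subspace_of_def)

lemma sections_subspace_of:
  "f \<in> sections (subspace_of X S) U \<longleftrightarrow> f \<in> extensional U \<and>
     (\<forall>x\<in>U. \<exists>V. \<exists>g\<in>sections X V. openin (zar X) V \<and> x \<in> V \<and> (\<forall>y\<in>U \<inter> V. f y = g y))"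
  by (simp add: subspace_of_def)

lemma morphism_pullback:
  assumes "morphism X Y \<phi>" "openin (zar Y) U" "f \<in> sections Y U"
  shows "restrict (f \<circ> \<phi>) {x \<in> points X. \<phi> x \<in> U} \<in> sections X {x \<in> points X. \<phi> x \<in> U}"
  using assms by (simp add: morphism_def)

lemma morphism_open_preimage:
  assumes "morphism X Y \<phi>" "openin (zar Y) U"
  shows "openin (zar X) {x \<in> points X. \<phi> x \<in> U}"
  using assms by (simp add: morphism_def continuous_map_def)

lemma morphism_point:
  assumes "morphism X Y \<phi>" "x \<in> points X"
  shows "\<phi> x \<in> points Y"
  using assms by (auto simp add: morphism_def continuous_map_def Pi_iff)

lemma morphism_comp:
  assumes "morphism X Y \<phi>" "morphism Y Z \<psi>"
  shows "morphism X Z (\<psi> \<circ> \<phi>)"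
  unfolding morphism_def
proof (intro conjI allI impI ballI)
  show "continuous_map (zar X) (zar Z) (\<psi> \<circ> \<phi>)"
    using assms by (auto simp: morphism_def intro: continuous_map_compose)
  fix U f assume U: "openin (zar Z) U" "f \<in> sections Z U"
  let ?W = "{y \<in> points Y. \<psi> y \<in> U}"
  have "restrict (restrict (f \<circ> \<psi>) ?W \<circ> \<phi>) {x \<in> points X. \<phi> x \<in> ?W}
      \<in> sections X {x \<in> points X. \<phi> x \<in> ?W}"
    by (intro morphism_pullback[OF assms(1)] morphism_open_preimage[OF assms(2)]
        morphism_pullback[OF assms(2)] U)
  moreover have "{x \<in> points X. \<phi> x \<in> ?W} = {x \<in> points X. (\<psi> \<circ> \<phi>) x \<in> U}"
    using morphism_point[OF assms(1)] by auto
  moreover have "restrict (restrict (f \<circ> \<psi>) ?W \<circ> \<phi>) {x \<in> points X. (\<psi> \<circ> \<phi>) x \<in> U}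
      = restrict (f \<circ> (\<psi> \<circ> \<phi>)) {x \<in> points X. (\<psi> \<circ> \<phi>) x \<in> U}"
    using morphism_point[OF assms(1)] by (auto simp: fun_eq_iff)
  ultimately show "restrict (f \<circ> (\<psi> \<circ> \<phi>)) {x \<in> points X. (\<psi> \<circ> \<phi>) x \<in> U}
      \<in> sections X {x \<in> points X. (\<psi> \<circ> \<phi>) x \<in> U}"
    by simp
qed

lemma isomorphic_sym: "X \<cong>\<^sub>v Y \<Longrightarrow> Y \<cong>\<^sub>v X"
  unfolding isomorphic_def by blast

lemma isomorphic_trans:
  assumes "X \<cong>\<^sub>v Y" "Y \<cong>\<^sub>v Z"
  shows "X \<cong>\<^sub>v Z"
proof -
  obtain \<phi> \<psi> where 1: "morphism X Y \<phi>" "morphism Y X \<psi>"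
    "\<forall>x\<in>points X. \<psi> (\<phi> x) = x" "\<forall>y\<in>points Y. \<phi> (\<psi> y) = y"
    using assms(1) unfolding isomorphic_def by blast
  obtain \<phi>' \<psi>' where 2: "morphism Y Z \<phi>'" "morphism Z Y \<psi>'"
    "\<forall>x\<in>points Y. \<psi>' (\<phi>' x) = x" "\<forall>y\<in>points Z. \<phi>' (\<psi>' y) = y"
    using assms(2) unfolding isomorphic_def by blast
  show ?thesis
    unfolding isomorphic_def
    using morphism_comp[OF 1(1) 2(1)] morphism_comp[OF 2(2) 1(2)] 1 2
      morphism_point[OF 1(1)] morphism_point[OF 2(2)]
    by (intro exI[of _ "\<phi>' \<circ> \<phi>"] exI[of _ "\<psi> \<circ> \<psi>'"]) auto
qed

section \<open>Consequences of the sheaf axioms for subspaces and morphisms\<close>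

lemma sections_extensional:
  "is_sheaf X \<Longrightarrow> openin (zar X) U \<Longrightarrow> f \<in> sections X U \<Longrightarrow> f \<in> extensional U"
  unfolding is_sheaf_def by blast

lemma sections_restrict:
  "is_sheaf X \<Longrightarrow> openin (zar X) U \<Longrightarrow> f \<in> sections X U \<Longrightarrow> openin (zar X) W \<Longrightarrow> W \<subseteq> U \<Longrightarrow>
    restrict f W \<in> sections X W"
  unfolding is_sheaf_def by blast

text \<open>Gluing in the form used below: a local representative g may live on a W that is not
  inside U, since it can be cut down to U \<inter> W.\<close>

lemma sections_glue:
  assumes X: "is_sheaf X" and U: "openin (zar X) U" and f: "f \<in> extensional U"
    and loc: "\<And>x. x \<in> U \<Longrightarrow>
      \<exists>W g. openin (zar X) W \<and> x \<in> W \<and> g \<in> sections X W \<and> (\<forall>y\<in>U \<inter> W. f y = g y)"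
  shows "f \<in> sections X U"
proof -
  have "\<exists>W. openin (zar X) W \<and> x \<in> W \<and> W \<subseteq> U \<and> restrict f W \<in> sections X W" if x: "x \<in> U" for x
  proof -
    obtain W g where W: "openin (zar X) W" "x \<in> W" "g \<in> sections X W" "\<forall>y\<in>U \<inter> W. f y = g y"
      using loc[OF x] by blast
    have "restrict g (U \<inter> W) \<in> sections X (U \<inter> W)"
      by (rule sections_restrict[OF X W(1) W(3)]) (auto simp: U W)
    moreover have "restrict g (U \<inter> W) = restrict f (U \<inter> W)"
      using W(4) by (auto simp: fun_eq_iff)
    ultimately show ?thesis
      using W U x by (intro exI[of _ "U \<inter> W"]) auto
  qed
  moreover have "\<forall>f\<in>extensional U. (\<forall>x\<in>U. \<exists>W. openin (zar X) W \<and> x \<in> W \<and> W \<subseteq> U \<and>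
      restrict f W \<in> sections X W) \<longrightarrow> f \<in> sections X U"
    using X U by (simp add: is_sheaf_def)
  ultimately show ?thesis
    using f by simp
qed

lemma sections_subspace_of_open:
  assumes "is_sheaf X" "openin (zar X) U"
  shows "sections (subspace_of X S) U = sections X U"
proof (intro equalityI subsetI)
  fix f assume "f \<in> sections (subspace_of X S) U"
  then have f: "f \<in> extensional U" "\<And>x. x \<in> U \<Longrightarrow>
    \<exists>V. \<exists>g\<in>sections X V. openin (zar X) V \<and> x \<in> V \<and> (\<forall>y\<in>U \<inter> V. f y = g y)"
    by (auto simp: sections_subspace_of)
  show "f \<in> sections X U"
  proof (rule sections_glue[OF assms f(1)])
    fix x assume "x \<in> U"
    from f(2)[OF this] show "\<exists>W g. openin (zar X) W \<and> x \<in> W \<and> g \<in> sections X W \<and> (\<forall>y\<in>U \<inter> W. f y = g y)"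
      by metis
  qed
next
  fix f assume "f \<in> sections X U"
  then show "f \<in> sections (subspace_of X S) U"
    unfolding sections_subspace_of
    using sections_extensional[OF assms] assms(2) by (intro conjI ballI exI[of _ U] bexI[of _ f]) auto
qed

text \<open>Sections of a subspace are defined by local agreement with ambient sections, so gluing
  is built in and only restriction has to come from X. In this form it covers subspaces of
  projective space after a check of restriction alone.\<close>

lemma is_sheaf_subspace_of_presheaf:
  assumes "\<And>U f W. openin (zar X) U \<Longrightarrow> f \<in> sections X U \<Longrightarrow> openin (zar X) W \<Longrightarrow> W \<subseteq> U \<Longrightarrow>
      restrict f W \<in> sections X W"
  shows "is_sheaf (subspace_of X S)"
  unfolding is_sheaf_def
proof (intro allI impI conjI ballI)
  fix U assume "openin (zar (subspace_of X S)) U"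
  show "sections (subspace_of X S) U \<subseteq> extensional U"
    by (auto simp: sections_subspace_of)
next
  fix U f W assume f: "f \<in> sections (subspace_of X S) U"
    and W: "openin (zar (subspace_of X S)) W \<and> W \<subseteq> U"
  show "restrict f W \<in> sections (subspace_of X S) W"
    unfolding sections_subspace_of
  proof (intro conjI ballI)
    fix x assume "x \<in> W"
    then obtain V g where "g\<in>sections X V" "openin (zar X) V" "x \<in> V" "\<forall>y\<in>U \<inter> V. f y = g y"
      using f conjunct2[OF W] unfolding sections_subspace_of by blast
    then show "\<exists>V. \<exists>g\<in>sections X V. openin (zar X) V \<and> x \<in> V \<and> (\<forall>y\<in>W \<inter> V. restrict f W y = g y)"
      using W by (intro exI[of _ V] bexI[of _ g]) auto
  qed simp
next
  fix U f assume f: "f \<in> extensional U"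
    and loc: "\<forall>x\<in>U. \<exists>W. openin (zar (subspace_of X S)) W \<and> x \<in> W \<and> W \<subseteq> U \<and>
        restrict f W \<in> sections (subspace_of X S) W"
  show "f \<in> sections (subspace_of X S) U"
    unfolding sections_subspace_of
  proof (intro conjI ballI f)
    fix x assume "x \<in> U"
    then obtain W where W: "openin (zar (subspace_of X S)) W" "x \<in> W" "W \<subseteq> U"
      "restrict f W \<in> sections (subspace_of X S) W"
      using loc by blast
    obtain V g where g: "g\<in>sections X V" "openin (zar X) V" "x \<in> V"
      "\<forall>y\<in>W \<inter> V. restrict f W y = g y"
      using W unfolding sections_subspace_of by blast
    obtain W' where W': "openin (zar X) W'" "W = W' \<inter> S"
      using W(1) by (auto simp: openin_subtopology)
    have U: "\<forall>x\<in>U. x \<in> S"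
      using loc openin_subset by (fastforce simp: openin_subtopology)
    \<comment> \<open>W is open only relative to S, so V is cut down by the ambient open set W'.
      Points of U in V \<inter> W' then lie in W, because U is contained in S.\<close>
    have "restrict g (V \<inter> W') \<in> sections X (V \<inter> W')"
      by (rule assms[OF g(2,1)]) (auto simp: g W')
    moreover have "\<forall>y\<in>U \<inter> (V \<inter> W'). f y = restrict g (V \<inter> W') y"
      using g(4) W' U by auto
    ultimately show "\<exists>V. \<exists>g\<in>sections X V. openin (zar X) V \<and> x \<in> V \<and> (\<forall>y\<in>U \<inter> V. f y = g y)"
      using g W' W(2) by (intro exI[of _ "V \<inter> W'"] bexI[of _ "restrict g (V \<inter> W')"]) auto
  qed
qed

lemma is_sheaf_subspace_of: "is_sheaf X \<Longrightarrow> is_sheaf (subspace_of X S)"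
  by (rule is_sheaf_subspace_of_presheaf) (rule sections_restrict)

lemma morphism_subspace_of:
  assumes \<phi>: "morphism X Y \<phi>" and T: "\<And>x. x \<in> points X \<Longrightarrow> x \<in> S \<Longrightarrow> \<phi> x \<in> T"
  shows "morphism (subspace_of X S) (subspace_of Y T) \<phi>"
  unfolding morphism_def
proof (intro conjI allI impI ballI)
  show "continuous_map (zar (subspace_of X S)) (zar (subspace_of Y T)) \<phi>"
    using \<phi> T by (auto simp: morphism_def continuous_map_in_subtopology
        intro: continuous_map_from_subtopology)
  fix U f assume U: "openin (zar (subspace_of Y T)) U" and f: "f \<in> sections (subspace_of Y T) U"
  let ?P = "{x \<in> points (subspace_of X S). \<phi> x \<in> U}"
  show "restrict (f \<circ> \<phi>) ?P \<in> sections (subspace_of X S) ?P"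
    unfolding sections_subspace_of
  proof (intro conjI ballI)
    fix x assume x: "x \<in> ?P"
    then obtain V g where g: "g\<in>sections Y V" "openin (zar Y) V" "\<phi> x \<in> V" "\<forall>y\<in>U \<inter> V. f y = g y"
      using f unfolding sections_subspace_of by blast
    show "\<exists>V. \<exists>g\<in>sections X V. openin (zar X) V \<and> x \<in> V
        \<and> (\<forall>y\<in>?P \<inter> V. restrict (f \<circ> \<phi>) ?P y = g y)"
      using g x morphism_pullback[OF \<phi> g(2,1)] morphism_open_preimage[OF \<phi> g(2)]
      by (intro exI[of _ "{x \<in> points X. \<phi> x \<in> V}"]
          bexI[of _ "restrict (g \<circ> \<phi>) {x \<in> points X. \<phi> x \<in> V}"]) auto
  qed simp
qed

lemma morphism_inclusion: "morphism (subspace_of X S) X id"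
  unfolding morphism_def
proof (intro conjI allI impI ballI)
  show "continuous_map (zar (subspace_of X S)) (zar X) id"
    by (simp add: continuous_map_from_subtopology id_def)
  fix U f assume "openin (zar X) U" "f \<in> sections X U"
  then show "restrict (f \<circ> id) {x \<in> points (subspace_of X S). id x \<in> U} \<in>
      sections (subspace_of X S) {x \<in> points (subspace_of X S). id x \<in> U}"
    unfolding sections_subspace_of by auto
qed

lemma morphism_into_whole:
  assumes "is_sheaf X" "points X \<subseteq> S"
  shows "morphism X (subspace_of X S) id"
  unfolding morphism_def
proof (intro conjI allI impI ballI)
  show "continuous_map (zar X) (zar (subspace_of X S)) id"
    using assms by (auto simp: continuous_map_in_subtopology id_def)
  fix U f assume U: "openin (zar (subspace_of X S)) U" and f: "f \<in> sections (subspace_of X S) U"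
  have U': "openin (zar X) U"
    using U assms(2) by (simp add: subtopology_superset)
  have "{x \<in> points X. id x \<in> U} = U"
    using openin_subset[OF U'] by auto
  moreover have "f \<in> sections X U"
    using f sections_subspace_of_open[OF assms(1) U'] by simp
  ultimately show "restrict (f \<circ> id) {x \<in> points X. id x \<in> U} \<in> sections X {x \<in> points X. id x \<in> U}"
    using sections_extensional[OF assms(1) U'] by (simp add: extensional_restrict)
qed

lemma morphism_into_subspace:
  assumes "is_sheaf X" "morphism X Y \<phi>" "\<And>x. x \<in> points X \<Longrightarrow> \<phi> x \<in> T"
  shows "morphism X (subspace_of Y T) \<phi>"
  using morphism_comp[OF morphism_into_whole[OF assms(1) order_refl]
      morphism_subspace_of[OF assms(2), of "points X" T]] assms(3) by simp

lemma isomorphic_whole_subspace: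
  assumes "is_sheaf X" "points X \<subseteq> S"
  shows "subspace_of X S \<cong>\<^sub>v X"
  unfolding isomorphic_def
  using morphism_into_whole[OF assms] morphism_inclusion by (metis id_apply)

lemma isomorphic_subspace:
  assumes "morphism X Y \<phi>" "morphism Y X \<psi>"
    "\<And>x. x \<in> points X \<Longrightarrow> \<psi> (\<phi> x) = x" "\<And>y. y \<in> points Y \<Longrightarrow> \<phi> (\<psi> y) = y"
  shows "subspace_of X {x \<in> points X. \<phi> x \<in> T} \<cong>\<^sub>v subspace_of Y T"
  unfolding isomorphic_def
proof (intro exI[of _ \<phi>] exI[of _ \<psi>] conjI)
  show "morphism (subspace_of X {x \<in> points X. \<phi> x \<in> T}) (subspace_of Y T) \<phi>"
    by (rule morphism_subspace_of[OF assms(1)]) simp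
  show "morphism (subspace_of Y T) (subspace_of X {x \<in> points X. \<phi> x \<in> T}) \<psi>"
    by (rule morphism_subspace_of[OF assms(2)]) (use assms(4) morphism_point[OF assms(2)] in auto)
qed (use assms in auto)

lemma subspace_of_subspace_of:
  assumes "is_sheaf X"
  shows "subspace_of (subspace_of X S) T \<cong>\<^sub>v subspace_of X (S \<inter> T)"
  unfolding isomorphic_def
proof (intro exI[of _ id] conjI)
  show "morphism (subspace_of (subspace_of X S) T) (subspace_of X (S \<inter> T)) id"
    by (rule morphism_subspace_of[OF morphism_inclusion]) auto
  show "morphism (subspace_of X (S \<inter> T)) (subspace_of (subspace_of X S) T) id"
    by (intro morphism_into_subspace is_sheaf_subspace_of assms morphism_inclusion) auto
qed auto


section \<open>Spaces whose sections form local function algebras\<close>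

text \<open>What polynomials and their quotients need in order to act on sections. The datatype
  \<open>fspace\<close> imposes none of this; it is what makes regular coordinate functions
  determine a morphism into affine space.\<close>

definition ringed :: "'a fspace \<Rightarrow> bool" where
  "ringed X \<longleftrightarrow> is_sheaf X \<and> (\<forall>U. openin (zar X) U \<longrightarrow>
     (\<forall>c\<in>gauss_rat. (\<lambda>x\<in>U. c) \<in> sections X U) \<and>
     (\<forall>f\<in>sections X U. \<forall>g\<in>sections X U.
        (\<lambda>x\<in>U. f x + g x) \<in> sections X U \<and> (\<lambda>x\<in>U. f x * g x) \<in> sections X U) \<and>
     (\<forall>f\<in>sections X U. openin (zar X) {x \<in> U. f x \<noteq> 0} \<and>
        (\<lambda>x\<in>{x \<in> U. f x \<noteq> 0}. 1 / f x) \<in> sections X {x \<in> U. f x \<noteq> 0}))"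

lemma ringedD:
  assumes "ringed X"
  shows "is_sheaf X"
    and "\<And>U c. openin (zar X) U \<Longrightarrow> c \<in> gauss_rat \<Longrightarrow> (\<lambda>x\<in>U. c) \<in> sections X U"
    and "\<And>U f g. openin (zar X) U \<Longrightarrow> f \<in> sections X U \<Longrightarrow> g \<in> sections X U \<Longrightarrow>
      (\<lambda>x\<in>U. f x + g x) \<in> sections X U"
    and "\<And>U f g. openin (zar X) U \<Longrightarrow> f \<in> sections X U \<Longrightarrow> g \<in> sections X U \<Longrightarrow>
      (\<lambda>x\<in>U. f x * g x) \<in> sections X U"
    and "\<And>U f. openin (zar X) U \<Longrightarrow> f \<in> sections X U \<Longrightarrow> openin (zar X) {x \<in> U. f x \<noteq> 0}"
    and "\<And>U f. openin (zar X) U \<Longrightarrow> f \<in> sections X U \<Longrightarrow>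
      (\<lambda>x\<in>{x \<in> U. f x \<noteq> 0}. 1 / f x) \<in> sections X {x \<in> U. f x \<noteq> 0}"
  using assms unfolding ringed_def by blast+

text \<open>The algebra is done in Y: sections over U are pulled back along \<psi> to the
  corresponding set \<open>T U\<close>, combined there, and pulled back along \<phi>, which leads
  back to U (\<open>descend\<close>).\<close>

lemma ringed_isomorphic:
  assumes Y: "ringed Y" and X: "is_sheaf X" and iso: "X \<cong>\<^sub>v Y"
  shows "ringed X"
proof -
  obtain \<phi> \<psi> where \<phi>: "morphism X Y \<phi>" and \<psi>: "morphism Y X \<psi>"
    and inv: "\<forall>x\<in>points X. \<psi> (\<phi> x) = x" "\<forall>y\<in>points Y. \<phi> (\<psi> y) = y"
    using iso unfolding isomorphic_def by blast
  define T where "T U = {y \<in> points Y. \<psi> y \<in> U}" for U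
  define t where "t f U = restrict (f \<circ> \<psi>) (T U)" for U and f :: "'b \<Rightarrow> complex"
  have T: "openin (zar Y) (T U)" if "openin (zar X) U" for U
    unfolding T_def by (rule morphism_open_preimage[OF \<psi> that])
  have t: "t f U \<in> sections Y (T U)" if "openin (zar X) U" "f \<in> sections X U" for U f
    unfolding T_def t_def by (rule morphism_pullback[OF \<psi> that])
  have descend: "k \<in> sections X U"
    if U: "openin (zar X) U" and W: "openin (zar Y) W" "W = T U" and h: "h \<in> sections Y W"
      and k: "k \<in> extensional U" "\<And>x. x \<in> U \<Longrightarrow> k x = h (\<phi> x)" for U W h k
  proof -
    have "{x \<in> points X. \<phi> x \<in> W} = U"
      using openin_subset[OF U] inv morphism_point[OF \<phi>] W(2) by (auto simp: T_def)
    moreover from this have "restrict (h \<circ> \<phi>) {x \<in> points X. \<phi> x \<in> W} = k"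
      using k by (auto simp: fun_eq_iff extensional_def)
    ultimately show ?thesis
      using morphism_pullback[OF \<phi> W(1) h] by simp
  qed
  have TU: "\<phi> x \<in> T U" "t f U (\<phi> x) = f x" if "openin (zar X) U" "x \<in> U" for x U f
    using that openin_subset[OF that(1)] inv morphism_point[OF \<phi>] by (auto simp: T_def t_def)
  show ?thesis
    unfolding ringed_def
  proof (intro conjI allI impI ballI X)
    fix U assume U: "openin (zar X) U"
    note TU = TU[OF U]
    { fix c :: complex assume "c \<in> gauss_rat"
      then show "(\<lambda>x\<in>U. c) \<in> sections X U"
        by (intro descend[OF U T[OF U] refl ringedD(2)[OF Y T[OF U], of c]]) (auto simp: TU) }
    fix f assume f: "f \<in> sections X U"
    { fix g assume g: "g \<in> sections X U"
      show "(\<lambda>x\<in>U. f x + g x) \<in> sections X U"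
        by (intro descend[OF U T[OF U] refl ringedD(3)[OF Y T[OF U] t[OF U f] t[OF U g]]])
          (auto simp: TU)
      show "(\<lambda>x\<in>U. f x * g x) \<in> sections X U"
        by (intro descend[OF U T[OF U] refl ringedD(4)[OF Y T[OF U] t[OF U f] t[OF U g]]])
          (auto simp: TU) }
    let ?W = "{y \<in> T U. t f U y \<noteq> 0}" and ?V = "{x \<in> U. f x \<noteq> 0}"
    have W: "openin (zar Y) ?W"
      by (rule ringedD(5)[OF Y T[OF U] t[OF U f]])
    have "{x \<in> points X. \<phi> x \<in> ?W} = ?V"
      using TU openin_subset[OF U] inv by (auto simp: T_def t_def)
    then show V: "openin (zar X) ?V"
      using morphism_open_preimage[OF \<phi> W] by simp
    have WV: "?W = T ?V"
      by (auto simp: T_def t_def)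
    show "(\<lambda>x\<in>?V. 1 / f x) \<in> sections X ?V"
      by (rule descend[OF V W WV ringedD(6)[OF Y T[OF U] t[OF U f]]])
        (auto simp: TU)
  qed
qed

text \<open>All clauses of \<open>ringed\<close> are local: over an open chart C the sections of X
  and of the subspace agree on open subsets, so results found in charts can be glued.\<close>

lemma ringed_local:
  assumes X: "is_sheaf X"
    and loc: "\<And>x. x \<in> points X \<Longrightarrow> \<exists>C. openin (zar X) C \<and> x \<in> C \<and> ringed (subspace_of X C)"
  shows "ringed X"
proof -
  have chart: "\<exists>C. openin (zar X) (U \<inter> C) \<and> x \<in> U \<inter> C \<and> openin (zar (subspace_of X C)) (U \<inter> C)
      \<and> ringed (subspace_of X C)"
    if "openin (zar X) U" "x \<in> U" for U x
  proof -
    have "x \<in> points X"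
      using that openin_subset by auto
    then obtain C where "openin (zar X) C" "x \<in> C" "ringed (subspace_of X C)"
      using loc[of x] by metis
    then show ?thesis
      using that by (intro exI[of _ C]) (auto simp: openin_subtopology)
  qed
  note same = sections_subspace_of_open[OF X]
  show ?thesis
    unfolding ringed_def
  proof (intro conjI allI impI ballI X)
    fix U assume U: "openin (zar X) U"
    { fix c :: complex assume c: "c \<in> gauss_rat"
      show "(\<lambda>x\<in>U. c) \<in> sections X U"
      proof (rule sections_glue[OF X U])
        fix x assume "x \<in> U"
        then obtain C where C: "openin (zar X) (U \<inter> C)" "x \<in> U \<inter> C"
          "openin (zar (subspace_of X C)) (U \<inter> C)" "ringed (subspace_of X C)"
          using chart[OF U] by blast
        show "\<exists>W g. openin (zar X) W \<and> x \<in> W \<and> g \<in> sections X W \<and> (\<forall>y\<in>U \<inter> W. (\<lambda>x\<in>U. c) y = g y)"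
          using C ringedD(2)[OF C(4,3) c]
          by (intro exI[of _ "U \<inter> C"] exI[of _ "\<lambda>x\<in>U \<inter> C. c"]) (auto simp: same)
      qed simp }
    fix f assume f: "f \<in> sections X U"
    { fix g assume g: "g \<in> sections X U"
      have "\<exists>C. openin (zar X) (U \<inter> C) \<and> x \<in> U \<inter> C
          \<and> (\<lambda>x\<in>U \<inter> C. f x + g x) \<in> sections X (U \<inter> C)
          \<and> (\<lambda>x\<in>U \<inter> C. f x * g x) \<in> sections X (U \<inter> C)" if x: "x \<in> U" for x
      proof -
        obtain C where C: "openin (zar X) (U \<inter> C)" "x \<in> U \<inter> C"
          "openin (zar (subspace_of X C)) (U \<inter> C)" "ringed (subspace_of X C)"
          using chart[OF U x] by blast
        have r: "restrict f (U \<inter> C) \<in> sections (subspace_of X C) (U \<inter> C)"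
          "restrict g (U \<inter> C) \<in> sections (subspace_of X C) (U \<inter> C)"
          using sections_restrict[OF X U f C(1)] sections_restrict[OF X U g C(1)] same[OF C(1)]
          by auto
        show ?thesis
          using ringedD(3)[OF C(4,3) r] ringedD(4)[OF C(4,3) r] C(1,2)
          by (intro exI[of _ C]) (simp add: same cong: restrict_cong)
      qed
      note * = this
      show "(\<lambda>x\<in>U. f x + g x) \<in> sections X U"
      proof (rule sections_glue[OF X U])
        fix x assume "x \<in> U"
        then obtain C where C: "openin (zar X) (U \<inter> C)" "x \<in> U \<inter> C"
          "(\<lambda>x\<in>U \<inter> C. f x + g x) \<in> sections X (U \<inter> C)"
          using * by blast
        then show "\<exists>W h. openin (zar X) W \<and> x \<in> W \<and> h \<in> sections X W
            \<and> (\<forall>y\<in>U \<inter> W. (\<lambda>x\<in>U. f x + g x) y = h y)"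
          by (intro exI[of _ "U \<inter> C"] exI[of _ "\<lambda>x\<in>U \<inter> C. f x + g x"]) auto
      qed simp
      show "(\<lambda>x\<in>U. f x * g x) \<in> sections X U"
      proof (rule sections_glue[OF X U])
        fix x assume "x \<in> U"
        then obtain C where C: "openin (zar X) (U \<inter> C)" "x \<in> U \<inter> C"
          "(\<lambda>x\<in>U \<inter> C. f x * g x) \<in> sections X (U \<inter> C)"
          using * by blast
        then show "\<exists>W h. openin (zar X) W \<and> x \<in> W \<and> h \<in> sections X W
            \<and> (\<forall>y\<in>U \<inter> W. (\<lambda>x\<in>U. f x * g x) y = h y)"
          by (intro exI[of _ "U \<inter> C"] exI[of _ "\<lambda>x\<in>U \<inter> C. f x * g x"]) auto
      qed simp }
    let ?V = "{x \<in> U. f x \<noteq> 0}"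
    have *: "\<exists>C. openin (zar X) (?V \<inter> C) \<and> x \<in> ?V \<inter> C
        \<and> (\<lambda>x\<in>?V \<inter> C. 1 / f x) \<in> sections X (?V \<inter> C)" if x: "x \<in> ?V" for x
    proof -
      obtain C where C: "openin (zar X) (U \<inter> C)" "x \<in> U \<inter> C"
        "openin (zar (subspace_of X C)) (U \<inter> C)" "ringed (subspace_of X C)"
        using chart[OF U] x by blast
      have r: "restrict f (U \<inter> C) \<in> sections (subspace_of X C) (U \<inter> C)"
        using sections_restrict[OF X U f C(1)] same[OF C(1)] by auto
      have e: "{x \<in> U \<inter> C. restrict f (U \<inter> C) x \<noteq> 0} = ?V \<inter> C"
        by auto
      have "openin (zar (subspace_of X C)) (?V \<inter> C)"
        using ringedD(5)[OF C(4,3) r] unfolding e .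
      then obtain O' where O': "openin (zar X) O'" "?V \<inter> C = O' \<inter> C"
        by (auto simp: openin_subtopology)
      \<comment> \<open>The chart gives openness only relative to C; since U \<inter> C is open in
        X, this identity upgrades it to openness in X.\<close>
      have "?V \<inter> C = O' \<inter> (U \<inter> C)"
        using O'(2) by auto
      then have o: "openin (zar X) (?V \<inter> C)"
        using O'(1) C(1) by auto
      have "(\<lambda>x\<in>?V \<inter> C. 1 / restrict f (U \<inter> C) x) \<in> sections (subspace_of X C) (?V \<inter> C)"
        using ringedD(6)[OF C(4,3) r] unfolding e .
      moreover have "(\<lambda>x\<in>?V \<inter> C. 1 / restrict f (U \<inter> C) x) = (\<lambda>x\<in>?V \<inter> C. 1 / f x)"
        by (auto simp: fun_eq_iff)
      ultimately show ?thesis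
        using o x C(2) same[OF o] by (intro exI[of _ C]) simp
    qed
    show V: "openin (zar X) ?V"
      using * by (subst openin_subopen) blast
    show "(\<lambda>x\<in>?V. 1 / f x) \<in> sections X ?V"
    proof (rule sections_glue[OF X V])
      fix x assume "x \<in> ?V"
      then obtain C where C: "openin (zar X) (?V \<inter> C)" "x \<in> ?V \<inter> C"
        "(\<lambda>x\<in>?V \<inter> C. 1 / f x) \<in> sections X (?V \<inter> C)"
        using * by blast
      then show "\<exists>W h. openin (zar X) W \<and> x \<in> W \<and> h \<in> sections X W
          \<and> (\<forall>y\<in>?V \<inter> W. (\<lambda>x\<in>?V. 1 / f x) y = h y)"
        by (intro exI[of _ "?V \<inter> C"] exI[of _ "\<lambda>x\<in>?V \<inter> C. 1 / f x"]) auto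
    qed simp
  qed
qed

section \<open>Polynomial functions\<close>

lemma gauss_rat_of_rat [simp]: "of_rat a \<in> gauss_rat"
  unfolding gauss_rat_def by (intro CollectI exI[of _ a] exI[of _ 0]) simp

lemma gauss_rat_i [simp]: "\<i> \<in> gauss_rat"
  unfolding gauss_rat_def by (intro CollectI exI[of _ 0] exI[of _ 1]) simp

lemma gauss_rat_numeral [simp]: "0 \<in> gauss_rat" "1 \<in> gauss_rat" "- 1 \<in> gauss_rat"
  using gauss_rat_of_rat[of 0] gauss_rat_of_rat[of 1] gauss_rat_of_rat[of "- 1"]
  by simp_all

lemma poly_fun_uminus: "p \<in> poly_fun I \<Longrightarrow> (\<lambda>u. - p u) \<in> poly_fun I"
  using poly_fun.mult[OF poly_fun.const[of "- 1"]] by simp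

lemma poly_fun_diff: "p \<in> poly_fun I \<Longrightarrow> q \<in> poly_fun I \<Longrightarrow> (\<lambda>u. p u - q u) \<in> poly_fun I"
  using poly_fun.add[OF _ poly_fun_uminus] by simp

lemma poly_fun_power: "p \<in> poly_fun I \<Longrightarrow> (\<lambda>u. p u ^ k) \<in> poly_fun I"
  by (induction k) (auto intro: poly_fun.intros)

lemma poly_fun_sum:
  "(\<And>a. a \<in> A \<Longrightarrow> p a \<in> poly_fun I) \<Longrightarrow> (\<lambda>u. \<Sum>a\<in>A. p a u) \<in> poly_fun I"
  by (induction A rule: infinite_finite_induct) (auto intro: poly_fun.intros)

lemma poly_fun_subst:
  assumes "p \<in> poly_fun I" "\<And>i. i \<in> I \<Longrightarrow> (\<lambda>v. s v i) \<in> poly_fun J"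
  shows "(\<lambda>v. p (s v)) \<in> poly_fun J"
  using assms by (induction rule: poly_fun.induct) (auto intro: poly_fun.intros)

lemma poly_fun_mono: "p \<in> poly_fun I \<Longrightarrow> I \<subseteq> J \<Longrightarrow> p \<in> poly_fun J"
  using poly_fun_subst[of p I "\<lambda>v. v" J] by (auto intro: poly_fun.intros)

lemma poly_fun_cong:
  assumes "p \<in> poly_fun I" "\<And>i. i \<in> I \<Longrightarrow> u i = v i"
  shows "p u = p v"
  using assms by (induction rule: poly_fun.induct) auto

lemma poly_fun_restrict [simp]: "p \<in> poly_fun I \<Longrightarrow> p (restrict u I) = p u"
  by (rule poly_fun_cong) auto


section \<open>Subspaces of affine space\<close>

lemma points_affine_space [simp]: "points (affine_space I) = vectors I"
proof -
  have "vectors I \<in> {{u \<in> vectors I. p u \<noteq> 0} | p. p \<in> poly_fun I}"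
    by (intro CollectI exI[of _ "\<lambda>_. 1"]) (auto intro: poly_fun.const)
  then show ?thesis
    by (auto simp: affine_space_def)
qed

lemma openin_affine_basic: "p \<in> poly_fun I \<Longrightarrow> openin (zar (affine_space I)) {u \<in> vectors I. p u \<noteq> 0}"
  by (auto simp: affine_space_def intro!: topology_generated_by_Basis)

text \<open>Principal open sets are closed under intersection, by multiplying the polynomials, so
  the generating family is already a base.\<close>

lemma openin_affine_space:
  "openin (zar (affine_space I)) W \<longleftrightarrow> W \<subseteq> vectors I \<and>
     (\<forall>x\<in>W. \<exists>p\<in>poly_fun I. p x \<noteq> 0 \<and> {u \<in> vectors I. p u \<noteq> 0} \<subseteq> W)" (is "?L \<longleftrightarrow> ?R")
proof
  assume W: ?L
  then have "generate_topology_on {{u \<in> vectors I. p u \<noteq> 0} | p. p \<in> poly_fun I} W"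
    by (simp add: affine_space_def openin_topology_generated_by_iff)
  then have "\<forall>x\<in>W. \<exists>p\<in>poly_fun I. p x \<noteq> 0 \<and> {u \<in> vectors I. p u \<noteq> 0} \<subseteq> W"
  proof induction
    case (Int a b)
    show ?case
    proof
      fix x assume x: "x \<in> a \<inter> b"
      obtain p where "p \<in> poly_fun I" "p x \<noteq> 0" "{u \<in> vectors I. p u \<noteq> 0} \<subseteq> a"
        using bspec[OF Int.IH(1), of x] x by auto
      moreover obtain q where "q \<in> poly_fun I" "q x \<noteq> 0" "{u \<in> vectors I. q u \<noteq> 0} \<subseteq> b"
        using bspec[OF Int.IH(2), of x] x by auto
      ultimately show "\<exists>p\<in>poly_fun I. p x \<noteq> 0 \<and> {u \<in> vectors I. p u \<noteq> 0} \<subseteq> a \<inter> b"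
        by (intro bexI[of _ "\<lambda>u. p u * q u"]) (auto intro: poly_fun.intros)
    qed
  next
    case (UN K)
    show ?case
    proof
      fix x assume "x \<in> \<Union>K"
      then obtain k where k: "k \<in> K" "x \<in> k"
        by blast
      then obtain p where "p \<in> poly_fun I" "p x \<noteq> 0" "{u \<in> vectors I. p u \<noteq> 0} \<subseteq> k"
        using bspec[OF UN.IH[OF k(1)], of x] by auto
      then show "\<exists>p\<in>poly_fun I. p x \<noteq> 0 \<and> {u \<in> vectors I. p u \<noteq> 0} \<subseteq> \<Union>K"
        using k by (intro bexI[of _ p]) auto
    qed
  next
    case (Basis s)
    then obtain p where "p \<in> poly_fun I" "s = {u \<in> vectors I. p u \<noteq> 0}"
      by auto
    then show ?case
      by (intro ballI bexI[of _ p]) auto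
  qed simp
  then show ?R
    using openin_subset[OF W] by simp
next
  assume R: ?R
  show ?L
  proof (subst openin_subopen, intro ballI)
    fix x assume "x \<in> W"
    then obtain p where "p\<in>poly_fun I" "p x \<noteq> 0" "{u \<in> vectors I. p u \<noteq> 0} \<subseteq> W" "x \<in> vectors I"
      using bspec[OF conjunct2[OF R], of x] conjunct1[OF R] by auto
    then show "\<exists>T. openin (zar (affine_space I)) T \<and> x \<in> T \<and> T \<subseteq> W"
      using openin_affine_basic by (intro exI[of _ "{u \<in> vectors I. p u \<noteq> 0}"]) auto
  qed
qed

section \<open>Regular functions on subsets of affine space\<close>

text \<open>U need not be open in affine space: the same quotient condition will describe the
  sections of every subspace.\<close>

definition regular_on :: "nat set \<Rightarrow> (nat \<Rightarrow> complex) set \<Rightarrow> ((nat \<Rightarrow> complex) \<Rightarrow> complex) \<Rightarrow> bool" where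
  "regular_on I U f \<longleftrightarrow> (\<forall>x\<in>U. \<exists>p\<in>poly_fun I. \<exists>q\<in>poly_fun I.
     q x \<noteq> 0 \<and> (\<forall>y\<in>U. q y \<noteq> 0 \<longrightarrow> f y = p y / q y))"

lemma regular_onE:
  assumes "regular_on I U f" "x \<in> U"
  obtains p q where "p \<in> poly_fun I" "q \<in> poly_fun I" "q x \<noteq> 0"
    "\<forall>y\<in>U. q y \<noteq> 0 \<longrightarrow> f y = p y / q y"
  using bspec[OF assms(1)[unfolded regular_on_def] assms(2)] by auto

lemma regular_on_quotient:
  assumes "p \<in> poly_fun I" "q \<in> poly_fun I" "\<And>x. x \<in> U \<Longrightarrow> q x \<noteq> 0" "\<And>x. x \<in> U \<Longrightarrow> f x = p x / q x"
  shows "regular_on I U f"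
  unfolding regular_on_def using assms by (intro ballI bexI[of _ p] bexI[of _ q]) auto

lemma regular_on_poly:
  assumes "p \<in> poly_fun I" "\<And>x. x \<in> U \<Longrightarrow> f x = p x"
  shows "regular_on I U f"
  using assms by (intro regular_on_quotient[of p I "\<lambda>_. 1"]) (auto intro: poly_fun.const)

lemma regular_on_subset: "regular_on I U f \<Longrightarrow> W \<subseteq> U \<Longrightarrow> regular_on I W f"
  unfolding regular_on_def
proof
  fix x assume *: "\<forall>x\<in>U. \<exists>p\<in>poly_fun I. \<exists>q\<in>poly_fun I. q x \<noteq> 0 \<and> (\<forall>y\<in>U. q y \<noteq> 0 \<longrightarrow> f y = p y / q y)"
    and W: "W \<subseteq> U" and x: "x \<in> W"
  from bspec[OF * subsetD[OF W x]]
  obtain p q where "p\<in>poly_fun I" "q\<in>poly_fun I" "q x \<noteq> 0" "\<forall>y\<in>U. q y \<noteq> 0 \<longrightarrow> f y = p y / q y"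
    by auto
  then show "\<exists>p\<in>poly_fun I. \<exists>q\<in>poly_fun I. q x \<noteq> 0 \<and> (\<forall>y\<in>W. q y \<noteq> 0 \<longrightarrow> f y = p y / q y)"
    using W by (intro bexI[of _ p] bexI[of _ q]) auto
qed

lemma regular_on_cong: "(\<And>x. x \<in> U \<Longrightarrow> f x = g x) \<Longrightarrow> regular_on I U f = regular_on I U g"
  unfolding regular_on_def by auto

lemma regular_on_restrict [simp]: "regular_on I U (restrict f U) = regular_on I U f"
  by (rule regular_on_cong) simp

lemma sections_affine_space:
  "sections (affine_space I) U = {f \<in> extensional U. regular_on I U f}"
  by (auto simp: affine_space_def regular_on_def)

text \<open>A representative g is available only on an ambient neighbourhood V of x. Multiplying its
  numerator and denominator by a polynomial r whose nonvanishing locus lies in V makes the quotient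
  formula valid at every point of U where the new denominator is nonzero.\<close>

lemma sections_affine_subspace:
  assumes "U \<subseteq> vectors I"
  shows "sections (subspace_of (affine_space I) S) U = {f \<in> extensional U. regular_on I U f}"
proof (intro equalityI subsetI)
  fix f assume f: "f \<in> sections (subspace_of (affine_space I) S) U"
  have "regular_on I U f"
    unfolding regular_on_def
  proof
    fix x assume x: "x \<in> U"
    have "\<forall>x\<in>U. \<exists>V. \<exists>g\<in>sections (affine_space I) V. openin (zar (affine_space I)) V \<and> x \<in> V
        \<and> (\<forall>y\<in>U \<inter> V. f y = g y)"
      using f by (simp add: sections_subspace_of)
    from bspec[OF this x] obtain V g where V: "openin (zar (affine_space I)) V" "x \<in> V" "\<forall>y\<in>U \<inter> V. f y = g y"
      and g: "regular_on I V g"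
      by (auto simp: sections_affine_space)
    obtain r where r: "r \<in> poly_fun I" "r x \<noteq> 0" "{u \<in> vectors I. r u \<noteq> 0} \<subseteq> V"
      using V(1,2) unfolding openin_affine_space by auto
    obtain p q where "p \<in> poly_fun I" "q \<in> poly_fun I" "q x \<noteq> 0"
      "\<forall>y\<in>V. q y \<noteq> 0 \<longrightarrow> g y = p y / q y"
      by (rule regular_onE[OF g V(2)])
    moreover have "y \<in> V" if "y \<in> U" "r y \<noteq> 0" for y
      using r(3) that assms by blast
    ultimately show "\<exists>p\<in>poly_fun I. \<exists>q\<in>poly_fun I. q x \<noteq> 0 \<and> (\<forall>y\<in>U. q y \<noteq> 0 \<longrightarrow> f y = p y / q y)"
      using r(1,2) V(3)
      by - (rule bexI[of _ "\<lambda>u. p u * r u"], rule bexI[of _ "\<lambda>u. q u * r u"], auto intro: poly_fun.intros)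
  qed
  then show "f \<in> {f \<in> extensional U. regular_on I U f}"
    using f by (simp add: sections_subspace_of)
next
  fix f assume f: "f \<in> {f \<in> extensional U. regular_on I U f}"
  show "f \<in> sections (subspace_of (affine_space I) S) U"
    unfolding sections_subspace_of
  proof (intro conjI ballI)
    fix x assume x: "x \<in> U"
    obtain p q where pq: "p \<in> poly_fun I" "q \<in> poly_fun I" "q x \<noteq> 0"
      "\<forall>y\<in>U. q y \<noteq> 0 \<longrightarrow> f y = p y / q y"
      by (rule regular_onE[of I U f x]) (use f x in auto)
    let ?V = "{u \<in> vectors I. q u \<noteq> 0}"
    have "(\<lambda>y\<in>?V. p y / q y) \<in> sections (affine_space I) ?V"
      unfolding sections_affine_space using pq by (auto intro!: regular_on_quotient[of p I q])
    then show "\<exists>V. \<exists>g\<in>sections (affine_space I) V. openin (zar (affine_space I)) V \<and> x \<in> V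
        \<and> (\<forall>y\<in>U \<inter> V. f y = g y)"
      using openin_affine_basic[OF pq(2)] pq x assms
      by (intro exI[of _ ?V] bexI[of _ "\<lambda>y\<in>?V. p y / q y"]) auto
  qed (use f in simp)
qed

lemma openin_affine_subspace:
  assumes "S \<subseteq> vectors I"
  shows "openin (zar (subspace_of (affine_space I) S)) W \<longleftrightarrow> W \<subseteq> S \<and>
     (\<forall>x\<in>W. \<exists>p\<in>poly_fun I. p x \<noteq> 0 \<and> {u \<in> S. p u \<noteq> 0} \<subseteq> W)"
proof
  assume "openin (zar (subspace_of (affine_space I) S)) W"
  then obtain V where V: "openin (zar (affine_space I)) V" "W = V \<inter> S"
    by (auto simp: openin_subtopology)
  show "W \<subseteq> S \<and> (\<forall>x\<in>W. \<exists>p\<in>poly_fun I. p x \<noteq> 0 \<and> {u \<in> S. p u \<noteq> 0} \<subseteq> W)"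
  proof (intro conjI ballI)
    fix x assume "x \<in> W"
    then obtain p where "p\<in>poly_fun I" "p x \<noteq> 0" "{u \<in> vectors I. p u \<noteq> 0} \<subseteq> V"
      using V unfolding openin_affine_space by auto
    then show "\<exists>p\<in>poly_fun I. p x \<noteq> 0 \<and> {u \<in> S. p u \<noteq> 0} \<subseteq> W"
      using V assms by (intro bexI[of _ p]) auto
  qed (use V in auto)
next
  assume W: "W \<subseteq> S \<and> (\<forall>x\<in>W. \<exists>p\<in>poly_fun I. p x \<noteq> 0 \<and> {u \<in> S. p u \<noteq> 0} \<subseteq> W)"
  show "openin (zar (subspace_of (affine_space I) S)) W"
  proof (subst openin_subopen, intro ballI)
    fix x assume x: "x \<in> W"
    then obtain p where "p\<in>poly_fun I" "p x \<noteq> 0" "{u \<in> S. p u \<noteq> 0} \<subseteq> W"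
      using bspec[OF conjunct2[OF W] x] by auto
    moreover have "{u \<in> S. p u \<noteq> 0} = {u \<in> vectors I. p u \<noteq> 0} \<inter> S"
      using assms by auto
    ultimately show "\<exists>T. openin (zar (subspace_of (affine_space I) S)) T \<and> x \<in> T \<and> T \<subseteq> W"
      using openin_affine_basic[of p I] x W
      by (intro exI[of _ "{u \<in> S. p u \<noteq> 0}"]) (auto simp: openin_subtopology)
  qed
qed

lemma openin_affine_subspace_basic:
  assumes "S \<subseteq> vectors I" "p \<in> poly_fun I"
  shows "openin (zar (subspace_of (affine_space I) S)) {u \<in> S. p u \<noteq> 0}"
  using assms by (auto simp: openin_affine_subspace simp del: zar_subspace_of)

lemma is_sheaf_affine_space: "is_sheaf (affine_space I)"
  unfolding is_sheaf_def
proof (intro allI impI conjI ballI)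
  fix U f W assume "f \<in> sections (affine_space I) U" "openin (zar (affine_space I)) W \<and> W \<subseteq> U"
  then show "restrict f W \<in> sections (affine_space I) W"
    unfolding sections_affine_space
    using regular_on_subset[of I U f W] regular_on_cong[of W "restrict f W" f] by auto
next
  fix U f assume f: "f \<in> extensional U"
    and loc: "\<forall>x\<in>U. \<exists>W. openin (zar (affine_space I)) W \<and> x \<in> W \<and> W \<subseteq> U \<and>
        restrict f W \<in> sections (affine_space I) W"
    and U: "openin (zar (affine_space I)) U"
  \<comment> \<open>Sections of a subspace are local by construction. For the subspace consisting of
    all vectors they coincide with those of \<open>affine_space\<close>, so gluing comes for
    free.\<close>
  have "f \<in> sections (subspace_of (affine_space I) (vectors I)) U"
    unfolding sections_subspace_of
  proof (intro conjI ballI f)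
    fix x assume "x \<in> U"
    then obtain W where "openin (zar (affine_space I)) W" "x \<in> W" "restrict f W \<in> sections (affine_space I) W"
      using loc by blast
    then show "\<exists>V. \<exists>g\<in>sections (affine_space I) V. openin (zar (affine_space I)) V \<and> x \<in> V
        \<and> (\<forall>y\<in>U \<inter> V. f y = g y)"
      by (intro exI[of _ W] bexI[of _ "restrict f W"]) auto
  qed
  moreover have "U \<subseteq> vectors I"
    using openin_subset[OF U] by simp
  ultimately show "f \<in> sections (affine_space I) U"
    by (simp add: sections_affine_subspace sections_affine_space)
qed (auto simp: sections_affine_space)

lemma regular_on_add:
  assumes "regular_on I U f" "regular_on I U g"
  shows "regular_on I U (\<lambda>x. f x + g x)"
  unfolding regular_on_def
proof
  fix x assume x: "x \<in> U"
  obtain p q where 1: "p \<in> poly_fun I" "q \<in> poly_fun I" "q x \<noteq> 0"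
    "\<forall>y\<in>U. q y \<noteq> 0 \<longrightarrow> f y = p y / q y"
    by (rule regular_onE[OF assms(1) x])
  obtain r s where 2: "r \<in> poly_fun I" "s \<in> poly_fun I" "s x \<noteq> 0"
    "\<forall>y\<in>U. s y \<noteq> 0 \<longrightarrow> g y = r y / s y"
    by (rule regular_onE[OF assms(2) x])
  show "\<exists>p\<in>poly_fun I. \<exists>q\<in>poly_fun I. q x \<noteq> 0 \<and> (\<forall>y\<in>U. q y \<noteq> 0 \<longrightarrow> f y + g y = p y / q y)"
    using 1 2 by - (rule bexI[of _ "\<lambda>u. p u * s u + r u * q u"], rule bexI[of _ "\<lambda>u. q u * s u"], auto intro: poly_fun.intros simp: field_simps)
qed

lemma regular_on_mult:
  assumes "regular_on I U f" "regular_on I U g"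
  shows "regular_on I U (\<lambda>x. f x * g x)"
  unfolding regular_on_def
proof
  fix x assume x: "x \<in> U"
  obtain p q where 1: "p \<in> poly_fun I" "q \<in> poly_fun I" "q x \<noteq> 0"
    "\<forall>y\<in>U. q y \<noteq> 0 \<longrightarrow> f y = p y / q y"
    by (rule regular_onE[OF assms(1) x])
  obtain r s where 2: "r \<in> poly_fun I" "s \<in> poly_fun I" "s x \<noteq> 0"
    "\<forall>y\<in>U. s y \<noteq> 0 \<longrightarrow> g y = r y / s y"
    by (rule regular_onE[OF assms(2) x])
  show "\<exists>p\<in>poly_fun I. \<exists>q\<in>poly_fun I. q x \<noteq> 0 \<and> (\<forall>y\<in>U. q y \<noteq> 0 \<longrightarrow> f y * g y = p y / q y)"
    using 1 2 by - (rule bexI[of _ "\<lambda>u. p u * r u"], rule bexI[of _ "\<lambda>u. q u * s u"], auto intro: poly_fun.intros)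
qed

lemma ringed_affine_subspace:
  assumes S: "S \<subseteq> vectors I"
  shows "ringed (subspace_of (affine_space I) S)"
  unfolding ringed_def
proof (intro conjI allI impI ballI)
  show "is_sheaf (subspace_of (affine_space I) S)"
    by (intro is_sheaf_subspace_of is_sheaf_affine_space)
  fix U assume U: "openin (zar (subspace_of (affine_space I) S)) U"
  have "U \<subseteq> vectors I"
    using openin_subset[OF U] by auto
  note sec = sections_affine_subspace[OF this, of S]
  { fix c :: complex assume "c \<in> gauss_rat"
    then show "(\<lambda>x\<in>U. c) \<in> sections (subspace_of (affine_space I) S) U"
      by (auto simp: sec intro!: regular_on_poly poly_fun.const) }
  fix f assume f: "f \<in> sections (subspace_of (affine_space I) S) U"
  { fix g assume g: "g \<in> sections (subspace_of (affine_space I) S) U"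
    show "(\<lambda>x\<in>U. f x + g x) \<in> sections (subspace_of (affine_space I) S) U"
      using f g by (simp add: sec regular_on_add cong: regular_on_cong)
    show "(\<lambda>x\<in>U. f x * g x) \<in> sections (subspace_of (affine_space I) S) U"
      using f g by (simp add: sec regular_on_mult cong: regular_on_cong) }
  let ?V = "{x \<in> U. f x \<noteq> 0}"
  have reg: "regular_on I U f"
    using f by (simp add: sec)
  show V: "openin (zar (subspace_of (affine_space I) S)) ?V"
  proof (subst openin_subopen, intro ballI)
    fix x assume x: "x \<in> ?V"
    then obtain p q where pq: "p \<in> poly_fun I" "q \<in> poly_fun I" "q x \<noteq> 0"
      "\<forall>y\<in>U. q y \<noteq> 0 \<longrightarrow> f y = p y / q y"
      by (auto elim: regular_onE[OF reg, of x])
    let ?W = "U \<inter> {u \<in> S. p u * q u \<noteq> 0}"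
    have "openin (zar (subspace_of (affine_space I) S)) {u \<in> S. p u * q u \<noteq> 0}"
      by (rule openin_affine_subspace_basic[OF S]) (intro poly_fun.mult pq)
    moreover have "x \<in> S"
      using openin_subset[OF U] x by auto
    ultimately show "\<exists>T. openin (zar (subspace_of (affine_space I) S)) T \<and> x \<in> T \<and> T \<subseteq> ?V"
      using U x pq by (intro exI[of _ ?W] conjI openin_Int) auto
  qed
  have "?V \<subseteq> vectors I"
    using openin_subset[OF V] by auto
  note sec' = sections_affine_subspace[OF this, of S]
  \<comment> \<open>Locally 1 / f = q / p. The fraction is expanded by q, because f = p / q is known
    only where q is nonzero and the new denominator must guarantee that.\<close>
  have "regular_on I ?V (\<lambda>x. 1 / f x)"
    unfolding regular_on_def
  proof
    fix x assume x: "x \<in> ?V"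
    then obtain p q where pq: "p \<in> poly_fun I" "q \<in> poly_fun I" "q x \<noteq> 0"
      "\<forall>y\<in>U. q y \<noteq> 0 \<longrightarrow> f y = p y / q y"
      by (auto elim: regular_onE[OF reg, of x])
    show "\<exists>p\<in>poly_fun I. \<exists>q\<in>poly_fun I. q x \<noteq> 0 \<and> (\<forall>y\<in>?V. q y \<noteq> 0 \<longrightarrow> 1 / f y = p y / q y)"
      using pq x by - (rule bexI[of _ "\<lambda>u. q u * q u"], rule bexI[of _ "\<lambda>u. p u * q u"], auto intro: poly_fun.intros)
  qed
  then show "(\<lambda>x\<in>?V. 1 / f x) \<in> sections (subspace_of (affine_space I) S) ?V"
    by (simp add: sec')
qed

section \<open>Morphisms into affine space\<close>

lemma ringed_poly_section:
  assumes X: "ringed X"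
    and reg: "\<And>i. i \<in> I \<Longrightarrow> (\<lambda>x\<in>points X. \<phi> x i) \<in> sections X (points X)"
    and p: "p \<in> poly_fun I"
  shows "(\<lambda>x\<in>points X. p (\<phi> x)) \<in> sections X (points X)"
  using p
proof induction
  case (const c)
  then show ?case
    by (intro ringedD(2)[OF X]) auto
next
  case (add p q)
  show ?case
    using ringedD(3)[OF X openin_topspace add.IH] by (rule back_subst[of "\<lambda>f. f \<in> _"]) (simp add: fun_eq_iff)
next
  case (mult p q)
  show ?case
    using ringedD(4)[OF X openin_topspace mult.IH] by (rule back_subst[of "\<lambda>f. f \<in> _"]) (simp add: fun_eq_iff)
qed (rule reg)

text \<open>The universal property of affine space. Polynomials in regular coordinates are regular,
  their nonvanishing loci are open, and a local quotient p / q pulls back to a product of a section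
  with an inverse.\<close>

lemma morphism_into_affine_space:
  assumes X: "ringed X" and vec: "\<And>x. x \<in> points X \<Longrightarrow> \<phi> x \<in> vectors I"
    and reg: "\<And>i. i \<in> I \<Longrightarrow> (\<lambda>x\<in>points X. \<phi> x i) \<in> sections X (points X)"
  shows "morphism X (affine_space I) \<phi>"
proof -
  have P: "(\<lambda>x\<in>points X. p (\<phi> x)) \<in> sections X (points X)" if "p \<in> poly_fun I" for p
    using ringed_poly_section[OF X reg that] .
  have nz: "{x \<in> points X. (\<lambda>x\<in>points X. p (\<phi> x)) x \<noteq> 0} = {x \<in> points X. p (\<phi> x) \<noteq> 0}"
    for p :: "(nat \<Rightarrow> complex) \<Rightarrow> complex"
    by auto
  have op: "openin (zar X) {x \<in> points X. p (\<phi> x) \<noteq> 0}" if "p \<in> poly_fun I" for p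
    using ringedD(5)[OF X openin_topspace P[OF that]] unfolding nz .
  have cont: "continuous_map (zar X) (zar (affine_space I)) \<phi>"
    unfolding affine_space_def fspace.sel
  proof (rule continuous_on_generated_topo)
    fix U assume "U \<in> {{u \<in> vectors I. p u \<noteq> 0} | p. p \<in> poly_fun I}"
    then obtain p where p: "p \<in> poly_fun I" "U = {u \<in> vectors I. p u \<noteq> 0}"
      by blast
    have "\<phi> -` U \<inter> points X = {x \<in> points X. p (\<phi> x) \<noteq> 0}"
      using vec p(2) by auto
    then show "openin (zar X) (\<phi> -` U \<inter> points X)"
      using op[OF p(1)] by simp
  next
    show "\<phi> ` points X \<subseteq> \<Union>{{u \<in> vectors I. p u \<noteq> 0} | p. p \<in> poly_fun I}"
      using vec points_affine_space[of I] by (auto simp: affine_space_def)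
  qed
  show ?thesis
    unfolding morphism_def
  proof (intro conjI cont allI impI ballI)
    fix U f assume U: "openin (zar (affine_space I)) U" and f: "f \<in> sections (affine_space I) U"
    let ?P = "{x \<in> points X. \<phi> x \<in> U}"
    have OP: "openin (zar X) ?P"
      using cont U by (simp add: continuous_map_def)
    show "restrict (f \<circ> \<phi>) ?P \<in> sections X ?P"
    proof (rule sections_glue[OF ringedD(1)[OF X] OP])
      fix x assume x: "x \<in> ?P"
      obtain p q where pq: "p \<in> poly_fun I" "q \<in> poly_fun I" "q (\<phi> x) \<noteq> 0"
        "\<forall>y\<in>U. q y \<noteq> 0 \<longrightarrow> f y = p y / q y"
        by (rule regular_onE[of I U f "\<phi> x"]) (use f x in \<open>auto simp: sections_affine_space\<close>)
      let ?W = "{x \<in> points X. q (\<phi> x) \<noteq> 0}"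
      note W = op[OF pq(2)]
      have "(\<lambda>x\<in>?W. 1 / (\<lambda>x\<in>points X. q (\<phi> x)) x) \<in> sections X ?W"
        using ringedD(6)[OF X openin_topspace P[OF pq(2)]] unfolding nz .
      then have 1: "(\<lambda>x\<in>?W. 1 / q (\<phi> x)) \<in> sections X ?W"
        by (simp cong: restrict_cong conj_cong)
      have "restrict (\<lambda>x\<in>points X. p (\<phi> x)) ?W \<in> sections X ?W"
        by (rule sections_restrict[OF ringedD(1)[OF X] openin_topspace P[OF pq(1)] W]) auto
      then have 2: "(\<lambda>x\<in>?W. p (\<phi> x)) \<in> sections X ?W"
        by (simp add: Int_absorb1 Collect_conj_eq[symmetric] restrict_restrict)
      show "\<exists>W g. openin (zar X) W \<and> x \<in> W \<and> g \<in> sections X W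
          \<and> (\<forall>y\<in>?P \<inter> W. restrict (f \<circ> \<phi>) ?P y = g y)"
        using ringedD(4)[OF X W 2 1] W x pq
        by (intro exI[of _ ?W] exI[of _ "\<lambda>x\<in>?W. (\<lambda>x\<in>?W. p (\<phi> x)) x * (\<lambda>x\<in>?W. 1 / q (\<phi> x)) x"]) auto
    qed simp
  qed
qed

lemma coordinate_section:
  assumes \<phi>: "morphism X (affine_space I) \<phi>" and i: "i \<in> I"
  shows "(\<lambda>x\<in>points X. \<phi> x i) \<in> sections X (points X)"
proof -
  have "(\<lambda>u\<in>vectors I. u i) \<in> sections (affine_space I) (vectors I)"
    using i by (auto simp: sections_affine_space intro!: regular_on_poly[of "\<lambda>u. u i"] poly_fun.coord)
  moreover have "openin (zar (affine_space I)) (vectors I)"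
    using openin_topspace[of "zar (affine_space I)"] by simp
  ultimately have "restrict ((\<lambda>u\<in>vectors I. u i) \<circ> \<phi>) {x \<in> points X. \<phi> x \<in> vectors I}
      \<in> sections X {x \<in> points X. \<phi> x \<in> vectors I}"
    using morphism_pullback[OF \<phi>] by blast
  moreover have "{x \<in> points X. \<phi> x \<in> vectors I} = points X"
    using morphism_point[OF \<phi>] by auto
  moreover have "restrict ((\<lambda>u\<in>vectors I. u i) \<circ> \<phi>) (points X) = (\<lambda>x\<in>points X. \<phi> x i)"
    using morphism_point[OF \<phi>] by (auto simp: fun_eq_iff)
  ultimately show ?thesis
    by simp
qed

lemma points_affine_subspace [simp]:
  "S \<subseteq> vectors I \<Longrightarrow> points (subspace_of (affine_space I) S) = S"
  by auto

lemma morphism_affine_subspaces: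
  assumes S: "S \<subseteq> vectors I" and T: "T \<subseteq> vectors J" and \<phi>: "\<And>x. x \<in> S \<Longrightarrow> \<phi> x \<in> T"
    and reg: "\<And>j. j \<in> J \<Longrightarrow> regular_on I S (\<lambda>x. \<phi> x j)"
  shows "morphism (subspace_of (affine_space I) S) (subspace_of (affine_space J) T) \<phi>"
proof (rule morphism_into_subspace)
  show "is_sheaf (subspace_of (affine_space I) S)"
    by (intro is_sheaf_subspace_of is_sheaf_affine_space)
  show "morphism (subspace_of (affine_space I) S) (affine_space J) \<phi>"
  proof (rule morphism_into_affine_space[OF ringed_affine_subspace[OF S]])
    fix j assume "j \<in> J"
    then have "regular_on I S (\<lambda>x\<in>S. \<phi> x j)"
      using reg by (simp cong: regular_on_cong)
    then show "(\<lambda>x\<in>points (subspace_of (affine_space I) S). \<phi> x j)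
        \<in> sections (subspace_of (affine_space I) S) (points (subspace_of (affine_space I) S))"
      unfolding points_affine_subspace[OF S] by (simp add: sections_affine_subspace[OF S])
  next
    fix x assume "x \<in> points (subspace_of (affine_space I) S)"
    then have "\<phi> x \<in> T"
      using \<phi> by simp
    then show "\<phi> x \<in> vectors J"
      using T by blast
  qed
qed (use \<phi> in simp)

lemma isomorphic_affine_subspaces:
  assumes S: "S \<subseteq> vectors I" and T: "T \<subseteq> vectors J"
    and \<phi>: "\<And>x. x \<in> S \<Longrightarrow> \<phi> x \<in> T" "\<And>j. j \<in> J \<Longrightarrow> regular_on I S (\<lambda>x. \<phi> x j)"
    and \<psi>: "\<And>y. y \<in> T \<Longrightarrow> \<psi> y \<in> S" "\<And>i. i \<in> I \<Longrightarrow> regular_on J T (\<lambda>y. \<psi> y i)"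
    and inv: "\<And>x. x \<in> S \<Longrightarrow> \<psi> (\<phi> x) = x" "\<And>y. y \<in> T \<Longrightarrow> \<phi> (\<psi> y) = y"
  shows "subspace_of (affine_space I) S \<cong>\<^sub>v subspace_of (affine_space J) T"
  unfolding isomorphic_def
  using morphism_affine_subspaces[OF S T \<phi>] morphism_affine_subspaces[OF T S \<psi>] inv
  by (intro exI[of _ \<phi>] exI[of _ \<psi>]) (simp add: S T points_affine_subspace del: zar_subspace_of)

section \<open>Classes of quasi-affine varieties\<close>

abbreviation affine_sub :: "nat set \<Rightarrow> (nat \<Rightarrow> complex) set \<Rightarrow> (nat \<Rightarrow> complex) fspace" where
  "affine_sub I S \<equiv> subspace_of (affine_space I) S"

text \<open>The type \<open>variety\<close> only contains spaces whose points are sets of vectors.\<close>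

definition singletons :: "'a fspace \<Rightarrow> 'a set fspace" where
  "singletons X = FSpace (pullback_topology (range (\<lambda>x. {x})) the_elem (zar X))
     (\<lambda>W. {f \<in> extensional W. (\<lambda>x\<in>the_elem ` W. f {x}) \<in> sections X (the_elem ` W)})"

lemma openin_singletons:
  "openin (zar (singletons X)) W \<longleftrightarrow> (\<exists>U. openin (zar X) U \<and> W = (\<lambda>x. {x}) ` U)"
proof -
  have "the_elem -` U \<inter> range (\<lambda>x. {x}) = (\<lambda>x. {x}) ` U" for U :: "'a set"
    by auto
  then show ?thesis
    by (simp add: singletons_def openin_pullback_topology)
qed

lemma points_singletons [simp]: "points (singletons X) = (\<lambda>x. {x}) ` points X"
  by (auto simp: singletons_def topspace_pullback_topology)

lemma sections_singletons:
  "f \<in> sections (singletons X) ((\<lambda>x. {x}) ` U) \<longleftrightarrow>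
     f \<in> extensional ((\<lambda>x. {x}) ` U) \<and> (\<lambda>x\<in>U. f {x}) \<in> sections X U"
  by (simp add: singletons_def image_image)

lemma is_sheaf_singletons:
  assumes X: "is_sheaf X"
  shows "is_sheaf (singletons X)"
  unfolding is_sheaf_def
proof (intro allI impI conjI ballI)
  fix W assume "openin (zar (singletons X)) W"
  then obtain U where U: "openin (zar X) U" "W = (\<lambda>x. {x}) ` U"
    unfolding openin_singletons by auto
  show "sections (singletons X) W \<subseteq> extensional W"
    unfolding U(2) by (auto simp: sections_singletons)
  { fix f W' assume f: "f \<in> sections (singletons X) W"
      and W': "openin (zar (singletons X)) W' \<and> W' \<subseteq> W"
    then obtain U' where U': "openin (zar X) U'" "W' = (\<lambda>x. {x}) ` U'"
      unfolding openin_singletons by auto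
    have "U' \<subseteq> U"
      using U(2) U'(2) W' by auto
    then have "restrict (\<lambda>x\<in>U. f {x}) U' \<in> sections X U'"
      using f unfolding U(2) sections_singletons by (intro sections_restrict[OF X U(1) _ U'(1)]) auto
    moreover have "restrict (\<lambda>x\<in>U. f {x}) U' = (\<lambda>x\<in>U'. restrict f W' {x})"
      using \<open>U' \<subseteq> U\<close> U'(2) by (auto simp: fun_eq_iff)
    ultimately show "restrict f W' \<in> sections (singletons X) W'"
      unfolding U'(2) sections_singletons by simp }
  fix f assume f: "f \<in> extensional W"
    and loc: "\<forall>x\<in>W. \<exists>W'. openin (zar (singletons X)) W' \<and> x \<in> W' \<and> W' \<subseteq> W \<and>
        restrict f W' \<in> sections (singletons X) W'"
  have "(\<lambda>x\<in>U. f {x}) \<in> sections X U"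
  proof (rule sections_glue[OF X U(1)])
    fix x assume "x \<in> U"
    then have "{x} \<in> W"
      using U by simp
    from bspec[OF loc this] obtain W' where W': "openin (zar (singletons X)) W'" "{x} \<in> W'" "W' \<subseteq> W"
      "restrict f W' \<in> sections (singletons X) W'"
      by auto
    then obtain U' where U': "openin (zar X) U'" "W' = (\<lambda>x. {x}) ` U'"
      unfolding openin_singletons by auto
    show "\<exists>W g. openin (zar X) W \<and> x \<in> W \<and> g \<in> sections X W \<and> (\<forall>y\<in>U \<inter> W. (\<lambda>x\<in>U. f {x}) y = g y)"
      using W' U' unfolding U'(2) sections_singletons
      by (intro exI[of _ U'] exI[of _ "\<lambda>x\<in>U'. restrict f ((\<lambda>x. {x}) ` U') {x}"]) auto
  qed simp
  then show "f \<in> sections (singletons X) W"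
    using f unfolding U(2) sections_singletons by simp
qed

lemma singletons_isomorphic:
  assumes X: "is_sheaf X"
  shows "singletons X \<cong>\<^sub>v X"
  unfolding isomorphic_def
proof (intro exI[of _ the_elem] exI[of _ "\<lambda>x. {x}"] conjI)
  have pre: "{P \<in> points (singletons X). the_elem P \<in> U} = (\<lambda>x. {x}) ` U"
    if "openin (zar X) U" for U
    using openin_subset[OF that] by auto
  show "morphism (singletons X) X the_elem"
    unfolding morphism_def
  proof (intro conjI allI impI ballI)
    show "continuous_map (zar (singletons X)) (zar X) the_elem"
      unfolding continuous_map_def using pre by (auto simp: openin_singletons)
    fix U f assume U: "openin (zar X) U" and f: "f \<in> sections X U"
    have "(\<lambda>x\<in>U. f x) = f"
      using sections_extensional[OF X U f] by (simp add: extensional_restrict)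
    then show "restrict (f \<circ> the_elem) {P \<in> points (singletons X). the_elem P \<in> U}
        \<in> sections (singletons X) {P \<in> points (singletons X). the_elem P \<in> U}"
      using f unfolding pre[OF U] sections_singletons by (auto cong: restrict_cong)
  qed
  have pre': "{x \<in> points X. {x} \<in> (\<lambda>x. {x}) ` U} = U"
    if "openin (zar X) U" for U
    using openin_subset[OF that] by auto
  show "morphism X (singletons X) (\<lambda>x. {x})"
    unfolding morphism_def
  proof (intro conjI allI impI ballI)
    show "continuous_map (zar X) (zar (singletons X)) (\<lambda>x. {x})"
      unfolding continuous_map_def using pre' by (auto simp: openin_singletons)
    fix W f assume W: "openin (zar (singletons X)) W" and f: "f \<in> sections (singletons X) W"
    then obtain U where U: "openin (zar X) U" "W = (\<lambda>x. {x}) ` U"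
      unfolding openin_singletons by auto
    show "restrict (f \<circ> (\<lambda>x. {x})) {x \<in> points X. {x} \<in> W} \<in> sections X {x \<in> points X. {x} \<in> W}"
      using f unfolding U(2) pre'[OF U(1)] sections_singletons by (simp add: comp_def)
  qed
qed auto

section \<open>Affine varieties are varieties\<close>

text \<open>After embedding X into affine space, two morphisms disagree at x exactly if some
  coordinate does. The locus of disagreement is a union of nonvanishing loci of differences of
  regular functions, hence open.\<close>

lemma separated_if_affine:
  assumes "affine_variety X"
  shows "separated X"
  unfolding separated_def
proof (intro allI impI)
  fix J V \<phi> \<psi>
  assume V: "closedin (zar (affine_space J)) V"
    and \<phi>: "morphism (affine_sub J V) X \<phi>" and \<psi>: "morphism (affine_sub J V) X \<psi>"
  obtain I C where C: "closedin (zar (affine_space I)) C" and "X \<cong>\<^sub>v affine_sub I C"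
    using assms unfolding affine_variety_def by blast
  then obtain \<theta> \<eta> where \<theta>: "morphism X (affine_sub I C) \<theta>"
    and inv: "\<forall>x\<in>points X. \<eta> (\<theta> x) = x"
    unfolding isomorphic_def by blast
  have VJ: "V \<subseteq> vectors J"
    using closedin_subset[OF V] by simp
  have CI: "C \<subseteq> vectors I"
    using closedin_subset[OF C] by simp
  note R = ringed_affine_subspace[OF VJ]
  have \<theta>': "morphism X (affine_space I) \<theta>"
    using morphism_comp[OF \<theta> morphism_inclusion] by simp
  have ptV: "points (affine_sub J V) = V"
    by (rule points_affine_subspace[OF VJ])
  have openV: "openin (zar (affine_sub J V)) V"
    using openin_topspace[of "zar (affine_sub J V)"] ptV by simp
  have op: "openin (zar (affine_sub J V)) {x \<in> V. \<theta> (\<phi> x) i \<noteq> \<theta> (\<psi> x) i}" if i: "i \<in> I" for i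
  proof -
    have 1: "(\<lambda>x\<in>V. \<theta> (\<phi> x) i) \<in> sections (affine_sub J V) V"
      using coordinate_section[OF morphism_comp[OF \<phi> \<theta>'] i] unfolding ptV by simp
    have 2: "(\<lambda>x\<in>V. \<theta> (\<psi> x) i) \<in> sections (affine_sub J V) V"
      using coordinate_section[OF morphism_comp[OF \<psi> \<theta>'] i] unfolding ptV by simp
    have 3: "(\<lambda>x\<in>V. - 1) \<in> sections (affine_sub J V) V"
      by (rule ringedD(2)[OF R openV]) simp
    \<comment> \<open>The difference of the coordinates, written with a factor -1 because
      \<open>ringed\<close> offers constants, sums and products.\<close>
    have "{x \<in> V. (\<lambda>x\<in>V. (\<lambda>x\<in>V. \<theta> (\<phi> x) i) x +
        (\<lambda>x\<in>V. (\<lambda>x\<in>V. - 1) x * (\<lambda>x\<in>V. \<theta> (\<psi> x) i) x) x) x \<noteq> 0}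
      = {x \<in> V. \<theta> (\<phi> x) i \<noteq> \<theta> (\<psi> x) i}"
      by auto
    then show ?thesis
      using ringedD(5)[OF R openV ringedD(3)[OF R openV 1 ringedD(4)[OF R openV 3 2]]] by simp
  qed
  have "V - {x \<in> V. \<phi> x = \<psi> x} = (\<Union>i\<in>I. {x \<in> V. \<theta> (\<phi> x) i \<noteq> \<theta> (\<psi> x) i})"
  proof (intro equalityI subsetI)
    fix x assume x: "x \<in> V - {x \<in> V. \<phi> x = \<psi> x}"
    have pts: "\<phi> x \<in> points X" "\<psi> x \<in> points X"
      using morphism_point[OF \<phi>, of x] morphism_point[OF \<psi>, of x] x ptV by auto
    then have "\<eta> (\<theta> (\<phi> x)) \<noteq> \<eta> (\<theta> (\<psi> x))"
      using inv x by simp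
    then have "\<theta> (\<phi> x) \<noteq> \<theta> (\<psi> x)"
      by auto
    moreover have "\<theta> (\<phi> x) \<in> vectors I" "\<theta> (\<psi> x) \<in> vectors I"
      using morphism_point[OF \<theta>'] pts by auto
    ultimately obtain i where "i \<in> I" "\<theta> (\<phi> x) i \<noteq> \<theta> (\<psi> x) i"
      using PiE_ext[of "\<theta> (\<phi> x)" I "\<lambda>_. UNIV" "\<theta> (\<psi> x)"] by auto
    then show "x \<in> (\<Union>i\<in>I. {x \<in> V. \<theta> (\<phi> x) i \<noteq> \<theta> (\<psi> x) i})"
      using x by auto
  qed auto
  moreover have "openin (zar (affine_sub J V)) (\<Union>i\<in>I. {x \<in> V. \<theta> (\<phi> x) i \<noteq> \<theta> (\<psi> x) i})"
    using op by (intro openin_Union) auto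
  ultimately show "closedin (zar (affine_sub J V)) {x \<in> V. \<phi> x = \<psi> x}"
    unfolding closedin_def ptV by simp
qed

lemma is_variety_if_affine:
  assumes "affine_variety X" "is_sheaf X"
  shows "is_variety X"
proof -
  have "affine_variety (subspace_of X (points X))"
    using assms isomorphic_trans[OF isomorphic_whole_subspace[OF assms(2) order_refl]]
    unfolding affine_variety_def by blast
  then have "prevariety X"
    unfolding prevariety_def using assms(2) by (intro conjI exI[of _ "{points X}"]) auto
  then show ?thesis
    using separated_if_affine[OF assms(1)] by (simp add: is_variety_def)
qed

text \<open>\<open>ringed\<close> is local and invariant under isomorphism, so it is inherited from
  the affine charts. It is needed for the arbitrary test objects in
  \<open>is_product\<close>.\<close>

lemma ringed_variety: "is_variety X \<Longrightarrow> ringed X"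
proof -
  assume "is_variety X"
  then obtain \<U> where X: "is_sheaf X" and \<U>: "\<Union>\<U> = points X"
    "\<forall>U\<in>\<U>. openin (zar X) U \<and> affine_variety (subspace_of X U)"
    unfolding is_variety_def prevariety_def by blast
  show ?thesis
  proof (rule ringed_local[OF X])
    fix x assume "x \<in> points X"
    then obtain U where U: "U \<in> \<U>" "x \<in> U"
      using \<U>(1) by blast
    then obtain I V where V: "closedin (zar (affine_space I)) V" and iso: "subspace_of X U \<cong>\<^sub>v affine_sub I V"
      using \<U>(2) unfolding affine_variety_def by blast
    have "V \<subseteq> vectors I"
      using closedin_subset[OF V] by simp
    then have "ringed (subspace_of X U)"
      by (intro ringed_isomorphic[OF ringed_affine_subspace is_sheaf_subspace_of[OF X] iso])
    then show "\<exists>C. openin (zar X) C \<and> x \<in> C \<and> ringed (subspace_of X C)"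
      using U \<U>(2) by blast
  qed
qed

section \<open>Well-definedness of classes and the scissor relation\<close>

text \<open>Guards the Hilbert choice in \<open>K0_class\<close>: only under this condition is the
  chosen variety known to be isomorphic to X.\<close>

definition has_class :: "'a fspace \<Rightarrow> bool" where
  "has_class X \<longleftrightarrow> (\<exists>V. Rep_variety V \<cong>\<^sub>v X)"

lemma has_class_isomorphic: "has_class X \<Longrightarrow> X \<cong>\<^sub>v Y \<Longrightarrow> has_class Y"
  unfolding has_class_def using isomorphic_trans[of _ X Y] by auto

text \<open>Isomorphic spaces have the same representatives, so the choice returns the same variety.
  The point types may differ, which is how classes pass from matrices to the projective
  complement.\<close>

lemma K0_class_isomorphic:
  assumes "X \<cong>\<^sub>v Y"
  shows "K0_class X = K0_class Y"
proof -
  have "(Rep_variety V \<cong>\<^sub>v X) = (Rep_variety V \<cong>\<^sub>v Y)" for V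
    using isomorphic_trans[OF _ assms] isomorphic_trans[OF _ isomorphic_sym[OF assms]] by auto
  then show ?thesis
    by (simp add: K0_class_def)
qed

lemma K0_relations:
  assumes "a \<in> iso_relations \<union> scissor_relations \<union> product_relations \<union> unit_relations"
  shows "a \<in> K0_ideal"
  unfolding K0_ideal_def by (rule module.span_base[OF module_free_ring assms])

lemma K0_gen_isomorphic:
  assumes "Rep_variety V \<cong>\<^sub>v Rep_variety W"
  shows "K0_gen V = K0_gen W"
  using assms
proof transfer
  fix V W assume "Rep_variety V \<cong>\<^sub>v Rep_variety W"
  then have "gen V - gen W \<in> iso_relations"
    unfolding iso_relations_def by blast
  then show "K0_rel (gen V) (gen W)"
    unfolding K0_rel_def by (intro K0_relations) simp
qed

lemma K0_class_eq_gen: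
  assumes "Rep_variety V \<cong>\<^sub>v X"
  shows "K0_class X = K0_gen V"
  unfolding K0_class_def
proof (rule K0_gen_isomorphic)
  have "Rep_variety (SOME V. Rep_variety V \<cong>\<^sub>v X) \<cong>\<^sub>v X"
    using assms by (rule someI)
  then show "Rep_variety (SOME V. Rep_variety V \<cong>\<^sub>v X) \<cong>\<^sub>v Rep_variety V"
    by (rule isomorphic_trans[OF _ isomorphic_sym[OF assms]])
qed

text \<open>Whatever the point type of X, its closed model in affine space has vectors as points,
  and \<open>singletons\<close> moves that model into the type underlying
  \<open>variety\<close>.\<close>

lemma has_class_affine_variety:
  assumes "affine_variety (X :: 'a fspace)"
  shows "has_class X"
proof -
  obtain I V where V: "finite I" "closedin (zar (affine_space I)) V" and iso: "X \<cong>\<^sub>v affine_sub I V"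
    using assms unfolding affine_variety_def by blast
  let ?Y = "singletons (affine_sub I V)"
  have sh: "is_sheaf (affine_sub I V)"
    by (intro is_sheaf_subspace_of is_sheaf_affine_space)
  have "is_variety ?Y"
  proof (rule is_variety_if_affine)
    show "affine_variety ?Y"
      unfolding affine_variety_def using V singletons_isomorphic[OF sh] by blast
  qed (rule is_sheaf_singletons[OF sh])
  then have "Rep_variety (Abs_variety ?Y) = ?Y"
    by (simp add: Abs_variety_inverse)
  then have "Rep_variety (Abs_variety ?Y) \<cong>\<^sub>v X"
    using isomorphic_trans[OF singletons_isomorphic[OF sh] isomorphic_sym[OF iso]] by simp
  then show ?thesis
    unfolding has_class_def by blast
qed

text \<open>The scissor relations speak about elements of \<open>variety\<close>, so C is
  transported to the chosen representative of X along the isomorphism; complement and subspace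
  structure are carried along.\<close>

lemma K0_class_scissor:
  assumes X: "has_class X" and C: "closedin (zar X) C"
    and "has_class (subspace_of X C)" "has_class (subspace_of X (points X - C))"
  shows "K0_class X = K0_class (subspace_of X C) + K0_class (subspace_of X (points X - C))"
proof -
  obtain V where V: "Rep_variety V \<cong>\<^sub>v X"
    using X unfolding has_class_def by blast
  obtain Y where Y: "Rep_variety Y \<cong>\<^sub>v subspace_of X C"
    using assms(3) unfolding has_class_def by blast
  obtain U where U: "Rep_variety U \<cong>\<^sub>v subspace_of X (points X - C)"
    using assms(4) unfolding has_class_def by blast
  obtain \<phi> \<psi> where \<phi>: "morphism (Rep_variety V) X \<phi>" and \<psi>: "morphism X (Rep_variety V) \<psi>"
    and "\<forall>x\<in>points (Rep_variety V). \<psi> (\<phi> x) = x" "\<forall>y\<in>points X. \<phi> (\<psi> y) = y"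
    using V unfolding isomorphic_def by blast
  then have inv: "\<And>x. x \<in> points (Rep_variety V) \<Longrightarrow> \<psi> (\<phi> x) = x" "\<And>y. y \<in> points X \<Longrightarrow> \<phi> (\<psi> y) = y"
    by auto
  let ?C = "{x \<in> points (Rep_variety V). \<phi> x \<in> C}"
  have C': "closedin (zar (Rep_variety V)) ?C"
    by (rule closedin_continuous_map_preimage[OF _ C]) (use \<phi> in \<open>simp add: morphism_def\<close>)
  have compl: "{x \<in> points (Rep_variety V). \<phi> x \<in> points X - C} = points (Rep_variety V) - ?C"
    using morphism_point[OF \<phi>] by auto
  have "Rep_variety Y \<cong>\<^sub>v subspace_of (Rep_variety V) ?C"
    using isomorphic_trans[OF Y isomorphic_sym[OF isomorphic_subspace[OF \<phi> \<psi> inv]]] by simp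
  moreover have "Rep_variety U \<cong>\<^sub>v subspace_of (Rep_variety V) (points (Rep_variety V) - ?C)"
    using isomorphic_trans[OF U isomorphic_sym[OF isomorphic_subspace[OF \<phi> \<psi> inv]]]
    unfolding compl by simp
  ultimately have "gen V - (gen Y + gen U) \<in> scissor_relations"
    unfolding scissor_relations_def using C'
    by (intro CollectI exI[of _ V] exI[of _ Y] exI[of _ U]) auto
  then have "K0_rel (gen V) (gen Y + gen U)"
    unfolding K0_rel_def by (intro K0_relations) simp
  then have "K0_gen V = K0_gen Y + K0_gen U"
    by transfer
  then show ?thesis
    using K0_class_eq_gen[OF V] K0_class_eq_gen[OF Y] K0_class_eq_gen[OF U] by simp
qed

section \<open>Quasi-affine sets and Rabinowitsch's trick\<close>

text \<open>One inequation is enough, as further ones can be multiplied into f, and it keeps the set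
  isomorphic to a closed one. The family of equations may be infinite.\<close>

definition quasi_affine :: "nat set \<Rightarrow> (nat \<Rightarrow> complex) set \<Rightarrow> bool" where
  "quasi_affine I S \<longleftrightarrow> (\<exists>P\<subseteq>poly_fun I. \<exists>f\<in>poly_fun I. S = {u \<in> vectors I. (\<forall>p\<in>P. p u = 0) \<and> f u \<noteq> 0})"

lemma quasi_affineE:
  assumes "quasi_affine I S"
  obtains P f where "P \<subseteq> poly_fun I" "f \<in> poly_fun I" "S = {u \<in> vectors I. (\<forall>p\<in>P. p u = 0) \<and> f u \<noteq> 0}"
  using assms unfolding quasi_affine_def by (elim exE conjE bexE)

lemma quasi_affineI:
  "P \<subseteq> poly_fun I \<Longrightarrow> f \<in> poly_fun I \<Longrightarrow> S = {u \<in> vectors I. (\<forall>p\<in>P. p u = 0) \<and> f u \<noteq> 0} \<Longrightarrow>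
    quasi_affine I S"
  unfolding quasi_affine_def by (intro exI[of _ P] conjI bexI[of _ f])

lemma quasi_affine_subset: "quasi_affine I S \<Longrightarrow> S \<subseteq> vectors I"
  by (erule quasi_affineE) simp

lemma quasi_affine_vectors: "quasi_affine I (vectors I)"
  by (rule quasi_affineI[of "{}" I "\<lambda>_. 1"]) (auto intro: poly_fun.const)

lemma quasi_affine_zeros:
  assumes "quasi_affine I S" "G \<subseteq> poly_fun I"
  shows "quasi_affine I {u \<in> S. \<forall>g\<in>G. g u = 0}"
proof -
  obtain P f where "P \<subseteq> poly_fun I" "f \<in> poly_fun I" "S = {u \<in> vectors I. (\<forall>p\<in>P. p u = 0) \<and> f u \<noteq> 0}"
    by (rule quasi_affineE[OF assms(1)])
  then show ?thesis
    using assms(2) by (intro quasi_affineI[of "P \<union> G" I f]) auto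
qed

lemma quasi_affine_zero: "quasi_affine I S \<Longrightarrow> g \<in> poly_fun I \<Longrightarrow> quasi_affine I {u \<in> S. g u = 0}"
  using quasi_affine_zeros[of I S "{g}"] by simp

lemma quasi_affine_nonzero:
  assumes "quasi_affine I S" "g \<in> poly_fun I"
  shows "quasi_affine I {u \<in> S. g u \<noteq> 0}"
proof -
  obtain P f where "P \<subseteq> poly_fun I" "f \<in> poly_fun I" "S = {u \<in> vectors I. (\<forall>p\<in>P. p u = 0) \<and> f u \<noteq> 0}"
    by (rule quasi_affineE[OF assms(1)])
  then show ?thesis
    using assms(2) by (intro quasi_affineI[of P I "\<lambda>u. f u * g u"]) (auto intro: poly_fun.intros)
qed

lemma closedin_zeros:
  assumes "P \<subseteq> poly_fun I"
  shows "closedin (zar (affine_space I)) {u \<in> vectors I. \<forall>p\<in>P. p u = 0}"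
proof -
  have "openin (zar (affine_space I)) (vectors I - {u \<in> vectors I. \<forall>p\<in>P. p u = 0})"
    unfolding openin_affine_space
  proof (intro conjI ballI)
    fix x assume "x \<in> vectors I - {u \<in> vectors I. \<forall>p\<in>P. p u = 0}"
    then obtain p where "p \<in> P" "p x \<noteq> 0"
      by auto
    then show "\<exists>p\<in>poly_fun I. p x \<noteq> 0 \<and> {u \<in> vectors I. p u \<noteq> 0} \<subseteq> vectors I - {u \<in> vectors I. \<forall>p\<in>P. p u = 0}"
      using assms by (intro bexI[of _ p]) auto
  qed auto
  then show ?thesis
    by (auto simp: closedin_def)
qed

text \<open>Rabinowitsch's trick: an additional coordinate j subject to f u * u j = 1 turns the
  inequation into an equation, with the graph of 1 / f as the isomorphism.\<close>

lemma affine_variety_quasi_affine: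
  assumes "finite I" "quasi_affine I S"
  shows "affine_variety (affine_sub I S)"
proof -
  obtain P f where P: "P \<subseteq> poly_fun I" and f: "f \<in> poly_fun I"
    and S: "S = {u \<in> vectors I. (\<forall>p\<in>P. p u = 0) \<and> f u \<noteq> 0}"
    by (rule quasi_affineE[OF assms(2)])
  obtain j where j: "j \<notin> I"
    using ex_new_if_finite[OF infinite_UNIV_nat assms(1)] by blast
  let ?J = "insert j I"
  let ?C = "{u \<in> vectors ?J. \<forall>p\<in>insert (\<lambda>u. f u * u j - 1) P. p u = 0}"
  have f': "f \<in> poly_fun ?J" and P': "P \<subseteq> poly_fun ?J"
    using poly_fun_mono[of _ I ?J] f subsetD[OF P] by auto
  have loc: "p (u(j := c)) = p u" if "p \<in> poly_fun I" for p u c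
    by (rule poly_fun_cong[OF that]) (use j in auto)
  have "closedin (zar (affine_space ?J)) ?C"
    using P' f' by (intro closedin_zeros insert_subsetI poly_fun_diff poly_fun.mult poly_fun.coord poly_fun.const) auto
  moreover have "affine_sub I S \<cong>\<^sub>v affine_sub ?J ?C"
  proof (rule isomorphic_affine_subspaces[of S I ?C ?J "\<lambda>u. u(j := 1 / f u)" "\<lambda>v. restrict v I"])
    show "u(j := 1 / f u) \<in> ?C" if "u \<in> S" for u
      using that P f by (auto simp: S loc subset_iff PiE_def extensional_def)
    show "regular_on I S (\<lambda>x. (x(j := 1 / f x)) i)" if "i \<in> ?J" for i
    proof (cases "i = j")
      case True
      then show ?thesis
        using f by (intro regular_on_quotient[of "\<lambda>_. 1" I f]) (auto simp: S intro: poly_fun.intros)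
    next
      case False
      then show ?thesis
        using that by (intro regular_on_poly[of "\<lambda>u. u i"]) (auto intro: poly_fun.intros)
    qed
    show "restrict v I \<in> S" if "v \<in> ?C" for v
      using that P f by (auto simp: S subset_iff)
    show "regular_on ?J ?C (\<lambda>y. restrict y I i)" if "i \<in> I" for i
      using that by (intro regular_on_poly[of "\<lambda>u. u i"]) (auto intro: poly_fun.intros)
    show "restrict (u(j := 1 / f u)) I = u" if "u \<in> S" for u
      using that j by (auto simp: S fun_eq_iff PiE_def extensional_def)
    show "(restrict v I)(j := 1 / f (restrict v I)) = v" if "v \<in> ?C" for v
    proof -
      have "f v * v j = 1" "v \<in> extensional ?J"
        using that by (auto simp: PiE_def)
      then have "v j = 1 / f v"
        by (metis div_by_0 mult_cancel_left2 mult_zero_left nonzero_eq_divide_eq mult.commute)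
      then show ?thesis
        using \<open>v \<in> extensional ?J\<close> f by (auto simp: fun_eq_iff extensional_def)
    qed
  qed (auto simp: S)
  ultimately show ?thesis
    unfolding affine_variety_def using assms(1) by blast
qed

lemma has_class_quasi_affine: "finite I \<Longrightarrow> quasi_affine I S \<Longrightarrow> has_class (affine_sub I S)"
  by (intro has_class_affine_variety affine_variety_quasi_affine)

text \<open>The working form of the scissor relation. Both pieces are again quasi-affine, so they
  have classes and the cutting can be iterated.\<close>

lemma K0_class_split:
  assumes I: "finite I" and S: "quasi_affine I S" and g: "g \<in> poly_fun I"
  shows "K0_class (affine_sub I S)
    = K0_class (affine_sub I {u \<in> S. g u = 0}) + K0_class (affine_sub I {u \<in> S. g u \<noteq> 0})"
proof -
  note SI = quasi_affine_subset[OF S]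
  let ?C = "{u \<in> S. g u = 0}" and ?U = "{u \<in> S. g u \<noteq> 0}"
  have pts: "points (affine_sub I S) = S"
    by (rule points_affine_subspace[OF SI])
  have "S - ?C = ?U"
    by auto
  then have C: "closedin (zar (affine_sub I S)) ?C"
    using openin_affine_subspace_basic[OF SI g] pts by (auto simp: closedin_def)
  have iso: "subspace_of (affine_sub I S) T \<cong>\<^sub>v affine_sub I T" if "T \<subseteq> S" for T
    using subspace_of_subspace_of[OF is_sheaf_affine_space, of I S T] that by (simp add: Int_absorb1)
  have isoC: "subspace_of (affine_sub I S) ?C \<cong>\<^sub>v affine_sub I ?C"
    and isoU: "subspace_of (affine_sub I S) ?U \<cong>\<^sub>v affine_sub I ?U"
    by (rule iso; auto)+
  have "K0_class (affine_sub I S) = K0_class (subspace_of (affine_sub I S) ?C)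
      + K0_class (subspace_of (affine_sub I S) (points (affine_sub I S) - ?C))"
  proof (rule K0_class_scissor[OF has_class_quasi_affine[OF I S] C])
    show "has_class (subspace_of (affine_sub I S) ?C)"
      by (rule has_class_isomorphic[OF has_class_quasi_affine isomorphic_sym[OF isoC]])
        (intro I quasi_affine_zero S g)+
    show "has_class (subspace_of (affine_sub I S) (points (affine_sub I S) - ?C))"
      unfolding pts \<open>S - ?C = ?U\<close>
      by (rule has_class_isomorphic[OF has_class_quasi_affine isomorphic_sym[OF isoU]])
        (intro I quasi_affine_nonzero S g)+
  qed
  then show ?thesis
    unfolding pts \<open>S - ?C = ?U\<close> K0_class_isomorphic[OF isoC] K0_class_isomorphic[OF isoU] .
qed

lemma affine_sub_vectors: "affine_sub I (vectors I) \<cong>\<^sub>v affine_space I"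
  by (rule isomorphic_whole_subspace[OF is_sheaf_affine_space]) simp

lemma has_class_affine_space: "finite I \<Longrightarrow> has_class (affine_space I)"
  by (intro has_class_isomorphic[OF has_class_quasi_affine affine_sub_vectors] quasi_affine_vectors)

section \<open>Products and classes of affine spaces\<close>

text \<open>A map to affine space is a family of regular coordinates, so a pair of maps merges into
  one over the disjoint index set I \<union> J. The isomorphisms to the abstract representatives P,
  X and Y are composed around this.\<close>

lemma is_product_affine_space:
  assumes P: "Rep_variety P \<cong>\<^sub>v affine_space (I \<union> J)" and X: "Rep_variety X \<cong>\<^sub>v affine_space I"
    and Y: "Rep_variety Y \<cong>\<^sub>v affine_space J" and disj: "I \<inter> J = {}"
  shows "is_product P X Y"
proof -
  obtain \<pi> \<pi>' where \<pi>: "morphism (Rep_variety P) (affine_space (I \<union> J)) \<pi>"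
    "morphism (affine_space (I \<union> J)) (Rep_variety P) \<pi>'"
    "\<forall>x\<in>points (Rep_variety P). \<pi>' (\<pi> x) = x" "\<forall>y\<in>vectors (I \<union> J). \<pi> (\<pi>' y) = y"
    using P unfolding isomorphic_def points_affine_space by blast
  obtain \<xi> \<xi>' where \<xi>: "morphism (Rep_variety X) (affine_space I) \<xi>"
    "morphism (affine_space I) (Rep_variety X) \<xi>'"
    "\<forall>x\<in>points (Rep_variety X). \<xi>' (\<xi> x) = x" "\<forall>y\<in>vectors I. \<xi> (\<xi>' y) = y"
    using X unfolding isomorphic_def points_affine_space by blast
  obtain \<eta> \<eta>' where \<eta>: "morphism (Rep_variety Y) (affine_space J) \<eta>"
    "morphism (affine_space J) (Rep_variety Y) \<eta>'"
    "\<forall>x\<in>points (Rep_variety Y). \<eta>' (\<eta> x) = x" "\<forall>y\<in>vectors J. \<eta> (\<eta>' y) = y"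
    using Y unfolding isomorphic_def points_affine_space by blast
  have proj: "morphism (affine_space (I \<union> J)) (affine_space K) (\<lambda>u. restrict u K)"
    if K: "K \<subseteq> I \<union> J" for K
  proof (rule morphism_into_affine_space)
    show "ringed (affine_space (I \<union> J))"
      by (rule ringed_isomorphic[OF ringed_affine_subspace[OF order_refl] is_sheaf_affine_space
            isomorphic_sym[OF affine_sub_vectors]])
    fix i assume "i \<in> K"
    then show "(\<lambda>x\<in>points (affine_space (I \<union> J)). restrict x K i)
        \<in> sections (affine_space (I \<union> J)) (points (affine_space (I \<union> J)))"
      using K by (auto simp: sections_affine_space intro!: regular_on_poly[of "\<lambda>u. u i"] poly_fun.coord)
  qed simp
  let ?p = "\<xi>' \<circ> ((\<lambda>u. restrict u I) \<circ> \<pi>)" and ?q = "\<eta>' \<circ> ((\<lambda>u. restrict u J) \<circ> \<pi>)"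
  have p: "morphism (Rep_variety P) (Rep_variety X) ?p"
    by (intro morphism_comp[OF morphism_comp[OF \<pi>(1) proj] \<xi>(2)]) simp
  have q: "morphism (Rep_variety P) (Rep_variety Y) ?q"
    by (intro morphism_comp[OF morphism_comp[OF \<pi>(1) proj] \<eta>(2)]) simp
  show ?thesis
    unfolding is_product_def
  proof (rule exI[of _ ?p], rule exI[of _ ?q], intro conjI p q allI impI)
    fix Z f g
    assume f: "morphism (Rep_variety Z) (Rep_variety X) f"
      and g: "morphism (Rep_variety Z) (Rep_variety Y) g"
    have Z: "ringed (Rep_variety Z)"
      using ringed_variety Rep_variety by blast
    define m where "m z = (\<lambda>i\<in>I \<union> J. if i \<in> I then \<xi> (f z) i else \<eta> (g z) i)" for z
    have m: "morphism (Rep_variety Z) (affine_space (I \<union> J)) m"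
    proof (rule morphism_into_affine_space[OF Z])
      fix i assume i: "i \<in> I \<union> J"
      show "(\<lambda>x\<in>points (Rep_variety Z). m x i) \<in> sections (Rep_variety Z) (points (Rep_variety Z))"
      proof (cases "i \<in> I")
        case True
        then show ?thesis
          using coordinate_section[OF morphism_comp[OF f \<xi>(1)]] by (simp add: m_def)
      next
        case False
        then show ?thesis
          using i coordinate_section[OF morphism_comp[OF g \<eta>(1)]] by (simp add: m_def)
      qed
    qed (simp add: m_def)
    have vec: "\<xi> (f z) \<in> vectors I" "\<eta> (g z) \<in> vectors J" if "z \<in> points (Rep_variety Z)" for z
      using morphism_point[OF morphism_comp[OF f \<xi>(1)] that]
        morphism_point[OF morphism_comp[OF g \<eta>(1)] that] by simp_all
    have res: "restrict (m z) I = \<xi> (f z)" "restrict (m z) J = \<eta> (g z)"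
      if "z \<in> points (Rep_variety Z)" for z
      using vec[OF that] disj by (auto simp: m_def fun_eq_iff PiE_def extensional_def)
    have mv: "m z \<in> vectors (I \<union> J)" for z
      by (simp add: m_def)
    have ok: "\<xi>' (\<xi> (f z)) = f z" "\<eta>' (\<eta> (g z)) = g z" if "z \<in> points (Rep_variety Z)" for z
      using morphism_point[OF f that] morphism_point[OF g that] \<xi>(3) \<eta>(3) by auto
    show "\<exists>h. morphism (Rep_variety Z) (Rep_variety P) h \<and>
        (\<forall>z\<in>points (Rep_variety Z). ?p (h z) = f z \<and> ?q (h z) = g z) \<and>
        (\<forall>h'. morphism (Rep_variety Z) (Rep_variety P) h' \<longrightarrow>
          (\<forall>z\<in>points (Rep_variety Z). ?p (h' z) = f z \<and> ?q (h' z) = g z) \<longrightarrow>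
          (\<forall>z\<in>points (Rep_variety Z). h' z = h z))"
    proof (intro exI[of _ "\<pi>' \<circ> m"] conjI ballI allI impI)
      show "morphism (Rep_variety Z) (Rep_variety P) (\<pi>' \<circ> m)"
        by (rule morphism_comp[OF m \<pi>(2)])
      fix z assume z: "z \<in> points (Rep_variety Z)"
      show "?p ((\<pi>' \<circ> m) z) = f z" "?q ((\<pi>' \<circ> m) z) = g z"
        using \<pi>(4) mv res[OF z] ok[OF z] by simp_all
    next
      fix h' z
      assume h': "morphism (Rep_variety Z) (Rep_variety P) h'"
        and eq: "\<forall>z\<in>points (Rep_variety Z). ?p (h' z) = f z \<and> ?q (h' z) = g z"
        and z: "z \<in> points (Rep_variety Z)"
      note hz = morphism_point[OF h' z]
      have v: "\<pi> (h' z) \<in> vectors (I \<union> J)"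
        using morphism_point[OF \<pi>(1) hz] by simp
      have "\<xi>' (restrict (\<pi> (h' z)) I) = f z" "\<eta>' (restrict (\<pi> (h' z)) J) = g z"
        using eq z by auto
      then have "\<xi> (\<xi>' (restrict (\<pi> (h' z)) I)) = \<xi> (f z)"
        "\<eta> (\<eta>' (restrict (\<pi> (h' z)) J)) = \<eta> (g z)"
        by simp_all
      then have r: "restrict (\<pi> (h' z)) I = \<xi> (f z)" "restrict (\<pi> (h' z)) J = \<eta> (g z)"
        using \<xi>(4) \<eta>(4) by simp_all
      have "\<pi> (h' z) = m z"
      proof
        fix i
        show "\<pi> (h' z) i = m z i"
          using fun_cong[OF r(1), of i] fun_cong[OF r(2), of i] v
          by (auto simp: m_def PiE_def extensional_def)
      qed
      then show "h' z = (\<pi>' \<circ> m) z"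
        using bspec[OF \<pi>(3) hz] by simp
    qed
  qed
qed

lemma K0_class_affine_space:
  assumes "finite I"
  shows "K0_class (affine_space I) = \<bbbL> ^ card I"
  using assms
proof induction
  case empty
  obtain V where V: "Rep_variety V \<cong>\<^sub>v affine_space {}"
    using has_class_affine_space[of "{}"] unfolding has_class_def by auto
  then have "gen V - 1 \<in> unit_relations"
    unfolding unit_relations_def by blast
  then have "K0_rel (gen V) 1"
    unfolding K0_rel_def by (intro K0_relations) simp
  then have "K0_gen V = 1"
    by transfer
  then show ?case
    using K0_class_eq_gen[OF V] by simp
next
  case (insert i I)
  obtain P where P: "Rep_variety P \<cong>\<^sub>v affine_space (I \<union> {i})"
    using has_class_affine_space[of "I \<union> {i}"] insert unfolding has_class_def by auto
  obtain X where X: "Rep_variety X \<cong>\<^sub>v affine_space I"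
    using has_class_affine_space[of I] insert unfolding has_class_def by auto
  obtain Y where Y: "Rep_variety Y \<cong>\<^sub>v affine_space {i}"
    using has_class_affine_space[of "{i}"] unfolding has_class_def by auto
  have "is_product P X Y"
    using is_product_affine_space[OF P X Y] insert by simp
  then have "gen X * gen Y - gen P \<in> product_relations"
    unfolding product_relations_def by blast
  then have "K0_rel (gen X * gen Y) (gen P)"
    unfolding K0_rel_def by (intro K0_relations) simp
  then have "K0_gen X * K0_gen Y = K0_gen P"
    by transfer
  \<comment> \<open>\<open>lefschetz\<close> is the line with index 0; renaming the coordinate
    identifies it with the line indexed by i.\<close>
  moreover have "affine_sub {i} (vectors {i}) \<cong>\<^sub>v affine_sub {0} (vectors {0})"
  proof (rule isomorphic_affine_subspaces[of _ _ _ _ "\<lambda>u. \<lambda>j\<in>{0}. u i" "\<lambda>u. \<lambda>j\<in>{i}. u 0"])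
    show "regular_on {i} (vectors {i}) (\<lambda>u. (\<lambda>j\<in>{0}. u i) j)" if "j \<in> {0}" for j
      using that by (intro regular_on_poly[of "\<lambda>u. u i"]) (auto intro: poly_fun.coord)
    show "regular_on {0} (vectors {0}) (\<lambda>u. (\<lambda>j\<in>{i}. u 0) j)" if "j \<in> {i}" for j
      using that by (intro regular_on_poly[of "\<lambda>u. u 0"]) (auto intro: poly_fun.coord)
  qed (auto simp: fun_eq_iff PiE_def extensional_def)
  then have "affine_space {i} \<cong>\<^sub>v affine_space {0}"
    using isomorphic_trans[OF isomorphic_sym[OF affine_sub_vectors]
        isomorphic_trans[OF _ affine_sub_vectors]] by simp
  then have "K0_class (affine_space {i}) = \<bbbL>"
    unfolding lefschetz_def by (rule K0_class_isomorphic)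
  ultimately show ?case
    using insert K0_class_eq_gen[OF P] K0_class_eq_gen[OF X] K0_class_eq_gen[OF Y]
    by (simp add: mult.commute)
qed

section \<open>The class of the complement of a split quadratic form\<close>

lemma K0_class_vectors: "finite I \<Longrightarrow> K0_class (affine_sub I (vectors I)) = \<bbbL> ^ card I"
  using K0_class_isomorphic[OF affine_sub_vectors] K0_class_affine_space by simp

text \<open>Cutting the empty set leaves two empty pieces, so its class x satisfies x = x +
  x.\<close>

lemma K0_class_empty:
  assumes "finite I"
  shows "K0_class (affine_sub I {}) = 0"
proof -
  have "quasi_affine I {}"
    by (rule quasi_affineI[of "{}" I "\<lambda>_. 0"]) (auto intro: poly_fun.const)
  from K0_class_split[OF assms this poly_fun.const[of 0]] show ?thesis
    by simp
qed

text \<open>Fixing a coordinate at a constant of the ground field removes it. R is an arbitrary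
  predicate on the other coordinates, so the same isomorphism serves slices that carry further
  inequations.\<close>

lemma affine_sub_fixed_coordinate:
  assumes "b \<in> J" "c \<in> gauss_rat"
  shows "affine_sub J {u \<in> vectors J. u b = c \<and> R (restrict u (J - {b}))}
    \<cong>\<^sub>v affine_sub (J - {b}) {v \<in> vectors (J - {b}). R v}"
proof (rule isomorphic_affine_subspaces[of _ _ _ _ "\<lambda>u. restrict u (J - {b})" "\<lambda>v. v(b := c)"])
  show "regular_on J {u \<in> vectors J. u b = c \<and> R (restrict u (J - {b}))}
      (\<lambda>u. restrict u (J - {b}) j)" if "j \<in> J - {b}" for j
    using that by (intro regular_on_poly[of "\<lambda>u. u j"]) (auto intro: poly_fun.coord)
  show "regular_on (J - {b}) {v \<in> vectors (J - {b}). R v} (\<lambda>v. (v(b := c)) j)" if "j \<in> J" for j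
    using that assms
    by (intro regular_on_poly[of "if j = b then (\<lambda>_. c) else (\<lambda>v. v j)"]) (auto intro: poly_fun.intros)
  have eq: "restrict (v(b := c)) (J - {b}) = v" if "v \<in> vectors (J - {b})" for v
    using that by (auto simp: fun_eq_iff PiE_def extensional_def)
  show "v(b := c) \<in> {u \<in> vectors J. u b = c \<and> R (restrict u (J - {b}))}"
    if "v \<in> {v \<in> vectors (J - {b}). R v}" for v
    using that assms eq by (auto simp: PiE_def extensional_def)
  show "restrict (v(b := c)) (J - {b}) = v" if "v \<in> {v \<in> vectors (J - {b}). R v}" for v
    by (rule eq) (use that in simp)
  show "(restrict u (J - {b}))(b := c) = u"
    if "u \<in> {u \<in> vectors J. u b = c \<and> R (restrict u (J - {b}))}" for u
    using that by (auto simp: fun_eq_iff PiE_def extensional_def)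
qed auto

lemma K0_class_coordinate_nonzero:
  assumes J: "finite J" and b: "b \<in> J"
  shows "K0_class (affine_sub J {u \<in> vectors J. u b \<noteq> 0}) = \<bbbL> ^ card J - \<bbbL> ^ (card J - 1)"
proof -
  have "K0_class (affine_sub J {u \<in> vectors J. u b = 0}) = \<bbbL> ^ (card J - 1)"
    using K0_class_isomorphic[OF affine_sub_fixed_coordinate[OF b gauss_rat_numeral(1), of "\<lambda>_. True"]]
      K0_class_vectors[of "J - {b}"] J b by simp
  then show ?thesis
    using K0_class_split[OF J quasi_affine_vectors poly_fun.coord[OF b]] K0_class_vectors[OF J]
    by (simp add: algebra_simps)
qed

text \<open>With D(k) = L^k - L^(k-1), the class of affine k-space minus one coordinate hyperplane,
  this is D(N) - D(N-1) for N = \<open>card J\<close>. It is left in that form because such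
  differences telescope over the strata.\<close>

lemma K0_class_two_coordinates_nonzero:
  assumes J: "finite J" and a: "a \<in> J" and b: "b \<in> J" and "a \<noteq> b"
  shows "K0_class (affine_sub J {u \<in> vectors J. u a \<noteq> 0 \<and> u b \<noteq> 0})
    = \<bbbL> ^ card J - \<bbbL> ^ (card J - 1) - (\<bbbL> ^ (card J - 1) - \<bbbL> ^ (card J - 2))"
proof -
  let ?S = "{u \<in> vectors J. u a \<noteq> 0}"
  have "{u \<in> ?S. u b = 0} = {u \<in> vectors J. u b = 0 \<and> restrict u (J - {b}) a \<noteq> 0}"
    using a \<open>a \<noteq> b\<close> by auto
  then have "K0_class (affine_sub J {u \<in> ?S. u b = 0})
      = K0_class (affine_sub (J - {b}) {v \<in> vectors (J - {b}). v a \<noteq> 0})"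
    using K0_class_isomorphic[OF affine_sub_fixed_coordinate[OF b gauss_rat_numeral(1), of "\<lambda>v. v a \<noteq> 0"]]
    by simp
  also have "\<dots> = \<bbbL> ^ (card J - 1) - \<bbbL> ^ (card J - 2)"
    using K0_class_coordinate_nonzero[of "J - {b}" a] assms by (simp add: numeral_2_eq_2)
  finally have "K0_class (affine_sub J {u \<in> ?S. u b = 0}) = \<bbbL> ^ (card J - 1) - \<bbbL> ^ (card J - 2)" .
  moreover have "quasi_affine J ?S"
    by (intro quasi_affine_nonzero quasi_affine_vectors poly_fun.coord a)
  note K0_class_split[OF J this poly_fun.coord[OF b]]
  moreover have "{u \<in> ?S. u b \<noteq> 0} = {u \<in> vectors J. u a \<noteq> 0 \<and> u b \<noteq> 0}"
    by auto
  ultimately show ?thesis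
    using K0_class_coordinate_nonzero[OF J a] by (simp add: algebra_simps)
qed

section \<open>Stratification by the first nonvanishing odd coordinate\<close>

definition split_form :: "nat \<Rightarrow> (nat \<Rightarrow> complex) \<Rightarrow> complex" where
  "split_form m w = (\<Sum>l<m. w (2 * l + 1) * w (2 * l + 2))"

text \<open>The pairs strictly after pair j: the terms that must be subtracted when solving for the
  partner of the first nonvanishing odd coordinate.\<close>

definition tail_form :: "nat \<Rightarrow> nat \<Rightarrow> (nat \<Rightarrow> complex) \<Rightarrow> complex" where
  "tail_form j m w = (\<Sum>l\<in>{j<..<m}. w (2 * l + 1) * w (2 * l + 2))"

lemma split_form_eq_tail_form:
  assumes "j < m" "\<And>l. l < j \<Longrightarrow> w (2 * l + 1) = 0"
  shows "split_form m w = w (2 * j + 1) * w (2 * j + 2) + tail_form j m w"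
proof -
  have "{..<m} = {..<j} \<union> insert j {j<..<m}"
    using assms(1) by auto
  then have "split_form m w = (\<Sum>l\<in>{..<j} \<union> insert j {j<..<m}. w (2 * l + 1) * w (2 * l + 2))"
    unfolding split_form_def by (rule arg_cong)
  also have "\<dots> = (\<Sum>l<j. w (2 * l + 1) * w (2 * l + 2))
      + (\<Sum>l\<in>insert j {j<..<m}. w (2 * l + 1) * w (2 * l + 2))"
    by (rule sum.union_disjoint) auto
  also have "(\<Sum>l<j. w (2 * l + 1) * w (2 * l + 2)) = 0"
    using assms(2) by (intro sum.neutral) auto
  finally show ?thesis
    by (simp add: tail_form_def)
qed

text \<open>For c = 1 this says that the tail ignores all coordinates up to 2 * j + 2; general c
  serves the normalisation of a matrix row.\<close>

lemma tail_form_cong: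
  assumes "\<And>i. 2 * j + 2 < i \<Longrightarrow> i \<le> 2 * m \<Longrightarrow> v i = c * w i"
  shows "tail_form j m v = c\<^sup>2 * tail_form j m w"
  unfolding tail_form_def sum_distrib_left
  by (rule sum.cong) (use assms in \<open>auto simp: power2_eq_square\<close>)

lemma poly_fun_split_form: "{1..2 * m} \<subseteq> I \<Longrightarrow> split_form m \<in> poly_fun I"
  unfolding split_form_def[abs_def] by (intro poly_fun_sum poly_fun.mult poly_fun.coord) auto

lemma poly_fun_tail_form: "{2 * j + 2<..2 * m} \<subseteq> I \<Longrightarrow> tail_form j m \<in> poly_fun I"
  unfolding tail_form_def[abs_def] by (intro poly_fun_sum poly_fun.mult poly_fun.coord) auto

lemma card_minus_odd:
  assumes "finite I" "{1..2 * m} \<subseteq> I" "j \<le> m"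
  shows "card (I - (\<lambda>l. 2 * l + 1) ` {..<j}) = card I - j"
proof -
  have "(\<lambda>l. 2 * l + 1) ` {..<j} \<subseteq> I"
    using assms(2,3) by (auto simp: subset_iff)
  moreover have "card ((\<lambda>l. 2 * l + 1 :: nat) ` {..<j}) = j"
    by (subst card_image) (auto simp: inj_on_def)
  ultimately show ?thesis
    using assms(1) by (simp add: card_Diff_subset)
qed

text \<open>Pairs are counted from l = 0, so exactly j odd coordinates vanish here, and J is what
  remains of I without them.\<close>

lemma affine_stratum:
  assumes I: "{1..2 * m} \<subseteq> I" and j: "j < m"
  defines "J \<equiv> I - (\<lambda>l. 2 * l + 1) ` {..<j}"
  shows "affine_sub I {u \<in> vectors I. split_form m u \<noteq> 0 \<and> (\<forall>l<j. u (2 * l + 1) = 0) \<and> u (2 * j + 1) \<noteq> 0}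
    \<cong>\<^sub>v affine_sub J {w \<in> vectors J. w (2 * j + 1) \<noteq> 0 \<and> w (2 * j + 2) \<noteq> 0}"
    (is "affine_sub I ?S \<cong>\<^sub>v affine_sub J ?T")
proof -
  let ?\<phi> = "\<lambda>u. (restrict u J)(2 * j + 2 := split_form m u)"
  let ?y = "\<lambda>w. (w (2 * j + 2) - tail_form j m w) / w (2 * j + 1)"
  let ?\<psi> = "\<lambda>w. \<lambda>i\<in>I. if i = 2 * j + 2 then ?y w else if i \<in> J then w i else 0"
  have J: "2 * j + 2 \<in> J" "2 * j + 1 \<in> J" "{2 * j + 2<..2 * m} \<subseteq> J" "J \<subseteq> I"
    using I j by (auto simp: J_def subset_iff image_iff; presburger)+
  have tail: "split_form m u = u (2 * j + 1) * u (2 * j + 2) + tail_form j m u" if "u \<in> ?S" for u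
    using that by (intro split_form_eq_tail_form j) auto
  \<comment> \<open>The tail sees neither the overwritten coordinate 2 * j + 2 nor the removed ones.
    Hence it has the same value before and after the change of coordinates, and solving for
    \<open>?y\<close> is not circular.\<close>
  have tail\<phi>: "tail_form j m (?\<phi> u) = tail_form j m u" for u
    using tail_form_cong[of j m "?\<phi> u" 1 u] J(3) by (auto simp: subset_iff)
  have tail\<psi>: "tail_form j m (?\<psi> w) = tail_form j m w" for w
    using tail_form_cong[of j m "?\<psi> w" 1 w] J(3,4) by (auto simp: subset_iff)
  \<comment> \<open>The default value 0 in \<open>?\<psi>\<close> restores the equations of the
    stratum.\<close>
  have odd0: "?\<psi> w (2 * l + 1) = 0" if "l < j" for w l
  proof -
    have "2 * l + 1 \<in> I" "2 * l + 1 \<notin> J" "2 * l + 1 \<noteq> 2 * j + 2"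
      using I j that by (auto simp: J_def subset_iff; presburger)+
    then show ?thesis
      by simp
  qed
  have \<psi>: "split_form m (?\<psi> w) = w (2 * j + 2)" if "w \<in> ?T" for w
  proof -
    have "split_form m (?\<psi> w) = ?\<psi> w (2 * j + 1) * ?\<psi> w (2 * j + 2) + tail_form j m (?\<psi> w)"
      using odd0 by (intro split_form_eq_tail_form j)
    moreover have "?\<psi> w (2 * j + 1) = w (2 * j + 1)" "?\<psi> w (2 * j + 2) = ?y w"
      using J by auto
    ultimately have "split_form m (?\<psi> w) = w (2 * j + 1) * ?y w + tail_form j m w"
      by (simp only: tail\<psi>)
    then show ?thesis
      using that by simp
  qed
  show ?thesis
  proof (rule isomorphic_affine_subspaces[of ?S I ?T J ?\<phi> ?\<psi>])
    show "?\<phi> u \<in> ?T" if "u \<in> ?S" for u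
      using that J by (auto simp: PiE_def extensional_def)
    show "regular_on I ?S (\<lambda>u. ?\<phi> u i)" if "i \<in> J" for i
      using that J(4) I
      by (intro regular_on_poly[of "if i = 2 * j + 2 then split_form m else (\<lambda>u. u i)"])
        (auto intro: poly_fun.coord poly_fun_split_form[OF I])
    show "?\<psi> w \<in> ?S" if "w \<in> ?T" for w
      using that \<psi>[OF that] J odd0 by auto
    show "regular_on J ?T (\<lambda>w. ?\<psi> w i)" if "i \<in> I" for i
    proof (cases "i = 2 * j + 2")
      case True
      then show ?thesis
        using that J
        by (intro regular_on_quotient[of "\<lambda>w. w (2 * j + 2) - tail_form j m w" J "\<lambda>w. w (2 * j + 1)"])
          (auto intro!: poly_fun_diff poly_fun.coord poly_fun_tail_form[OF J(3)])
    next
      case False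
      then show ?thesis
        using that
        by (intro regular_on_poly[of "if i \<in> J then (\<lambda>w. w i) else (\<lambda>_. 0)"]) (auto intro: poly_fun.intros)
    qed
    show "?\<psi> (?\<phi> u) = u" if u: "u \<in> ?S" for u
    proof
      fix i
      have a: "?\<phi> u (2 * j + 2) = split_form m u" "?\<phi> u (2 * j + 1) = u (2 * j + 1)"
        using J by auto
      consider "i \<notin> I" | "i = 2 * j + 2" | "i \<in> J" "i \<noteq> 2 * j + 2" | "i \<in> I" "i \<notin> J" "i \<noteq> 2 * j + 2"
        by blast
      then show "?\<psi> (?\<phi> u) i = u i"
      proof cases
        case 2
        then have "?\<psi> (?\<phi> u) i = (?\<phi> u (2 * j + 2) - tail_form j m (?\<phi> u)) / ?\<phi> u (2 * j + 1)"
          using subsetD[OF J(4) J(1)] by (simp only: restrict_apply simp_thms if_True)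
        then show ?thesis
          using 2 u tail[OF u] unfolding a tail\<phi> by simp
      qed (use u J(4) in \<open>auto simp: PiE_def extensional_def J_def\<close>)
    qed
    show "?\<phi> (?\<psi> w) = w" if w: "w \<in> ?T" for w
      using w J \<psi>[OF w] by (auto simp: fun_eq_iff PiE_def extensional_def)
  qed auto
qed

text \<open>Downward induction on j. If all odd coordinates vanish, so does the form, and the locus
  for j = m is empty. With D(k) = L^k - L^(k-1) and N = \<open>card I\<close>, each step adds D(N-j)
  - D(N-j-1), giving D(N-j) - D(N-m).\<close>

lemma K0_class_split_form_strata:
  assumes I: "finite I" "{1..2 * m} \<subseteq> I" and "j \<le> m"
  shows "K0_class (affine_sub I {u \<in> vectors I. split_form m u \<noteq> 0 \<and> (\<forall>l<j. u (2 * l + 1) = 0)})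
    = \<bbbL> ^ (card I - j) - \<bbbL> ^ (card I - j - 1) - (\<bbbL> ^ (card I - m) - \<bbbL> ^ (card I - m - 1))"
  using \<open>j \<le> m\<close>
proof (induction j rule: inc_induct)
  case base
  have empty: "{u \<in> vectors I. split_form m u \<noteq> 0 \<and> (\<forall>l<m. u (2 * l + 1) = 0)} = {}"
    by (auto simp: split_form_def)
  show ?case
    unfolding empty using K0_class_empty[OF I(1)] by simp
next
  case (step j)
  let ?F = "\<lambda>j. {u \<in> vectors I. split_form m u \<noteq> 0 \<and> (\<forall>l<j. u (2 * l + 1) = 0)}"
  let ?J = "I - (\<lambda>l. 2 * l + 1) ` {..<j}"
  have i: "2 * l + 1 \<in> I" if "l < m" for l
    using I(2) that by (auto simp: subset_iff)
  have "quasi_affine I {u \<in> {u \<in> vectors I. split_form m u \<noteq> 0}. \<forall>g\<in>(\<lambda>l u. u (2 * l + 1)) ` {..<j}. g u = 0}"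
    by (intro quasi_affine_zeros quasi_affine_nonzero quasi_affine_vectors poly_fun_split_form I)
      (use i step.hyps in \<open>auto intro: poly_fun.coord\<close>)
  then have qa: "quasi_affine I (?F j)"
    by (rule back_subst) auto
  have zero: "{u \<in> ?F j. u (2 * j + 1) = 0} = ?F (Suc j)"
    by (auto simp: less_Suc_eq)
  have nonzero: "{u \<in> ?F j. u (2 * j + 1) \<noteq> 0} =
      {u \<in> vectors I. split_form m u \<noteq> 0 \<and> (\<forall>l<j. u (2 * l + 1) = 0) \<and> u (2 * j + 1) \<noteq> 0}"
    by auto
  have "2 * j + 1 \<in> ?J" "2 * j + 2 \<in> ?J"
    using I step.hyps by (auto simp: subset_iff image_iff; presburger)+
  then have stratum: "K0_class (affine_sub ?J {w \<in> vectors ?J. w (2 * j + 1) \<noteq> 0 \<and> w (2 * j + 2) \<noteq> 0})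
      = \<bbbL> ^ (card I - j) - \<bbbL> ^ (card I - j - 1) - (\<bbbL> ^ (card I - j - 1) - \<bbbL> ^ (card I - j - 2))"
    using K0_class_two_coordinates_nonzero[of ?J "2 * j + 1" "2 * j + 2"] I step.hyps
      card_minus_odd[OF I, of j] by simp
  show ?case
    unfolding K0_class_split[OF I(1) qa poly_fun.coord[OF i[OF step.hyps(2)]]] zero nonzero
      K0_class_isomorphic[OF affine_stratum[OF I(2) step.hyps(2)]] stratum step.IH
    by simp
qed

lemma K0_class_split_form_nonzero:
  assumes "finite I" "{1..2 * m} \<subseteq> I"
  shows "K0_class (affine_sub I {u \<in> vectors I. split_form m u \<noteq> 0})
    = \<bbbL> ^ card I - \<bbbL> ^ (card I - 1) - \<bbbL> ^ (card I - m) + \<bbbL> ^ (card I - m - 1)"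
  using K0_class_split_form_strata[OF assms, of 0] by (simp add: algebra_simps)

text \<open>The form does not involve coordinate 0, so the slices at 0 and at 1 are both isomorphic
  to the complement in dimension 2 * n + 2. Being disjoint, they subtract twice the class of that
  complement from the total.\<close>

lemma K0_class_split_form_nonzero_minus_hyperplanes:
  defines "I \<equiv> \<lambda>n. {0..2 * n + 2 :: nat}"
  shows "K0_class (affine_sub (I n) {u \<in> vectors (I n). split_form (n + 1) u \<noteq> 0 \<and> u 0 \<noteq> 0 \<and> u 0 \<noteq> 1})
    = \<bbbL> ^ (2 * n + 3) - 3 * \<bbbL> ^ (2 * n + 2) + 2 * \<bbbL> ^ (2 * n + 1)
      - \<bbbL> ^ (n + 2) + 3 * \<bbbL> ^ (n + 1) - 2 * \<bbbL> ^ n"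
proof -
  let ?I = "I n" and ?I' = "{1..2 * n + 2}"
  let ?S = "{u \<in> vectors ?I. split_form (n + 1) u \<noteq> 0}"
  have I: "finite ?I" "{1..2 * (n + 1)} \<subseteq> ?I" "0 \<in> ?I" "card ?I = 2 * n + 3" "?I - {0} = ?I'"
    by (auto simp: I_def)
  have X: "K0_class (affine_sub ?I' {u \<in> vectors ?I'. split_form (n + 1) u \<noteq> 0})
      = \<bbbL> ^ (2 * n + 2) - \<bbbL> ^ (2 * n + 1) - \<bbbL> ^ (n + 1) + \<bbbL> ^ n"
    using K0_class_split_form_nonzero[of ?I' "n + 1"] by (simp add: numeral_2_eq_2)
  have slice: "K0_class (affine_sub ?I {u \<in> ?S. u 0 = c})
      = \<bbbL> ^ (2 * n + 2) - \<bbbL> ^ (2 * n + 1) - \<bbbL> ^ (n + 1) + \<bbbL> ^ n" if "c \<in> gauss_rat" for c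
  proof -
    have "split_form (n + 1) (restrict u ?I') = split_form (n + 1) u" for u
      by (rule poly_fun_restrict[OF poly_fun_split_form]) simp
    then have "{u \<in> ?S. u 0 = c} = {u \<in> vectors ?I. u 0 = c \<and> split_form (n + 1) (restrict u (?I - {0})) \<noteq> 0}"
      unfolding I(5) by auto
    then show ?thesis
      using K0_class_isomorphic[OF affine_sub_fixed_coordinate[OF I(3) that, of "\<lambda>v. split_form (n + 1) v \<noteq> 0"]] X
      unfolding I(5) by simp
  qed
  have S: "quasi_affine ?I ?S"
    by (intro quasi_affine_nonzero quasi_affine_vectors poly_fun_split_form I)
  have S0: "quasi_affine ?I {u \<in> ?S. u 0 \<noteq> 0}"
    by (intro quasi_affine_nonzero[OF S] poly_fun.coord I)
  have p1: "(\<lambda>u. u 0 - 1) \<in> poly_fun ?I"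
    by (intro poly_fun_diff poly_fun.coord poly_fun.const I) simp
  have e: "{u \<in> {u \<in> ?S. u 0 \<noteq> 0}. u 0 - 1 = 0} = {u \<in> ?S. u 0 = 1}"
    "{u \<in> {u \<in> ?S. u 0 \<noteq> 0}. u 0 - 1 \<noteq> 0} = {u \<in> vectors ?I. split_form (n + 1) u \<noteq> 0 \<and> u 0 \<noteq> 0 \<and> u 0 \<noteq> 1}"
    by auto
  \<comment> \<open>The ring is not known to satisfy 0 \<noteq> 1, so the numerals are expanded into
    sums before both sides are compared as elements of a commutative ring.\<close>
  have numeral: "2 * x = x + x" "3 * x = x + x + x" for x :: K0
    using distrib_right[of 1 1 x] distrib_right[of "1 + 1" 1 x]
    by (simp_all only: numeral_Bit1 numeral_Bit0 numeral_One mult_1_left)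
  have "K0_class (affine_sub ?I {u \<in> vectors ?I. split_form (n + 1) u \<noteq> 0 \<and> u 0 \<noteq> 0 \<and> u 0 \<noteq> 1})
      = K0_class (affine_sub ?I ?S) - K0_class (affine_sub ?I {u \<in> ?S. u 0 = 0})
        - K0_class (affine_sub ?I {u \<in> ?S. u 0 = 1})"
    unfolding K0_class_split[OF I(1) S poly_fun.coord[OF I(3)]] K0_class_split[OF I(1) S0 p1] e
    by simp
  also have "K0_class (affine_sub ?I ?S) = \<bbbL> ^ (2 * n + 3) - \<bbbL> ^ (2 * n + 2) - \<bbbL> ^ (n + 2) + \<bbbL> ^ (n + 1)"
    using K0_class_split_form_nonzero[OF I(1,2)] I(4) by (simp add: numeral_3_eq_3 numeral_2_eq_2)
  finally show ?thesis
    unfolding slice[OF gauss_rat_numeral(1)] slice[OF gauss_rat_numeral(2)]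
    by (simp only: numeral) (simp only: algebra_simps)
qed

section \<open>Splitting the quadric over the Gaussian rationals\<close>

text \<open>Square roots of the coefficients of \<open>Q\<close>. These coefficients are squares of
  rationals, so \<i> is the only irrationality needed to split the form.\<close>

definition coord_scale :: "rat \<Rightarrow> nat \<Rightarrow> complex" where
  "coord_scale \<alpha> i = (if i \<in> {2, 3, 4} then 1 / of_rat \<alpha> else 1)"

text \<open>The factorisation a^2 + b^2 = (a + \<i> b) (a - \<i> b), applied to the scaled
  coordinates a, b at the indices 2 l + 1, 2 l + 2. Index 0 is the additional coordinate of the
  cone.\<close>

definition split_coords :: "rat \<Rightarrow> (nat \<Rightarrow> complex) \<Rightarrow> nat \<Rightarrow> complex" where
  "split_coords \<alpha> u i =
     (if i = 0 then u 0
      else if odd i then coord_scale \<alpha> i * u i + \<i> * (coord_scale \<alpha> (i + 1) * u (i + 1))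
      else coord_scale \<alpha> (i - 1) * u (i - 1) - \<i> * (coord_scale \<alpha> i * u i))"

text \<open>From x = a + \<i> b and y = a - \<i> b one recovers a = (x + y) / 2 and b = - \<i> (x -
  y) / 2; then the scaling is undone.\<close>

definition unsplit_coords :: "rat \<Rightarrow> (nat \<Rightarrow> complex) \<Rightarrow> nat \<Rightarrow> complex" where
  "unsplit_coords \<alpha> w i =
     (if i = 0 then w 0
      else if odd i then 1 / (2 * coord_scale \<alpha> i) * (w i + w (i + 1))
      else - (\<i> / (2 * coord_scale \<alpha> i)) * (w (i - 1) - w i))"

lemma split_coords_simps:
  "split_coords \<alpha> u 0 = u 0"
  "split_coords \<alpha> u (2 * l + 1)
    = coord_scale \<alpha> (2 * l + 1) * u (2 * l + 1) + \<i> * (coord_scale \<alpha> (2 * l + 2) * u (2 * l + 2))"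
  "split_coords \<alpha> u (2 * l + 2)
    = coord_scale \<alpha> (2 * l + 1) * u (2 * l + 1) - \<i> * (coord_scale \<alpha> (2 * l + 2) * u (2 * l + 2))"
  by (simp_all add: split_coords_def)

lemma unsplit_coords_simps:
  "unsplit_coords \<alpha> w 0 = w 0"
  "unsplit_coords \<alpha> w (2 * l + 1) = 1 / (2 * coord_scale \<alpha> (2 * l + 1)) * (w (2 * l + 1) + w (2 * l + 2))"
  "unsplit_coords \<alpha> w (2 * l + 2) = - (\<i> / (2 * coord_scale \<alpha> (2 * l + 2))) * (w (2 * l + 1) - w (2 * l + 2))"
  by (simp_all add: unsplit_coords_def)

lemma pair_index_cases:
  obtains "i = 0" | l where "i = 2 * l + 1" | l where "i = 2 * l + (2 :: nat)"
proof (cases "odd i")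
  case True
  then show ?thesis
    using that(2) by (auto elim: oddE)
next
  case False
  then obtain k where "i = 2 * k"
    by (auto elim: evenE)
  then show ?thesis
    using that(1) that(3)[of "k - 1"] by (cases k) auto
qed

lemma coord_scale_nonzero: "\<alpha> \<noteq> 0 \<Longrightarrow> coord_scale \<alpha> i \<noteq> 0"
  by (simp add: coord_scale_def)

lemma unsplit_split_coords: "\<alpha> \<noteq> 0 \<Longrightarrow> unsplit_coords \<alpha> (split_coords \<alpha> u) i = u i"
  by (cases i rule: pair_index_cases)
    (simp_all only: split_coords_simps unsplit_coords_simps, simp_all add: coord_scale_nonzero field_simps)

lemma split_unsplit_coords: "\<alpha> \<noteq> 0 \<Longrightarrow> split_coords \<alpha> (unsplit_coords \<alpha> w) i = w i"
  by (cases i rule: pair_index_cases)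
    (simp_all only: split_coords_simps unsplit_coords_simps, simp_all add: coord_scale_nonzero field_simps)

lemma split_coords_scale:
  "split_coords \<alpha> (\<lambda>i. c * u i) i = c * split_coords \<alpha> u i"
  "unsplit_coords \<alpha> (\<lambda>i. c * u i) i = c * unsplit_coords \<alpha> u i"
  by (simp_all add: split_coords_def unsplit_coords_def algebra_simps add_divide_distrib diff_divide_distrib)

lemma split_form_split_coords:
  "split_form m (split_coords \<alpha> u) = (\<Sum>i = 1..2 * m. (coord_scale \<alpha> i * u i)\<^sup>2)"
proof (induction m)
  case (Suc m)
  have "split_form (Suc m) (split_coords \<alpha> u)
      = split_form m (split_coords \<alpha> u) + split_coords \<alpha> u (2 * m + 1) * split_coords \<alpha> u (2 * m + 2)"
    by (simp add: split_form_def)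
  also have "split_coords \<alpha> u (2 * m + 1) * split_coords \<alpha> u (2 * m + 2)
      = (coord_scale \<alpha> (2 * m + 1) * u (2 * m + 1))\<^sup>2 + (coord_scale \<alpha> (2 * m + 2) * u (2 * m + 2))\<^sup>2"
    unfolding split_coords_simps by (simp add: power2_eq_square algebra_simps)
  finally show ?case
    using Suc by simp
qed (simp add: split_form_def)

lemma Q_eq_split_form:
  assumes "n \<ge> 1"
  shows "Q \<alpha> n u = split_form (n + 1) (split_coords \<alpha> u)"
proof -
  let ?f = "\<lambda>i. (coord_scale \<alpha> i * u i)\<^sup>2"
  \<comment> \<open>The sum is cut at 4, beyond which all coefficients are 1; n \<ge> 1 enters
    through 4 + (2 * n - 2) = 2 * n + 2.\<close>
  have "split_form (n + 1) (split_coords \<alpha> u) = sum ?f {1..4 + (2 * n - 2)}"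
    unfolding split_form_split_coords using assms by (intro arg_cong[of _ _ "sum ?f"]) auto
  also have "\<dots> = sum ?f {1..4} + sum ?f {4 + 1..4 + (2 * n - 2)}"
    by (rule sum.ub_add_nat) simp
  also have "sum ?f {4 + 1..4 + (2 * n - 2)} = (\<Sum>i=5..2*n+2. (u i)\<^sup>2)"
    using assms by (intro sum.cong) (auto simp: coord_scale_def)
  also have "{1..4} = {1, 2, 3, 4 :: nat}"
    by auto
  finally show ?thesis
    by (simp add: Q_def coord_scale_def power_divide power_mult_distrib algebra_simps)
qed

text \<open>The change of coordinates mixes the two indices of a pair, so it acts on vectors over I
  only if I contains both or neither of them.\<close>

definition paired :: "nat set \<Rightarrow> bool" where
  "paired I \<longleftrightarrow> (\<forall>l. 2 * l + 1 \<in> I \<longleftrightarrow> 2 * l + 2 \<in> I)"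

lemma paired_intervals: "paired {0..2 * n + 2}" "paired {1..2 * n + 2}"
  by (auto simp: paired_def)

lemma inverse_scale_gauss_rat: "1 / (2 * coord_scale \<alpha> i) \<in> gauss_rat" "- (\<i> / (2 * coord_scale \<alpha> i)) \<in> gauss_rat"
proof -
  obtain r where r: "coord_scale \<alpha> i = of_rat r"
    by (metis of_rat_1 of_rat_divide coord_scale_def)
  have "1 / (2 * coord_scale \<alpha> i) = of_rat (1 / (2 * r))"
    unfolding r by (simp add: of_rat_divide of_rat_mult)
  then show "1 / (2 * coord_scale \<alpha> i) \<in> gauss_rat"
    by simp
  have "- (\<i> / (2 * coord_scale \<alpha> i)) = of_rat 0 + \<i> * of_rat (- 1 / (2 * r))"
    unfolding r by (simp add: of_rat_divide of_rat_mult of_rat_minus)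
  then show "- (\<i> / (2 * coord_scale \<alpha> i)) \<in> gauss_rat"
    unfolding gauss_rat_def by blast
qed

lemma scale_gauss_rat: "coord_scale \<alpha> i \<in> gauss_rat"
  by (metis gauss_rat_of_rat of_rat_1 of_rat_divide coord_scale_def)

lemma poly_fun_split_coords:
  assumes "paired I" "i \<in> I"
  shows "(\<lambda>u. split_coords \<alpha> u i) \<in> poly_fun I" "(\<lambda>w. unsplit_coords \<alpha> w i) \<in> poly_fun I"
proof -
  have c: "(\<lambda>_. coord_scale \<alpha> i) \<in> poly_fun I" "(\<lambda>_. \<i>) \<in> poly_fun I"
    "(\<lambda>_. 1 / (2 * coord_scale \<alpha> i)) \<in> poly_fun I" "(\<lambda>_. - (\<i> / (2 * coord_scale \<alpha> i))) \<in> poly_fun I" for i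
    by (intro poly_fun.const scale_gauss_rat inverse_scale_gauss_rat gauss_rat_i)+
  show "(\<lambda>u. split_coords \<alpha> u i) \<in> poly_fun I"
  proof (cases i rule: pair_index_cases)
    case (2 l)
    then show ?thesis
      using assms unfolding 2 split_coords_simps
      by (intro poly_fun.add poly_fun.mult c poly_fun.coord) (auto simp: paired_def)
  next
    case (3 l)
    then show ?thesis
      using assms unfolding 3 split_coords_simps
      by (intro poly_fun_diff poly_fun.mult c poly_fun.coord) (auto simp: paired_def)
  qed (use assms in \<open>auto simp: split_coords_simps intro: poly_fun.coord\<close>)
  show "(\<lambda>w. unsplit_coords \<alpha> w i) \<in> poly_fun I"
  proof (cases i rule: pair_index_cases)
    case (2 l)
    then show ?thesis
      using assms unfolding 2 unsplit_coords_simps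
      by (intro poly_fun.add poly_fun.mult c poly_fun.coord) (auto simp: paired_def)
  next
    case (3 l)
    then show ?thesis
      using assms unfolding 3 unsplit_coords_simps
      by (intro poly_fun_diff poly_fun.mult c poly_fun.coord) (auto simp: paired_def)
  qed (use assms in \<open>auto simp: unsplit_coords_simps intro: poly_fun.coord\<close>)
qed

lemma affine_sub_split_coords:
  assumes \<alpha>: "\<alpha> \<noteq> 0" and I: "paired I"
  shows "affine_sub I {u \<in> vectors I. R (restrict (split_coords \<alpha> u) I)}
    \<cong>\<^sub>v affine_sub I {w \<in> vectors I. R w}"
proof -
  have res: "split_coords \<alpha> (restrict u I) i = split_coords \<alpha> u i"
    "unsplit_coords \<alpha> (restrict u I) i = unsplit_coords \<alpha> u i" if "i \<in> I" for u i
    using poly_fun_restrict[OF poly_fun_split_coords(1)[OF I that]]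
      poly_fun_restrict[OF poly_fun_split_coords(2)[OF I that]] by auto
  have 1: "restrict (split_coords \<alpha> (restrict (unsplit_coords \<alpha> w) I)) I = w" if "w \<in> vectors I" for w
    using that by (auto simp: fun_eq_iff res split_unsplit_coords[OF \<alpha>] PiE_def extensional_def)
  have 2: "restrict (unsplit_coords \<alpha> (restrict (split_coords \<alpha> u) I)) I = u" if "u \<in> vectors I" for u
    using that by (auto simp: fun_eq_iff res unsplit_split_coords[OF \<alpha>] PiE_def extensional_def)
  show ?thesis
  proof (rule isomorphic_affine_subspaces[of _ I _ I
        "\<lambda>u. restrict (split_coords \<alpha> u) I" "\<lambda>w. restrict (unsplit_coords \<alpha> w) I"])
    show "regular_on I {u \<in> vectors I. R (restrict (split_coords \<alpha> u) I)}
        (\<lambda>u. restrict (split_coords \<alpha> u) I i)" if "i \<in> I" for i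
      using that by (intro regular_on_poly[OF poly_fun_split_coords(1)[OF I that]]) simp
    show "regular_on I {w \<in> vectors I. R w} (\<lambda>w. restrict (unsplit_coords \<alpha> w) I i)"
      if "i \<in> I" for i
      using that by (intro regular_on_poly[OF poly_fun_split_coords(2)[OF I that]]) simp
  qed (use 1 2 in auto)
qed

lemma split_form_restrict: "{1..2 * m} \<subseteq> I \<Longrightarrow> split_form m (restrict w I) = split_form m w"
  by (rule poly_fun_restrict[OF poly_fun_split_form])

section \<open>Classes of the two affine complements\<close>

lemma K0_class_affine_cone_complement:
  assumes "n \<ge> 1" "\<alpha> \<noteq> 0"
  shows "K0_class (complement (affine_space {0..2*n+2}) (affine_cone \<alpha> n))
    = \<bbbL> ^ (2*n+3) - \<bbbL> ^ (2*n+2) - \<bbbL> ^ (n+2) + \<bbbL> ^ (n+1)"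
proof -
  let ?I = "{0..2 * n + 2}"
  have I: "{1..2 * (n + 1)} \<subseteq> ?I"
    by auto
  have "vectors ?I - affine_cone \<alpha> n
      = {u \<in> vectors ?I. split_form (n + 1) (restrict (split_coords \<alpha> u) ?I) \<noteq> 0}"
    unfolding affine_cone_def points_affine_space Q_eq_split_form[OF assms(1)] split_form_restrict[OF I]
    by auto
  then show ?thesis
    unfolding complement_def points_affine_space
    using K0_class_isomorphic[OF affine_sub_split_coords[OF assms(2) paired_intervals(1),
          where R = "\<lambda>w. split_form (n + 1) w \<noteq> 0"]]
      K0_class_split_form_nonzero[OF _ I] by (simp add: numeral_3_eq_3 numeral_2_eq_2)
qed

lemma K0_class_affine_cone_hyperplanes_complement:
  assumes "n \<ge> 1" "\<alpha> \<noteq> 0"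
  shows "K0_class (complement (affine_space {0..2*n+2}) (affine_cone \<alpha> n \<union> hyperplane n 0 \<union> hyperplane n 1))
    = \<bbbL> ^ (2*n+3) - 3 * \<bbbL> ^ (2*n+2) + 2 * \<bbbL> ^ (2*n+1)
      - \<bbbL> ^ (n+2) + 3 * \<bbbL> ^ (n+1) - 2 * \<bbbL> ^ n"
proof -
  let ?I = "{0..2 * n + 2}"
  let ?R = "\<lambda>w. split_form (n + 1) w \<noteq> 0 \<and> w 0 \<noteq> 0 \<and> w 0 \<noteq> 1"
  have I: "{1..2 * (n + 1)} \<subseteq> ?I"
    by auto
  \<comment> \<open>The change of coordinates fixes u 0, so the two hyperplanes keep their
    equations.\<close>
  have "vectors ?I - (affine_cone \<alpha> n \<union> hyperplane n 0 \<union> hyperplane n 1)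
      = {u \<in> vectors ?I. ?R (restrict (split_coords \<alpha> u) ?I)}"
    unfolding affine_cone_def hyperplane_def points_affine_space Q_eq_split_form[OF assms(1)]
      split_form_restrict[OF I]
    by (auto simp: split_coords_simps)
  then show ?thesis
    unfolding complement_def points_affine_space
    using K0_class_isomorphic[OF affine_sub_split_coords[OF assms(2) paired_intervals(1), where R = ?R]]
      K0_class_split_form_nonzero_minus_hyperplanes[of n] by simp
qed

section \<open>A closed affine model of the projective complement\<close>

text \<open>Affine coordinates are indexed by natural numbers, so positions in a matrix are coded by
  the pairing function.\<close>

abbreviation entry :: "(nat \<Rightarrow> complex) \<Rightarrow> nat \<Rightarrow> nat \<Rightarrow> complex" where
  "entry M a b \<equiv> M (prod_encode (a, b))"

definition entries :: "nat set \<Rightarrow> nat set" where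
  "entries I = prod_encode ` (I \<times> I)"

lemma prod_encode_entries [simp]: "prod_encode (a, b) \<in> entries I \<longleftrightarrow> a \<in> I \<and> b \<in> I"
  by (auto simp: entries_def)

lemma finite_entries: "finite I \<Longrightarrow> finite (entries I)"
  by (simp add: entries_def)

lemma entries_eqI:
  assumes "M \<in> extensional (entries I)" "N \<in> extensional (entries I)"
    "\<And>a b. a \<in> I \<Longrightarrow> b \<in> I \<Longrightarrow> entry M a b = entry N a b"
  shows "M = N"
  by (rule extensionalityI[OF assms(1,2)]) (use assms(3) in \<open>auto simp: entries_def\<close>)

text \<open>Numerator and denominator both have degree 2, so the matrix depends only on the point
  with homogeneous coordinates w.\<close>

definition outer :: "nat \<Rightarrow> nat set \<Rightarrow> (nat \<Rightarrow> complex) \<Rightarrow> nat \<Rightarrow> complex" where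
  "outer m I w = (\<lambda>k\<in>entries I. w (fst (prod_decode k)) * w (snd (prod_decode k)) / split_form m w)"

text \<open>The image of the complement of the quadric under the second Veronese embedding, normalised by
  the quadratic form: symmetric matrices of rank one on which the form takes the value \<open>1\<close>.\<close>

definition rank_one_equations :: "nat \<Rightarrow> nat set \<Rightarrow> ((nat \<Rightarrow> complex) \<Rightarrow> complex) set" where
  "rank_one_equations m I =
     (\<lambda>(a, b, c, d) M. entry M a b * entry M c d - entry M a d * entry M c b) ` (I \<times> I \<times> I \<times> I)
     \<union> (\<lambda>(a, b) M. entry M a b - entry M b a) ` (I \<times> I)
     \<union> {\<lambda>M. (\<Sum>l<m. entry M (2 * l + 1) (2 * l + 2)) - 1}"

definition rank_one :: "nat \<Rightarrow> nat set \<Rightarrow> (nat \<Rightarrow> complex) set" where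
  "rank_one m I = {M \<in> vectors (entries I). \<forall>p\<in>rank_one_equations m I. p M = 0}"

lemma entry_outer: "a \<in> I \<Longrightarrow> b \<in> I \<Longrightarrow> entry (outer m I w) a b = w a * w b / split_form m w"
  by (simp add: outer_def)

lemma mem_rank_one:
  "M \<in> rank_one m I \<longleftrightarrow> M \<in> vectors (entries I) \<and>
     (\<forall>a\<in>I. \<forall>b\<in>I. \<forall>c\<in>I. \<forall>d\<in>I. entry M a b * entry M c d = entry M a d * entry M c b) \<and>
     (\<forall>a\<in>I. \<forall>b\<in>I. entry M a b = entry M b a) \<and>
     (\<Sum>l<m. entry M (2 * l + 1) (2 * l + 2)) = 1"
  unfolding rank_one_def rank_one_equations_def by (auto simp: ball_Un)

lemma rank_one_equations_poly_fun:
  assumes "{1..2 * m} \<subseteq> I"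
  shows "rank_one_equations m I \<subseteq> poly_fun (entries I)"
proof -
  have "2 * l + 1 \<in> I \<and> 2 * l + 2 \<in> I" if "l < m" for l
    using assms that by (auto simp: subset_iff)
  then have "(\<lambda>M. (\<Sum>l<m. entry M (2 * l + 1) (2 * l + 2)) - 1) \<in> poly_fun (entries I)"
    by (intro poly_fun_diff poly_fun_sum poly_fun.coord poly_fun.const) auto
  moreover have "(\<lambda>M. entry M a b * entry M c d - entry M a d * entry M c b) \<in> poly_fun (entries I)"
    if "a \<in> I" "b \<in> I" "c \<in> I" "d \<in> I" for a b c d
    using that by (intro poly_fun_diff poly_fun.mult poly_fun.coord) auto
  moreover have "(\<lambda>M. entry M a b - entry M b a) \<in> poly_fun (entries I)" if "a \<in> I" "b \<in> I" for a b
    using that by (intro poly_fun_diff poly_fun.coord) auto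
  ultimately show ?thesis
    unfolding rank_one_equations_def by auto
qed

lemma quasi_affine_rank_one:
  assumes "{1..2 * m} \<subseteq> I"
  shows "quasi_affine (entries I) (rank_one m I)"
  unfolding rank_one_def
  by (intro quasi_affine_zeros quasi_affine_vectors rank_one_equations_poly_fun assms)

lemma outer_rank_one:
  assumes "{1..2 * m} \<subseteq> I" "split_form m w \<noteq> 0"
  shows "outer m I w \<in> rank_one m I"
proof -
  have "(\<Sum>l<m. entry (outer m I w) (2 * l + 1) (2 * l + 2))
      = (\<Sum>l<m. w (2 * l + 1) * w (2 * l + 2) / split_form m w)"
    using assms(1) by (intro sum.cong refl entry_outer) (auto simp: subset_iff)
  also have "\<dots> = 1"
    using assms(2) unfolding sum_divide_distrib[symmetric] split_form_def[symmetric] by simp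
  finally show ?thesis
    unfolding mem_rank_one by (auto simp: entry_outer) (auto simp: outer_def)
qed

lemma split_form_cong:
  assumes "\<And>i. i \<in> {1..2 * m} \<Longrightarrow> v i = c * w i"
  shows "split_form m v = c\<^sup>2 * split_form m w"
  unfolding split_form_def sum_distrib_left
  by (rule sum.cong) (use assms in \<open>auto simp: power2_eq_square\<close>)

lemma outer_cong:
  assumes I: "{1..2 * m} \<subseteq> I" and c: "c \<noteq> 0" and eq: "\<And>i. i \<in> I \<Longrightarrow> v i = c * w i"
  shows "outer m I v = outer m I w"
proof (rule entries_eqI)
  have "split_form m v = c\<^sup>2 * split_form m w"
    using I eq by (intro split_form_cong) auto
  then show "entry (outer m I v) a b = entry (outer m I w) a b" if "a \<in> I" "b \<in> I" for a b
    using that eq c by (simp add: entry_outer power2_eq_square)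
qed (auto simp: outer_def)

text \<open>For M = (w_a w_b / q(w)), row i is a multiple of w. So a row with nonzero diagonal entry
  recovers the point; by the minors, the form takes on it the value M_ii times the value of the form
  on M, which is 1.\<close>

lemma rank_one_row:
  assumes I: "{1..2 * m} \<subseteq> I" and M: "M \<in> rank_one m I" and i: "i \<in> I" "entry M i i \<noteq> 0"
  shows "split_form m (entry M i) = entry M i i" "outer m I (entry M i) = M"
proof -
  have minor: "entry M i a * entry M i b = entry M i i * entry M a b" if "a \<in> I" "b \<in> I" for a b
  proof -
    have "entry M a i = entry M i a" "entry M a b * entry M i i = entry M a i * entry M i b"
      using M i(1) that unfolding mem_rank_one by blast+
    then show ?thesis
      by (simp add: mult.commute)
  qed
  have "split_form m (entry M i) = (\<Sum>l<m. entry M i i * entry M (2 * l + 1) (2 * l + 2))"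
    unfolding split_form_def using I by (intro sum.cong refl minor) (auto simp: subset_iff)
  also have "\<dots> = entry M i i"
    using M unfolding sum_distrib_left[symmetric] mem_rank_one by simp
  finally show form: "split_form m (entry M i) = entry M i i" .
  show "outer m I (entry M i) = M"
  proof (rule entries_eqI)
    show "M \<in> extensional (entries I)"
      using M by (simp add: mem_rank_one PiE_def)
    show "entry (outer m I (entry M i)) a b = entry M a b" if "a \<in> I" "b \<in> I" for a b
      using that minor[OF that] i(2) by (simp add: entry_outer form)
  qed (simp add: outer_def)
qed

text \<open>The diagonal controls the matrix: a vanishing diagonal entry kills its row and column,
  and two nonvanishing ones force the entry where they cross to be nonzero.\<close>

lemma rank_one_square:
  assumes "M \<in> rank_one m I" "a \<in> I" "b \<in> I"
  shows "(entry M a b)\<^sup>2 = entry M a a * entry M b b"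
proof -
  have "entry M a b = entry M b a" "entry M a a * entry M b b = entry M a b * entry M b a"
    using assms unfolding mem_rank_one by blast+
  then show ?thesis
    by (simp add: power2_eq_square)
qed

text \<open>Otherwise every summand of the normalisation, whose square is a product of an odd and an
  even diagonal entry, would vanish, while the sum is 1. This makes the strata exhaust the rank one
  matrices.\<close>

lemma rank_one_odd_diagonal:
  assumes I: "{1..2 * m} \<subseteq> I" and M: "M \<in> rank_one m I"
  shows "\<exists>l<m. entry M (2 * l + 1) (2 * l + 1) \<noteq> 0"
proof (rule ccontr)
  assume zero: "\<not> ?thesis"
  have "(entry M (2 * l + 1) (2 * l + 2))\<^sup>2 = 0" if "l < m" for l
    using rank_one_square[OF M, of "2 * l + 1" "2 * l + 2"] zero I that
    by (auto simp: subset_iff)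
  then have "(\<Sum>l<m. entry M (2 * l + 1) (2 * l + 2)) = 0"
    by (intro sum.neutral) auto
  then show False
    using M by (simp add: mem_rank_one)
qed

section \<open>Stratification of the rank one matrices\<close>

text \<open>In contrast to the affine strata, J also drops the index 2 * j + 1, whose coordinate is
  normalised to 1. This costs one dimension and leaves a single inequation, the nonvanishing of the
  form.\<close>

lemma rank_one_stratum:
  assumes I: "{1..2 * m} \<subseteq> I" and j: "j < m"
  defines "J \<equiv> I - (\<lambda>l. 2 * l + 1) ` {..<Suc j}"
  shows "affine_sub (entries I) {M \<in> rank_one m I.
      (\<forall>l<j. entry M (2 * l + 1) (2 * l + 1) = 0) \<and> entry M (2 * j + 1) (2 * j + 1) \<noteq> 0}
    \<cong>\<^sub>v affine_sub J {w \<in> vectors J. w (2 * j + 2) \<noteq> 0}"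
    (is "affine_sub _ ?S \<cong>\<^sub>v affine_sub J ?T")
proof -
  define t s where "t = 2 * j + 1" and "s = 2 * j + 2"
  \<comment> \<open>With w normalised by w_t = 1 the entries are w_a w_b / q(w): the value of q is 1
    / M_tt, and w_i is M_ti / M_tt. Position s receives the value of q in place of w_s.\<close>
  define \<phi> where "\<phi> M = (\<lambda>i\<in>J. if i = s then 1 / entry M t t else entry M t i / entry M t t)" for M
  \<comment> \<open>The normalised vector rebuilt: 1 at t, the solution of q = w s at position s,
    and 0 at the earlier odd indices.\<close>
  define v where "v w i = (if i = s then w s - tail_form j m w else if i \<in> J then w i
    else if i = t then 1 else 0)" for w :: "nat \<Rightarrow> complex" and i
  have S: "?S = {M \<in> rank_one m I. (\<forall>l<j. entry M (2 * l + 1) (2 * l + 1) = 0) \<and> entry M t t \<noteq> 0}"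
    and T: "?T = {w \<in> vectors J. w s \<noteq> 0}"
    by (simp_all add: t_def s_def)
  have J: "s \<in> J" "t \<notin> J" "{s<..2 * m} \<subseteq> J" "J \<subseteq> I" "t \<in> I" "s \<in> I" "t \<noteq> s"
    using I j by (auto simp: J_def t_def s_def subset_iff image_iff; presburger)+
  have odd: "2 * l + 1 \<in> I" "2 * l + 1 \<notin> J" "2 * l + 1 \<noteq> s" "2 * l + 1 \<noteq> t" if "l < j" for l
    using I j that by (auto simp: J_def t_def s_def subset_iff image_iff; presburger)+
  have JI: "i \<in> J \<or> i = t \<or> (\<exists>l<j. i = 2 * l + 1)" if "i \<in> I" for i
    using that by (auto simp: J_def t_def less_Suc_eq)
  have form_v: "split_form m (v w) = w s" for w
  proof -
    have "tail_form j m (v w) = 1\<^sup>2 * tail_form j m w"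
      by (rule tail_form_cong) (use J(3) in \<open>auto simp: v_def s_def subset_iff\<close>)
    moreover have "split_form m (v w) = v w t * v w s + tail_form j m (v w)"
      unfolding t_def s_def by (rule split_form_eq_tail_form[OF j]) (use odd in \<open>simp add: v_def\<close>)
    ultimately show ?thesis
      using J by (simp add: v_def)
  qed
  have entry_v: "entry (outer m I (v w)) a b = v w a * v w b / w s" if "a \<in> I" "b \<in> I" for w a b
    using entry_outer[OF that] by (simp add: form_v)
  have v_t: "v w t = 1" for w
    using J by (simp add: v_def)
  have v_odd: "v w (2 * l + 1) = 0" if "l < j" for w l
    using odd[OF that] by (simp add: v_def)
  have poly_v: "(\<lambda>w. v w i) \<in> poly_fun J" for i
  proof -
    have "(\<lambda>w. w s - tail_form j m w) \<in> poly_fun J"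
      using J by (intro poly_fun_diff poly_fun.coord poly_fun_tail_form) (auto simp: s_def)
    then show ?thesis
      by (cases "i = s"; cases "i \<in> J"; cases "i = t") (auto simp: v_def intro: poly_fun.intros)
  qed
  show ?thesis
    unfolding S T
  proof (rule isomorphic_affine_subspaces[of _ _ _ _ \<phi> "\<lambda>w. outer m I (v w)"])
    show "regular_on (entries I) {M \<in> rank_one m I. (\<forall>l<j. entry M (2 * l + 1) (2 * l + 1) = 0)
        \<and> entry M t t \<noteq> 0} (\<lambda>M. \<phi> M i)" if "i \<in> J" for i
      using that J
      by (intro regular_on_quotient[of "if i = s then (\<lambda>_. 1) else (\<lambda>M. entry M t i)" _ "\<lambda>M. entry M t t"])
        (auto simp: \<phi>_def subset_iff intro: poly_fun.intros)
    show "regular_on J {w \<in> vectors J. w s \<noteq> 0} (\<lambda>w. outer m I (v w) k)" if k: "k \<in> entries I" for k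
    proof -
      obtain a b where "k = prod_encode (a, b)" "a \<in> I" "b \<in> I"
        using k by (auto simp: entries_def)
      then show ?thesis
        using J by (intro regular_on_quotient[of "\<lambda>w. v w a * v w b" _ "\<lambda>w. w s"])
          (auto simp: entry_v intro: poly_fun.intros poly_v)
    qed
    show "\<phi> M \<in> {w \<in> vectors J. w s \<noteq> 0}" if "M \<in> {M \<in> rank_one m I.
        (\<forall>l<j. entry M (2 * l + 1) (2 * l + 1) = 0) \<and> entry M t t \<noteq> 0}" for M
      using that J by (auto simp: \<phi>_def)
    show "outer m I (v w) \<in> {M \<in> rank_one m I. (\<forall>l<j. entry M (2 * l + 1) (2 * l + 1) = 0)
        \<and> entry M t t \<noteq> 0}" if "w \<in> {w \<in> vectors J. w s \<noteq> 0}" for w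
      using that outer_rank_one[OF I, of "v w"] J odd v_odd by (auto simp: form_v entry_v v_t)
    show "\<phi> (outer m I (v w)) = w" if w: "w \<in> {w \<in> vectors J. w s \<noteq> 0}" for w
    proof
      fix i
      show "\<phi> (outer m I (v w)) i = w i"
        using w J by (auto simp: \<phi>_def entry_v v_t v_def PiE_def extensional_def subset_iff)
    qed
    show "outer m I (v (\<phi> M)) = M" if "M \<in> {M \<in> rank_one m I.
        (\<forall>l<j. entry M (2 * l + 1) (2 * l + 1) = 0) \<and> entry M t t \<noteq> 0}" for M
    proof -
      define d where "d = entry M t t"
      have M: "M \<in> rank_one m I" "d \<noteq> 0"
        and zero: "\<And>l. l < j \<Longrightarrow> entry M (2 * l + 1) (2 * l + 1) = 0"
        using that by (auto simp: d_def)
      note row = rank_one_row[OF I M(1) J(5) M(2)[unfolded d_def]]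
      have row_odd: "entry M t (2 * l + 1) = 0" if "l < j" for l
        using rank_one_square[OF M(1) J(5) odd(1)[OF that]] zero[OF that] by simp
      \<comment> \<open>The form takes the value d on row t, which determines the tail of that row.
        Inserted into the formula for the solved coordinate, it gives M_ts / d, so
        \<open>v (\<phi> M)\<close> is row t divided by d.\<close>
      have "split_form m (entry M t) = entry M t t * entry M t s + tail_form j m (entry M t)"
        unfolding t_def s_def
        by (rule split_form_eq_tail_form[OF j]) (use row_odd in \<open>simp add: t_def\<close>)
      then have d: "d = d * entry M t s + tail_form j m (entry M t)"
        using row(1) by (simp add: d_def)
      have "tail_form j m (\<phi> M) = (1 / d)\<^sup>2 * tail_form j m (entry M t)"
        by (rule tail_form_cong) (use J(3) in \<open>auto simp: \<phi>_def d_def s_def subset_iff\<close>)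
      also have "tail_form j m (entry M t) = d - d * entry M t s"
        using d by (simp add: algebra_simps)
      finally have "tail_form j m (\<phi> M) = (1 / d)\<^sup>2 * (d - d * entry M t s)" .
      moreover have "v (\<phi> M) s = \<phi> M s - tail_form j m (\<phi> M)" "\<phi> M s = 1 / d"
        using J(1) by (simp_all add: v_def \<phi>_def d_def)
      ultimately have "v (\<phi> M) s = 1 / d - (1 / d)\<^sup>2 * (d - d * entry M t s)"
        by (simp only:)
      then have vs: "v (\<phi> M) s = 1 / d * entry M t s"
        using M(2) by (simp add: power2_eq_square field_simps)
      have "v (\<phi> M) i = 1 / d * entry M t i" if i: "i \<in> I" for i
      proof (cases "i = s")
        case False
        then show ?thesis
          using JI[OF i] J M(2) row_odd odd by (auto simp: v_def \<phi>_def d_def)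
      qed (use vs in simp)
      then have "outer m I (v (\<phi> M)) = outer m I (entry M t)"
        using M(2) by (intro outer_cong[OF I, of "1 / d"]) auto
      then show ?thesis
        using row(2) by simp
    qed
  qed (auto simp: mem_rank_one)
qed

text \<open>The diagonal entry at 2 * l + 1 is a square divided by q, so its vanishing encodes that
  of the odd coordinate. The strata contribute L^(2m-1-j) - L^(2m-2-j), and the locus for j = m is
  empty.\<close>

lemma K0_class_rank_one_strata:
  assumes I: "I = {1..2 * m}" and "j \<le> m"
  shows "K0_class (affine_sub (entries I) {M \<in> rank_one m I. \<forall>l<j. entry M (2 * l + 1) (2 * l + 1) = 0})
    = \<bbbL> ^ (2 * m - 1 - j) - \<bbbL> ^ (m - 1)"
  using \<open>j \<le> m\<close>
proof (induction j rule: inc_induct)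
  case base
  have II: "{1..2 * m} \<subseteq> I" and fin: "finite (entries I)"
    using I finite_entries by auto
  have empty: "{M \<in> rank_one m I. \<forall>l<m. entry M (2 * l + 1) (2 * l + 1) = 0} = {}"
    using rank_one_odd_diagonal[OF II] by auto
  show ?case
    unfolding empty using K0_class_empty[OF fin] by (simp add: mult_2)
next
  case (step j)
  have II: "{1..2 * m} \<subseteq> I" and fin: "finite (entries I)" "finite I"
    using I finite_entries by auto
  let ?F = "\<lambda>j. {M \<in> rank_one m I. \<forall>l<j. entry M (2 * l + 1) (2 * l + 1) = 0}"
  let ?J = "I - (\<lambda>l. 2 * l + 1) ` {..<Suc j}"
  have i: "2 * l + 1 \<in> I" if "l < m" for l
    using II that by (auto simp: subset_iff)
  have "quasi_affine (entries I) {M \<in> rank_one m I. \<forall>g\<in>(\<lambda>l M. entry M (2 * l + 1) (2 * l + 1)) ` {..<j}. g M = 0}"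
    by (intro quasi_affine_zeros quasi_affine_rank_one II)
      (use i step.hyps in \<open>auto intro: poly_fun.coord\<close>)
  then have qa: "quasi_affine (entries I) (?F j)"
    by (rule back_subst) auto
  have g: "(\<lambda>M. entry M (2 * j + 1) (2 * j + 1)) \<in> poly_fun (entries I)"
    by (intro poly_fun.coord) (simp only: prod_encode_entries i[OF step.hyps(2)] simp_thms)
  have zero: "{M \<in> ?F j. entry M (2 * j + 1) (2 * j + 1) = 0} = ?F (Suc j)"
    by (auto simp: less_Suc_eq)
  have nonzero: "{M \<in> ?F j. entry M (2 * j + 1) (2 * j + 1) \<noteq> 0} = {M \<in> rank_one m I.
      (\<forall>l<j. entry M (2 * l + 1) (2 * l + 1) = 0) \<and> entry M (2 * j + 1) (2 * j + 1) \<noteq> 0}"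
    by auto
  have "2 * j + 2 \<in> ?J"
    using II step.hyps by (auto simp: subset_iff image_iff; presburger)+
  then have stratum: "K0_class (affine_sub ?J {w \<in> vectors ?J. w (2 * j + 2) \<noteq> 0})
      = \<bbbL> ^ (2 * m - 1 - j) - \<bbbL> ^ (2 * m - 1 - Suc j)"
    using K0_class_coordinate_nonzero[of ?J "2 * j + 2"] fin(2) step.hyps
      card_minus_odd[OF fin(2) II, of "Suc j"] by (simp add: I)
  show ?case
    unfolding K0_class_split[OF fin(1) qa g] zero nonzero
      K0_class_isomorphic[OF rank_one_stratum[OF II step.hyps(2)]] stratum step.IH
    by simp
qed

lemma K0_class_rank_one:
  "K0_class (affine_sub (entries {1..2 * m}) (rank_one m {1..2 * m})) = \<bbbL> ^ (2 * m - 1) - \<bbbL> ^ (m - 1)"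
  using K0_class_rank_one_strata[OF refl, of 0 m] by simp

section \<open>Homogeneous forms and points of projective space\<close>

lemma form_fun_poly: "p \<in> form_fun I d \<Longrightarrow> p \<in> poly_fun I"
  by (simp add: form_fun_def)

lemma form_fun_scale: "p \<in> form_fun I d \<Longrightarrow> u \<in> vectors I \<Longrightarrow> p (\<lambda>i\<in>I. c * u i) = c ^ d * p u"
  by (simp add: form_fun_def del: poly_fun_restrict)

lemma form_fun_const: "c \<in> gauss_rat \<Longrightarrow> (\<lambda>_. c) \<in> form_fun I 0"
  by (simp add: form_fun_def poly_fun.const)

lemma form_fun_add: "p \<in> form_fun I d \<Longrightarrow> q \<in> form_fun I d \<Longrightarrow> (\<lambda>u. p u + q u) \<in> form_fun I d"
  by (simp add: form_fun_def poly_fun.add distrib_left del: poly_fun_restrict)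

lemma form_fun_mult:
  "p \<in> form_fun I d \<Longrightarrow> q \<in> form_fun I e \<Longrightarrow> (\<lambda>u. p u * q u) \<in> form_fun I (d + e)"
  by (simp add: form_fun_def poly_fun.mult power_add del: poly_fun_restrict)

lemma form_fun_power: "p \<in> form_fun I d \<Longrightarrow> (\<lambda>u. p u ^ k) \<in> form_fun I (d * k)"
  by (simp add: form_fun_def poly_fun_power power_mult_distrib power_mult del: poly_fun_restrict)

lemma mem_proj_points:
  assumes "P \<in> proj_points I" "u \<in> P"
  shows "u \<in> vectors I" "\<exists>i\<in>I. u i \<noteq> 0" "P = proj_point I u"
proof -
  obtain v c i where v: "P = proj_point I v" "v \<in> vectors I" "i \<in> I" "v i \<noteq> 0"
    and c: "u = (\<lambda>i\<in>I. c * v i)" "c \<noteq> 0"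
    using assms unfolding proj_points_def proj_point_def by auto
  show "u \<in> vectors I" "\<exists>i\<in>I. u i \<noteq> 0"
    using v c by auto
  have "\<exists>b. (\<lambda>i\<in>I. a * v i) = (\<lambda>i\<in>I. b * u i) \<and> b \<noteq> 0" if "a \<noteq> 0" for a
    using that c by (intro exI[of _ "a / c"]) (auto simp: fun_eq_iff)
  moreover have "\<exists>b. (\<lambda>i\<in>I. a * u i) = (\<lambda>i\<in>I. b * v i) \<and> b \<noteq> 0" if "a \<noteq> 0" for a
    using that c by (intro exI[of _ "a * c"]) (auto simp: fun_eq_iff)
  ultimately show "P = proj_point I u"
    unfolding v(1) proj_point_def by (auto simp: set_eq_iff)
qed

lemma proj_point_self: "u \<in> vectors I \<Longrightarrow> u \<in> proj_point I u"
  unfolding proj_point_def by (intro CollectI exI[of _ 1]) (auto simp: fun_eq_iff PiE_def extensional_def)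

lemma proj_point_in_proj_points: "u \<in> vectors I \<Longrightarrow> i \<in> I \<Longrightarrow> u i \<noteq> 0 \<Longrightarrow> proj_point I u \<in> proj_points I"
  unfolding proj_points_def by auto

lemma proj_point_same:
  assumes "P \<in> proj_points I" "u \<in> P" "v \<in> P"
  obtains c where "c \<noteq> 0" "v = (\<lambda>i\<in>I. c * u i)"
  using mem_proj_points(3)[OF assms(1,2)] assms(3) unfolding proj_point_def by auto

lemma proj_point_nonempty: "P \<in> proj_points I \<Longrightarrow> \<exists>u. u \<in> P"
  unfolding proj_points_def using proj_point_self by auto

text \<open>Homogeneity makes nonvanishing independent of the coordinate vector, so conditions on
  all vectors of a point can be tested on one.\<close>

lemma form_nonzero_iff:
  assumes "p \<in> form_fun I d" "P \<in> proj_points I" "u \<in> P"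
  shows "(\<forall>v\<in>P. p v \<noteq> 0) \<longleftrightarrow> p u \<noteq> 0"
proof
  assume u: "p u \<noteq> 0"
  show "\<forall>v\<in>P. p v \<noteq> 0"
  proof
    fix v assume "v \<in> P"
    then obtain c where "c \<noteq> 0" "v = (\<lambda>i\<in>I. c * u i)"
      by (rule proj_point_same[OF assms(2,3)])
    then show "p v \<noteq> 0"
      using u form_fun_scale[OF assms(1) mem_proj_points(1)[OF assms(2,3)]] by simp
  qed
qed (use assms in auto)

lemma points_proj_space [simp]: "points (proj_space I) = proj_points I"
proof -
  have "proj_points I \<in> {{P \<in> proj_points I. \<forall>u\<in>P. p u \<noteq> 0} | p d. p \<in> form_fun I d}"
    by (intro CollectI exI[of _ "\<lambda>_. 1"] exI[of _ 0]) (auto intro: form_fun_const)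
  then show ?thesis
    by (auto simp: proj_space_def)
qed

lemma openin_proj_basic:
  "p \<in> form_fun I d \<Longrightarrow> openin (zar (proj_space I)) {P \<in> proj_points I. \<forall>u\<in>P. p u \<noteq> 0}"
  unfolding proj_space_def fspace.sel
  by (rule topology_generated_by_Basis) auto

lemma sections_proj_space:
  "f \<in> sections (proj_space I) U \<longleftrightarrow> f \<in> extensional U \<and>
     (\<forall>P\<in>U. \<exists>d. \<exists>p\<in>form_fun I d. \<exists>q\<in>form_fun I d.
        (\<forall>u\<in>P. q u \<noteq> 0) \<and> (\<forall>R\<in>U. \<forall>u\<in>R. q u \<noteq> 0 \<longrightarrow> f R = p u / q u))"
  by (simp add: proj_space_def)

lemma is_sheaf_proj_subspace: "is_sheaf (subspace_of (proj_space I) S)"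
proof (rule is_sheaf_subspace_of_presheaf)
  fix U f W assume f: "f \<in> sections (proj_space I) U" and W: "W \<subseteq> U"
  show "restrict f W \<in> sections (proj_space I) W"
    unfolding sections_proj_space
  proof (intro conjI ballI)
    fix P assume P: "P \<in> W"
    have "\<forall>P\<in>U. \<exists>d. \<exists>p\<in>form_fun I d. \<exists>q\<in>form_fun I d.
        (\<forall>u\<in>P. q u \<noteq> 0) \<and> (\<forall>R\<in>U. \<forall>u\<in>R. q u \<noteq> 0 \<longrightarrow> f R = p u / q u)"
      using f by (simp add: sections_proj_space)
    from bspec[OF this subsetD[OF W P]] obtain d p q where "p \<in> form_fun I d" "q \<in> form_fun I d"
      "\<forall>u\<in>P. q u \<noteq> 0" "\<forall>R\<in>U. \<forall>u\<in>R. q u \<noteq> 0 \<longrightarrow> f R = p u / q u"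
      by auto
    then show "\<exists>d. \<exists>p\<in>form_fun I d. \<exists>q\<in>form_fun I d. (\<forall>u\<in>P. q u \<noteq> 0)
        \<and> (\<forall>R\<in>W. \<forall>u\<in>R. q u \<noteq> 0 \<longrightarrow> restrict f W R = p u / q u)"
      using W by - (rule exI[of _ d], rule bexI[of _ p], rule bexI[of _ q], auto)
  qed simp
qed

section \<open>The normalised Veronese isomorphism\<close>

context
  fixes m :: nat and I :: "nat set" and \<alpha> :: rat
  assumes I: "{1..2 * m} \<subseteq> I" and paired: "paired I" and \<alpha>: "\<alpha> \<noteq> 0"
begin

definition qform :: "(nat \<Rightarrow> complex) \<Rightarrow> complex" where
  "qform u = split_form m (split_coords \<alpha> u)"

definition qcompl :: "(nat \<Rightarrow> complex) set set" where
  "qcompl = {P \<in> proj_points I. \<exists>u\<in>P. qform u \<noteq> 0}"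

text \<open>The choice of coordinates is harmless: \<open>outer\<close> is invariant under scaling,
  and the change of coordinates is linear.\<close>

definition veronese :: "(nat \<Rightarrow> complex) set \<Rightarrow> nat \<Rightarrow> complex" where
  "veronese P = outer m I (split_coords \<alpha> (SOME u. u \<in> P))"

definition row_vector :: "nat \<Rightarrow> (nat \<Rightarrow> complex) \<Rightarrow> nat \<Rightarrow> complex" where
  "row_vector i M = restrict (unsplit_coords \<alpha> (entry M i)) I"

definition unveronese :: "(nat \<Rightarrow> complex) \<Rightarrow> (nat \<Rightarrow> complex) set" where
  "unveronese M = proj_point I (row_vector (SOME i. i \<in> I \<and> entry M i i \<noteq> 0) M)"

lemma split_coords_restrict:
  "i \<in> I \<Longrightarrow> split_coords \<alpha> (restrict u I) i = split_coords \<alpha> u i"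
  "i \<in> I \<Longrightarrow> unsplit_coords \<alpha> (restrict u I) i = unsplit_coords \<alpha> u i"
  using poly_fun_restrict[OF poly_fun_split_coords(1)[OF paired]]
    poly_fun_restrict[OF poly_fun_split_coords(2)[OF paired]] by auto

lemma split_coords_scaled: "i \<in> I \<Longrightarrow> split_coords \<alpha> (\<lambda>i\<in>I. c * u i) i = c * split_coords \<alpha> u i"
  unfolding split_coords_restrict split_coords_scale by simp

lemma form_fun_split_coords: "i \<in> I \<Longrightarrow> (\<lambda>u. split_coords \<alpha> u i) \<in> form_fun I 1"
  by (simp add: form_fun_def poly_fun_split_coords[OF paired] split_coords_scaled)

lemma form_fun_qform: "qform \<in> form_fun I 2"
  unfolding form_fun_def
proof (intro CollectI conjI ballI allI)
  show "qform \<in> poly_fun I"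
    unfolding qform_def[abs_def]
    by (intro poly_fun_subst[OF poly_fun_split_form[OF I]] poly_fun_split_coords[OF paired])
  show "qform (\<lambda>i\<in>I. c * u i) = c\<^sup>2 * qform u" for c u
    unfolding qform_def using I by (intro split_form_cong split_coords_scaled) auto
qed

lemma mem_qcompl:
  assumes "P \<in> proj_points I" "u \<in> P"
  shows "P \<in> qcompl \<longleftrightarrow> qform u \<noteq> 0"
  using form_nonzero_iff[OF form_fun_qform assms(1)] assms unfolding qcompl_def by auto

lemma veronese_eq:
  assumes "P \<in> proj_points I" "u \<in> P"
  shows "veronese P = outer m I (split_coords \<alpha> u)"
proof -
  have "(SOME u. u \<in> P) \<in> P"
    using someI[of "\<lambda>u. u \<in> P", OF assms(2)] .
  then obtain c where "c \<noteq> 0" "(SOME u. u \<in> P) = (\<lambda>i\<in>I. c * u i)"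
    by (rule proj_point_same[OF assms])
  then show ?thesis
    unfolding veronese_def by (intro outer_cong[OF I, of c]) (auto simp: split_coords_scaled)
qed

lemma veronese_rank_one:
  assumes "P \<in> qcompl"
  shows "veronese P \<in> rank_one m I"
proof -
  have P: "P \<in> proj_points I"
    using assms by (simp add: qcompl_def)
  then obtain u where u: "u \<in> P"
    using proj_point_nonempty by blast
  then show ?thesis
    using outer_rank_one[OF I] mem_qcompl[OF P u] assms
    unfolding veronese_eq[OF P u] qform_def by simp
qed

lemma split_coords_row_vector: "a \<in> I \<Longrightarrow> split_coords \<alpha> (row_vector i M) a = entry M i a"
  unfolding row_vector_def by (simp add: split_coords_restrict split_unsplit_coords[OF \<alpha>])

lemma row_vector_nonzero:
  assumes "i \<in> I" "entry M i i \<noteq> 0"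
  shows "proj_point I (row_vector i M) \<in> proj_points I" "row_vector i M \<in> proj_point I (row_vector i M)"
proof -
  have v: "row_vector i M \<in> vectors I"
    by (simp add: row_vector_def)
  then show "row_vector i M \<in> proj_point I (row_vector i M)"
    by (rule proj_point_self)
  \<comment> \<open>The change of coordinates is linear: if the row vector vanished, so would row i,
    including its diagonal entry.\<close>
  have "\<exists>a\<in>I. row_vector i M a \<noteq> 0"
  proof (rule ccontr)
    assume zero: "\<not> ?thesis"
    have "split_coords \<alpha> (row_vector i M) i = split_coords \<alpha> (\<lambda>_. 0) i"
      by (rule poly_fun_cong[OF poly_fun_split_coords(1)[OF paired assms(1)]]) (use zero in simp)
    also have "\<dots> = 0"
      by (simp add: split_coords_def)
    finally show False
      using assms by (simp add: split_coords_row_vector)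
  qed
  then show "proj_point I (row_vector i M) \<in> proj_points I"
    using proj_point_in_proj_points[OF v] by auto
qed

text \<open>Rows k and i are proportional with ratio M_ik / M_ii, which is nonzero by
  \<open>rank_one_square\<close>. So the row chosen in \<open>unveronese\<close> can be replaced by
  any row with nonzero diagonal entry.\<close>

lemma unveronese_eq:
  assumes M: "M \<in> rank_one m I" and i: "i \<in> I" "entry M i i \<noteq> 0"
  shows "unveronese M = proj_point I (row_vector i M)"
proof -
  define k where "k = (SOME i. i \<in> I \<and> entry M i i \<noteq> 0)"
  have k: "k \<in> I" "entry M k k \<noteq> 0"
    using someI[of "\<lambda>i. i \<in> I \<and> entry M i i \<noteq> 0" i] i by (auto simp: k_def)
  define c where "c = entry M i k / entry M i i"
  have "entry M k a = c * entry M i a" if "a \<in> I" for a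
  proof -
    have "entry M k a * entry M i i = entry M k i * entry M i a" "entry M k i = entry M i k"
      using M that i k unfolding mem_rank_one by blast+
    then show ?thesis
      using i by (simp add: c_def field_simps)
  qed
  then have "unsplit_coords \<alpha> (entry M k) a = c * unsplit_coords \<alpha> (entry M i) a" if "a \<in> I" for a
    unfolding split_coords_scale(2)[symmetric]
    by (rule poly_fun_cong[OF poly_fun_split_coords(2)[OF paired that]])
  then have *: "row_vector k M = (\<lambda>a\<in>I. c * row_vector i M a)"
    by (auto simp: row_vector_def fun_eq_iff)
  have "(entry M i k)\<^sup>2 \<noteq> 0"
    using rank_one_square[OF M i(1) k(1)] i k by simp
  then have "c \<noteq> 0"
    using i by (simp add: c_def)
  then have "row_vector k M \<in> proj_point I (row_vector i M)"
    unfolding * proj_point_def by auto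
  then show ?thesis
    using mem_proj_points(3)[OF row_vector_nonzero(1)[of i M, OF i]] unfolding unveronese_def k_def by simp
qed

lemma rank_one_diagonal:
  assumes "M \<in> rank_one m I"
  shows "\<exists>i\<in>I. entry M i i \<noteq> 0"
proof -
  obtain l where "l < m" "entry M (2 * l + 1) (2 * l + 1) \<noteq> 0"
    using rank_one_odd_diagonal[OF I assms] by auto
  then show ?thesis
    using subsetD[OF I, of "2 * l + 1"] by (intro bexI[of _ "2 * l + 1"]) simp_all
qed

lemma unveronese_qcompl:
  assumes M: "M \<in> rank_one m I"
  shows "unveronese M \<in> qcompl" "veronese (unveronese M) = M"
proof -
  obtain i where i: "i \<in> I" "entry M i i \<noteq> 0"
    using rank_one_diagonal[OF M] by blast
  note P = row_vector_nonzero[of i M, OF i]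
  have "qform (row_vector i M) = 1\<^sup>2 * split_form m (entry M i)"
    unfolding qform_def using I by (intro split_form_cong) (auto simp: split_coords_row_vector)
  then have "qform (row_vector i M) \<noteq> 0"
    using rank_one_row(1)[OF I M i] i by simp
  then show "unveronese M \<in> qcompl"
    unfolding unveronese_eq[OF M i] by (simp add: mem_qcompl[OF P])
  have "outer m I (split_coords \<alpha> (row_vector i M)) = outer m I (entry M i)"
    by (rule outer_cong[OF I, of 1]) (auto simp: split_coords_row_vector)
  then show "veronese (unveronese M) = M"
    unfolding unveronese_eq[OF M i] veronese_eq[OF P] using rank_one_row(2)[OF I M i] by simp
qed

lemma unveronese_veronese:
  assumes "P \<in> qcompl"
  shows "unveronese (veronese P) = P"
proof -
  have P: "P \<in> proj_points I"
    using assms by (simp add: qcompl_def)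
  then obtain u where u: "u \<in> P"
    using proj_point_nonempty by blast
  define w where "w = split_coords \<alpha> u"
  have q: "split_form m w \<noteq> 0"
    using mem_qcompl[OF P u] assms by (simp add: qform_def w_def)
  have V: "veronese P = outer m I w"
    unfolding w_def by (rule veronese_eq[OF P u])
  obtain i where i: "i \<in> I" "entry (veronese P) i i \<noteq> 0"
    using rank_one_diagonal[OF veronese_rank_one[OF assms]] by blast
  \<comment> \<open>Row i of the matrix (w_a w_b / q(w)) is c times w, so undoing the change of
    coordinates gives c times u.\<close>
  define c where "c = w i / split_form m w"
  have c: "c \<noteq> 0"
    using i q unfolding V c_def by (auto simp: entry_outer)
  have "row_vector i (veronese P) = (\<lambda>a\<in>I. c * u a)"
  proof
    fix a
    have "unsplit_coords \<alpha> (entry (veronese P) i) a = unsplit_coords \<alpha> (\<lambda>b. c * w b) a" if "a \<in> I"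
      by (rule poly_fun_cong[OF poly_fun_split_coords(2)[OF paired that]])
        (use i in \<open>simp add: V entry_outer c_def\<close>)
    then show "row_vector i (veronese P) a = (\<lambda>a\<in>I. c * u a) a"
      by (auto simp: row_vector_def split_coords_scale w_def unsplit_split_coords[OF \<alpha>])
  qed
  then have "row_vector i (veronese P) \<in> P"
    using c mem_proj_points(3)[OF P u] unfolding proj_point_def by auto
  then show ?thesis
    using mem_proj_points(3)[OF P] unfolding unveronese_eq[OF veronese_rank_one[OF assms] i] by simp
qed

text \<open>Each entry is a quadratic form over q, and sums are brought to a common power of q.
  Polynomials thus pull back to fractions of degree 0, the shape that sections of
  \<open>proj_space\<close> require.\<close>

lemma poly_fun_outer:
  assumes "r \<in> poly_fun (entries I)"
  shows "\<exists>k. \<exists>R\<in>form_fun I (2 * k). \<forall>u. qform u \<noteq> 0 \<longrightarrow>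
    r (outer m I (split_coords \<alpha> u)) = R u / qform u ^ k"
  using assms
proof induction
  case (const c)
  then show ?case
    by (intro exI[of _ 0] bexI[of _ "\<lambda>_. c"]) (auto intro: form_fun_const)
next
  case (coord k)
  then obtain a b where k: "k = prod_encode (a, b)" "a \<in> I" "b \<in> I"
    by (auto simp: entries_def)
  have "(\<lambda>u. split_coords \<alpha> u a * split_coords \<alpha> u b) \<in> form_fun I (1 + 1)"
    by (intro form_fun_mult form_fun_split_coords k)
  then show ?case
    using k by (intro exI[of _ 1] bexI[of _ "\<lambda>u. split_coords \<alpha> u a * split_coords \<alpha> u b"])
      (auto simp: entry_outer qform_def numeral_2_eq_2)
next
  case (add p q)
  obtain k R where 1: "R \<in> form_fun I (2 * k)"
    "\<forall>u. qform u \<noteq> 0 \<longrightarrow> p (outer m I (split_coords \<alpha> u)) = R u / qform u ^ k"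
    using add.IH(1) by auto
  obtain l T where 2: "T \<in> form_fun I (2 * l)"
    "\<forall>u. qform u \<noteq> 0 \<longrightarrow> q (outer m I (split_coords \<alpha> u)) = T u / qform u ^ l"
    using add.IH(2) by auto
  have "(\<lambda>u. T u * qform u ^ k) \<in> form_fun I (2 * k + 2 * l)"
    unfolding add.commute[of "2 * k"] by (intro form_fun_mult 2 form_fun_power form_fun_qform)
  moreover have "(\<lambda>u. R u * qform u ^ l) \<in> form_fun I (2 * k + 2 * l)"
    by (intro form_fun_mult 1 form_fun_power form_fun_qform)
  ultimately have "(\<lambda>u. R u * qform u ^ l + T u * qform u ^ k) \<in> form_fun I (2 * k + 2 * l)"
    by (rule form_fun_add[rotated])
  then show ?case
    using 1 2 by (intro exI[of _ "k + l"] bexI[of _ "\<lambda>u. R u * qform u ^ l + T u * qform u ^ k"])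
      (auto simp: field_simps power_add)
next
  case (mult p q)
  obtain k R where 1: "R \<in> form_fun I (2 * k)"
    "\<forall>u. qform u \<noteq> 0 \<longrightarrow> p (outer m I (split_coords \<alpha> u)) = R u / qform u ^ k"
    using mult.IH(1) by auto
  obtain l T where 2: "T \<in> form_fun I (2 * l)"
    "\<forall>u. qform u \<noteq> 0 \<longrightarrow> q (outer m I (split_coords \<alpha> u)) = T u / qform u ^ l"
    using mult.IH(2) by auto
  have "(\<lambda>u. R u * T u) \<in> form_fun I (2 * k + 2 * l)"
    by (intro form_fun_mult 1 2)
  then show ?case
    using 1 2 by (intro exI[of _ "k + l"] bexI[of _ "\<lambda>u. R u * T u"]) (auto simp: power_add)
qed

lemma veronese_form:
  assumes "r \<in> poly_fun (entries I)"
  obtains k R where "R \<in> form_fun I (2 * k)"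
    "\<forall>P\<in>qcompl. \<forall>u\<in>P. r (veronese P) = R u / qform u ^ k"
proof -
  obtain k R where R: "R \<in> form_fun I (2 * k)"
    "\<forall>u. qform u \<noteq> 0 \<longrightarrow> r (outer m I (split_coords \<alpha> u)) = R u / qform u ^ k"
    using poly_fun_outer[OF assms] by auto
  have "r (veronese P) = R u / qform u ^ k" if "P \<in> qcompl" "u \<in> P" for P u
  proof -
    have P: "P \<in> proj_points I"
      using that by (simp add: qcompl_def)
    show ?thesis
      using R(2) mem_qcompl[OF P that(2)] that(1) unfolding veronese_eq[OF P that(2)] by simp
  qed
  then show thesis
    using that R(1) by blast
qed

text \<open>\<open>morphism_into_affine_space\<close> asks for a \<open>ringed\<close> source, which
  is not known for the projective complement before this isomorphism is established. Continuity and
  pullback of sections are therefore read off from the fractions in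
  \<open>veronese_form\<close>.\<close>

lemma morphism_veronese:
  "morphism (subspace_of (proj_space I) qcompl) (affine_sub (entries I) (rank_one m I)) veronese"
proof (rule morphism_into_subspace[OF is_sheaf_proj_subspace])
  let ?X = "subspace_of (proj_space I) qcompl"
  have pts: "points ?X = qcompl"
    by (auto simp: qcompl_def)
  have vec: "veronese P \<in> vectors (entries I)" if "P \<in> qcompl" for P
    using veronese_rank_one[OF that] by (simp add: mem_rank_one)
  have cont: "continuous_map (zar ?X) (zar (affine_space (entries I))) veronese"
    unfolding affine_space_def fspace.sel
  proof (rule continuous_on_generated_topo)
    fix U assume "U \<in> {{u \<in> vectors (entries I). p u \<noteq> 0} | p. p \<in> poly_fun (entries I)}"
    then obtain r where r: "r \<in> poly_fun (entries I)" "U = {u \<in> vectors (entries I). r u \<noteq> 0}"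
      by auto
    obtain k R where R: "R \<in> form_fun I (2 * k)"
      "\<forall>P\<in>qcompl. \<forall>u\<in>P. r (veronese P) = R u / qform u ^ k"
      by (rule veronese_form[OF r(1)])
    have "P \<in> veronese -` U \<inter> points ?X \<longleftrightarrow>
        P \<in> {P \<in> proj_points I. \<forall>u\<in>P. R u \<noteq> 0} \<inter> qcompl" for P
    proof (cases "P \<in> qcompl")
      case True
      then have P: "P \<in> proj_points I"
        by (simp add: qcompl_def)
      then obtain u where u: "u \<in> P"
        using proj_point_nonempty by blast
      have "(\<forall>u\<in>P. R u \<noteq> 0) \<longleftrightarrow> r (veronese P) \<noteq> 0"
        using form_nonzero_iff[OF R(1) P u] R(2) True u mem_qcompl[OF P u] by auto
      then show ?thesis
        unfolding pts r(2) using True P vec by simp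
    qed (simp add: pts)
    then have "veronese -` U \<inter> points ?X = {P \<in> proj_points I. \<forall>u\<in>P. R u \<noteq> 0} \<inter> qcompl"
      by blast
    then show "openin (zar ?X) (veronese -` U \<inter> points ?X)"
      unfolding zar_subspace_of openin_subtopology using openin_proj_basic[OF R(1)] by blast
  next
    show "veronese ` points ?X \<subseteq> \<Union>{{u \<in> vectors (entries I). p u \<noteq> 0} | p. p \<in> poly_fun (entries I)}"
      unfolding pts using vec points_affine_space[of "entries I"] by (auto simp: affine_space_def)
  qed
  show "morphism ?X (affine_space (entries I)) veronese"
    unfolding morphism_def
  proof (intro conjI cont allI impI ballI)
    fix U f assume U: "openin (zar (affine_space (entries I))) U" and f: "f \<in> sections (affine_space (entries I)) U"
    let ?P = "{P \<in> points ?X. veronese P \<in> U}"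
    show "restrict (f \<circ> veronese) ?P \<in> sections ?X ?P"
      unfolding sections_subspace_of
    proof (intro conjI ballI)
      fix P0 assume P0: "P0 \<in> ?P"
      have "regular_on (entries I) U f"
        using f by (simp add: sections_affine_space)
      then obtain p q where pq: "p \<in> poly_fun (entries I)" "q \<in> poly_fun (entries I)" "q (veronese P0) \<noteq> 0"
        "\<forall>y\<in>U. q y \<noteq> 0 \<longrightarrow> f y = p y / q y"
        by (rule regular_onE[of "entries I" U f "veronese P0"]) (use P0 in auto)
      obtain k R where R: "R \<in> form_fun I (2 * k)" "\<forall>P\<in>qcompl. \<forall>u\<in>P. p (veronese P) = R u / qform u ^ k"
        by (rule veronese_form[OF pq(1)])
      obtain l T where T: "T \<in> form_fun I (2 * l)" "\<forall>P\<in>qcompl. \<forall>u\<in>P. q (veronese P) = T u / qform u ^ l"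
        by (rule veronese_form[OF pq(2)])
      \<comment> \<open>Cross-multiplied, p / q becomes \<open>?n\<close> / \<open>?d\<close>, two
        forms of equal degree. The neighbourhood is defined by \<open>?e\<close> instead of
        \<open>?d\<close>, since \<open>?e\<close> has a factor \<open>qform\<close> even for k = 0
        and so confines it to \<open>qcompl\<close>.\<close>
      let ?n = "\<lambda>u. R u * qform u ^ l" and ?d = "\<lambda>u. T u * qform u ^ k" and ?e = "\<lambda>u. T u * qform u"
      let ?V = "{P \<in> proj_points I. \<forall>u\<in>P. ?e u \<noteq> 0}"
      have forms: "?n \<in> form_fun I (2 * k + 2 * l)" "?d \<in> form_fun I (2 * l + 2 * k)" "?e \<in> form_fun I (2 * l + 2)"
        by (intro form_fun_mult R(1) T(1) form_fun_power form_fun_qform)+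
      note d_form = forms(2)[unfolded add.commute[of "2 * l"]]
      have V: "P \<in> ?V \<longleftrightarrow> P \<in> qcompl \<and> q (veronese P) \<noteq> 0" for P
      proof (cases "P \<in> proj_points I")
        case True
        then obtain u where u: "u \<in> P"
          using proj_point_nonempty by blast
        show ?thesis
          using form_nonzero_iff[OF forms(3) True u] mem_qcompl[OF True u] T(2) u True by auto
      qed (simp add: qcompl_def)
      let ?g = "\<lambda>P\<in>?V. p (veronese P) / q (veronese P)"
      have "?g \<in> sections (proj_space I) ?V"
        unfolding sections_proj_space
      proof (intro conjI ballI)
        fix P assume P: "P \<in> ?V"
        have eq: "?g S = ?n u / ?d u" if "S \<in> ?V" "u \<in> S" for S u
        proof -
          have S: "S \<in> qcompl"
            using that V by auto
          then have "qform u \<noteq> 0"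
            using mem_qcompl[of S u] that by auto
          moreover have "?g S = p (veronese S) / q (veronese S)"
            using that by simp
          ultimately show ?thesis
            using R(2) T(2) S that by (simp add: field_simps)
        qed
        have nz: "?d u \<noteq> 0" if "u \<in> P" for u
          using P that by auto
        show "\<exists>d. \<exists>p\<in>form_fun I d. \<exists>q\<in>form_fun I d. (\<forall>u\<in>P. q u \<noteq> 0)
            \<and> (\<forall>S\<in>?V. \<forall>u\<in>S. q u \<noteq> 0 \<longrightarrow> ?g S = p u / q u)"
          by (rule exI, rule bexI[OF _ forms(1)], rule bexI[OF _ d_form], intro conjI ballI impI)
            (rule nz eq; assumption)+
      qed simp
      moreover have "P0 \<in> ?V"
        using P0 pq(3) V unfolding pts by blast
      moreover have "\<forall>P\<in>?P \<inter> ?V. restrict (f \<circ> veronese) ?P P = ?g P"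
        using pq(4) V by auto
      ultimately show "\<exists>V. \<exists>g\<in>sections (proj_space I) V. openin (zar (proj_space I)) V \<and> P0 \<in> V
          \<and> (\<forall>P\<in>?P \<inter> V. restrict (f \<circ> veronese) ?P P = g P)"
        using openin_proj_basic[OF forms(3)] by - (rule exI[of _ ?V], rule bexI[of _ ?g], simp_all only: simp_thms)
    qed simp
  qed
qed (simp add: veronese_rank_one qcompl_def)

lemma form_row_vector:
  assumes "p \<in> form_fun I d" "i \<in> I"
  shows "(\<lambda>M. p (row_vector i M)) \<in> poly_fun (entries I)"
proof (rule poly_fun_subst[OF form_fun_poly[OF assms(1)]])
  fix a assume a: "a \<in> I"
  have "(\<lambda>M. unsplit_coords \<alpha> (entry M i) a) \<in> poly_fun (entries I)"
    by (rule poly_fun_subst[OF poly_fun_split_coords(2)[OF paired a]]) (use assms(2) in \<open>auto intro: poly_fun.coord\<close>)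
  then show "(\<lambda>M. row_vector i M a) \<in> poly_fun (entries I)"
    using a by (simp add: row_vector_def)
qed

text \<open>On the chart M_ii \<noteq> 0 the point is given by row i, whose coordinates are
  polynomial in the matrix; by \<open>rank_one_diagonal\<close> these charts cover.\<close>

lemma morphism_unveronese:
  "morphism (affine_sub (entries I) (rank_one m I)) (subspace_of (proj_space I) qcompl) unveronese"
proof (rule morphism_into_subspace)
  let ?X = "affine_sub (entries I) (rank_one m I)"
  have VE: "rank_one m I \<subseteq> vectors (entries I)"
    by (auto simp: rank_one_def)
  have pts: "points ?X = rank_one m I"
    by (rule points_affine_subspace[OF VE])
  show "is_sheaf ?X"
    by (intro is_sheaf_subspace_of is_sheaf_affine_space)
  show "unveronese M \<in> qcompl" if "M \<in> points ?X" for M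
    using that unveronese_qcompl(1) unfolding pts by simp
  have proj: "unveronese M \<in> proj_points I" if "M \<in> rank_one m I" for M
    using unveronese_qcompl(1)[OF that] by (simp add: qcompl_def)
  have cont: "continuous_map (zar ?X) (zar (proj_space I)) unveronese"
    unfolding proj_space_def fspace.sel
  proof (rule continuous_on_generated_topo)
    fix U assume "U \<in> {{P \<in> proj_points I. \<forall>u\<in>P. p u \<noteq> 0} | p d. p \<in> form_fun I d}"
    then obtain p d where p: "p \<in> form_fun I d" "U = {P \<in> proj_points I. \<forall>u\<in>P. p u \<noteq> 0}"
      by auto
    show "openin (zar ?X) (unveronese -` U \<inter> points ?X)"
      unfolding openin_affine_subspace[OF VE] pts
    proof (intro conjI ballI)
      fix M assume M: "M \<in> unveronese -` U \<inter> rank_one m I"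
      then obtain i where i: "i \<in> I" "entry M i i \<noteq> 0"
        using rank_one_diagonal by blast
      have iff: "N \<in> unveronese -` U \<longleftrightarrow> p (row_vector i N) \<noteq> 0"
        if "N \<in> rank_one m I" "entry N i i \<noteq> 0" for N
        using form_nonzero_iff[OF p(1) row_vector_nonzero[of i N, OF i(1) that(2)]] proj[OF that(1)]
          unveronese_eq[OF that(1) i(1) that(2)] by (simp add: p(2))
      \<comment> \<open>The factor \<open>entry N i i\<close> confines the neighbourhood to the
        chart in which row i represents the point.\<close>
      have "(\<lambda>N. entry N i i * p (row_vector i N)) \<in> poly_fun (entries I)"
        by (intro poly_fun.mult poly_fun.coord form_row_vector[OF p(1)] i) (simp add: i)
      moreover have "entry M i i * p (row_vector i M) \<noteq> 0"
        using M i iff[of M] by auto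
      moreover have "{N \<in> rank_one m I. entry N i i * p (row_vector i N) \<noteq> 0} \<subseteq> unveronese -` U \<inter> rank_one m I"
        using iff by auto
      ultimately show "\<exists>q\<in>poly_fun (entries I). q M \<noteq> 0 \<and> {N \<in> rank_one m I. q N \<noteq> 0} \<subseteq> unveronese -` U \<inter> rank_one m I"
        by - (rule bexI[of _ "\<lambda>N. entry N i i * p (row_vector i N)"], simp_all)
    qed auto
  next
    show "unveronese ` points ?X \<subseteq> \<Union>{{P \<in> proj_points I. \<forall>u\<in>P. p u \<noteq> 0} | p d. p \<in> form_fun I d}"
      unfolding pts using proj points_proj_space[of I] by (auto simp: proj_space_def)
  qed
  show "morphism ?X (proj_space I) unveronese"
    unfolding morphism_def
  proof (intro conjI cont allI impI ballI)
    fix U f assume U: "openin (zar (proj_space I)) U" and f: "f \<in> sections (proj_space I) U"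
    let ?W = "{M \<in> points ?X. unveronese M \<in> U}"
    have "regular_on (entries I) ?W (f \<circ> unveronese)"
      unfolding regular_on_def
    proof
      fix M assume M: "M \<in> ?W"
      then have M': "M \<in> rank_one m I" "unveronese M \<in> U"
        unfolding pts by auto
      obtain i where i: "i \<in> I" "entry M i i \<noteq> 0"
        using rank_one_diagonal[OF M'(1)] by blast
      have "\<forall>P\<in>U. \<exists>d. \<exists>p\<in>form_fun I d. \<exists>q\<in>form_fun I d.
          (\<forall>u\<in>P. q u \<noteq> 0) \<and> (\<forall>R\<in>U. \<forall>u\<in>R. q u \<noteq> 0 \<longrightarrow> f R = p u / q u)"
        using f by (simp add: sections_proj_space)
      from bspec[OF this M'(2)] obtain d p q where pq: "p \<in> form_fun I d" "q \<in> form_fun I d"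
        "\<forall>u\<in>unveronese M. q u \<noteq> 0" "\<forall>R\<in>U. \<forall>u\<in>R. q u \<noteq> 0 \<longrightarrow> f R = p u / q u"
        by auto
      \<comment> \<open>The common factor cancels in the quotient but makes the denominator vanish
        outside the chart of row i, where the formula is not claimed.\<close>
      let ?p = "\<lambda>N. entry N i i * p (row_vector i N)" and ?q = "\<lambda>N. entry N i i * q (row_vector i N)"
      have "?p \<in> poly_fun (entries I)" "?q \<in> poly_fun (entries I)"
        by (intro poly_fun.mult poly_fun.coord form_row_vector[OF pq(1)] form_row_vector[OF pq(2)] i; simp add: i)+
      moreover have mem: "row_vector i N \<in> unveronese N" if "N \<in> ?W" "entry N i i \<noteq> 0" for N
        using row_vector_nonzero(2)[of i N, OF i(1) that(2)] unveronese_eq[of N i, OF _ i(1) that(2)] that(1)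
        unfolding pts by simp
      then have "?q M \<noteq> 0"
        using pq(3) M i by auto
      moreover have "\<forall>N\<in>?W. ?q N \<noteq> 0 \<longrightarrow> (f \<circ> unveronese) N = ?p N / ?q N"
        using pq(4) mem by auto
      ultimately show "\<exists>p\<in>poly_fun (entries I). \<exists>q\<in>poly_fun (entries I). q M \<noteq> 0
          \<and> (\<forall>N\<in>?W. q N \<noteq> 0 \<longrightarrow> (f \<circ> unveronese) N = p N / q N)"
        by - (rule bexI[of _ ?p], rule bexI[of _ ?q], simp_all only: simp_thms)
    qed
    moreover have "?W \<subseteq> vectors (entries I)"
      unfolding pts using VE by auto
    ultimately show "restrict (f \<circ> unveronese) ?W \<in> sections ?X ?W"
      by (simp add: sections_affine_subspace)
  qed
qed

lemma proj_complement_isomorphic: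
  "subspace_of (proj_space I) {P \<in> proj_points I. \<exists>u\<in>P. split_form m (split_coords \<alpha> u) \<noteq> 0}
    \<cong>\<^sub>v affine_sub (entries I) (rank_one m I)"
  using morphism_veronese morphism_unveronese unveronese_veronese unveronese_qcompl(2)
  unfolding isomorphic_def qcompl_def[unfolded qform_def, symmetric]
  by (intro exI[of _ veronese] exI[of _ unveronese]) (auto simp: rank_one_def)

end

section \<open>The class of the projective complement\<close>

lemma K0_class_projective_complement:
  assumes "n \<ge> 1" "\<alpha> \<noteq> 0"
  shows "K0_class (complement (proj_space {1..2*n+2}) (quadric \<alpha> n)) = \<bbbL> ^ (2*n+1) - \<bbbL> ^ n"
proof -
  have I: "{1..2 * (n + 1)} \<subseteq> {1..2 * n + 2}" "{1..2 * n + 2} = {1..2 * (n + 1)}"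
    by auto
  have "proj_points {1..2*n+2} - quadric \<alpha> n
      = {P \<in> proj_points {1..2*n+2}. \<exists>u\<in>P. split_form (n + 1) (split_coords \<alpha> u) \<noteq> 0}"
    unfolding quadric_def points_proj_space Q_eq_split_form[OF assms(1)] by auto
  then show ?thesis
    unfolding complement_def points_proj_space
    using K0_class_isomorphic[OF proj_complement_isomorphic[OF I(1) paired_intervals(2) assms(2)]]
      K0_class_rank_one[of "n + 1"] unfolding I(2) by simp
qed

theorem theorem7p6:
  fixes n :: nat and \<alpha> :: rat
  assumes "n \<ge> 3" and "\<alpha> \<noteq> 0"
  shows "K0_class (complement (proj_space {1..2*n+2}) (quadric \<alpha> n)) = \<bbbL> ^ (2*n+1) - \<bbbL> ^ n
    \<and> K0_class (complement (affine_space {0..2*n+2}) (affine_cone \<alpha> n))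
        = \<bbbL> ^ (2*n+3) - \<bbbL> ^ (2*n+2) - \<bbbL> ^ (n+2) + \<bbbL> ^ (n+1)
    \<and> K0_class (complement (affine_space {0..2*n+2}) (affine_cone \<alpha> n \<union> hyperplane n 0 \<union> hyperplane n 1))
        = \<bbbL> ^ (2*n+3) - 3 * \<bbbL> ^ (2*n+2) + 2 * \<bbbL> ^ (2*n+1)
          - \<bbbL> ^ (n+2) + 3 * \<bbbL> ^ (n+1) - 2 * \<bbbL> ^ n"
  using assms
  by (intro conjI K0_class_projective_complement K0_class_affine_cone_complement
      K0_class_affine_cone_hyperplanes_complement) auto

end
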